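(* In $\mathbb{R}^n$: (i) every open ball $B_R$ is $(1,1)$-calibrable (with either constant signature); (ii) the complement $\mathbb{R}^n\setminus\overline{B_R}$ of every closed ball is $(1,1)$-calibrable with either constant signature, with a calibration $Z_0$ satisfying $\operatorname{div}Z_0=0$; (iii) every annulus $A_{R_0}^{R_1}=B_{R_1}\setminus\overline{B_{R_0}}$, $0<R_0<R_1$, is $(1,1)$-calibrable, for any choice of constant signature on each of its two boundary spheres.
   Context: For an open set $U\subset\mathbb{R}^n$ with smooth boundary, a signature is a continuous $\chi:\partial U\to\{-1,1\}$. $U$ is $(1,1)$-calibrable with signature $\chi$ if there exists a vector field $Z_0\in L^\infty(U;\mathbb{R}^n)$ with $\operatorname{div}Z_0\in L^2_{loc}$, $|Z_0|\le1$ on $U$, normal trace $[Z_0\cdot\nu]=\chi$ on $\partial U$ ($\nu$ the outer unit normal to $U$), and $\operatorname{div}Z_0$ constant on $U$. *)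

theory Defs
  imports "HOL-Analysis.Analysis"
begin

text \<open>Normalising constant omega_s = pi^(s/2) / Gamma(s/2+1), so that H^k agrees with
  k-dimensional surface measure on k-dimensional C^1 submanifolds.\<close>
definition hausdorff_const :: "real \<Rightarrow> real" where
  "hausdorff_const s = pi powr (s / 2) / Gamma (s / 2 + 1)"

text \<open>Contribution of one covering set (convention: the empty set contributes 0,
  and diam(C)^0 = 1 for nonempty C).\<close>
definition hausdorff_piece :: "real \<Rightarrow> 'a::metric_space set \<Rightarrow> real" where
  "hausdorff_piece s C =
     (if C = {} then 0
      else if s = 0 then hausdorff_const s
      else hausdorff_const s * (diameter C / 2) powr s)"

definition hausdorff_pre :: "real \<Rightarrow> real \<Rightarrow> 'a::metric_space set \<Rightarrow> ennreal" where
  "hausdorff_pre s \<delta> A =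
     (INF C \<in> {C :: nat \<Rightarrow> 'a set. A \<subseteq> (\<Union>i. C i) \<and> (\<forall>i. bounded (C i) \<and> diameter (C i) \<le> \<delta>)}.
        (\<Sum>i. ennreal (hausdorff_piece s (C i))))"

definition hausdorff_outer :: "real \<Rightarrow> 'a::metric_space set \<Rightarrow> ennreal" where
  "hausdorff_outer s A = (SUP \<delta> \<in> {0<..}. hausdorff_pre s \<delta> A)"

definition hausdorff_measure :: "real \<Rightarrow> 'a::euclidean_space measure" where
  "hausdorff_measure s = measure_of UNIV (sets borel) (hausdorff_outer s)"

definition test_fun :: "('a::euclidean_space \<Rightarrow> real) \<Rightarrow> ('a \<Rightarrow> 'a) \<Rightarrow> bool" where
  "test_fun \<phi> G \<longleftrightarrow>
     (\<forall>x. (\<phi> has_derivative (\<lambda>h. G x \<bullet> h)) (at x)) \<and> continuous_on UNIV G \<and>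
     compact (closure {x. \<phi> x \<noteq> 0})"

definition has_weak_div :: "('a::euclidean_space \<Rightarrow> 'a) \<Rightarrow> ('a \<Rightarrow> real) \<Rightarrow> 'a set \<Rightarrow> bool" where
  "has_weak_div Z g U \<longleftrightarrow>
     (\<forall>K. compact K \<and> K \<subseteq> U \<longrightarrow> set_integrable lebesgue K g) \<and>
     (\<forall>\<phi> G. test_fun \<phi> G \<and> closure {x. \<phi> x \<noteq> 0} \<subseteq> U \<longrightarrow>
        (\<integral>x\<in>U. Z x \<bullet> G x \<partial>lebesgue) = - (\<integral>x\<in>U. g x * \<phi> x \<partial>lebesgue))"

definition L2_loc :: "('a::euclidean_space \<Rightarrow> real) \<Rightarrow> 'a set \<Rightarrow> bool" where
  "L2_loc g U \<longleftrightarrow> set_borel_measurable lebesgue U g \<and>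
     (\<forall>K. compact K \<and> K \<subseteq> U \<longrightarrow> set_integrable lebesgue K (\<lambda>x. (g x)\<^sup>2))"

text \<open>Anzellotti's weak normal trace [Z . nu] = chi on the boundary of U, defined through the
  Gauss-Green formula with respect to (n-1)-dimensional Hausdorff measure on the boundary:
  int_U Z . grad phi + int_U phi div Z = int_{bd U} chi phi dH^{n-1}.\<close>
definition normal_trace_is :: "('a::euclidean_space \<Rightarrow> 'a) \<Rightarrow> ('a \<Rightarrow> real) \<Rightarrow> 'a set \<Rightarrow> ('a \<Rightarrow> real) \<Rightarrow> bool" where
  "normal_trace_is Z g U \<sigma> \<longleftrightarrow>
     (\<forall>\<phi> G. test_fun \<phi> G \<longrightarrow>
        (\<integral>x\<in>U. Z x \<bullet> G x \<partial>lebesgue) + (\<integral>x\<in>U. g x * \<phi> x \<partial>lebesgue)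
        = set_lebesgue_integral (hausdorff_measure (real DIM('a) - 1)) (frontier U) (\<lambda>x. \<sigma> x * \<phi> x))"

definition signature :: "'a::euclidean_space set \<Rightarrow> ('a \<Rightarrow> real) \<Rightarrow> bool" where
  "signature U \<sigma> \<longleftrightarrow> continuous_on (frontier U) \<sigma> \<and> \<sigma> ` frontier U \<subseteq> {-1, 1}"

definition calibration :: "'a::euclidean_space set \<Rightarrow> ('a \<Rightarrow> real) \<Rightarrow> ('a \<Rightarrow> 'a) \<Rightarrow> ('a \<Rightarrow> real) \<Rightarrow> bool" where
  "calibration U \<sigma> Z g \<longleftrightarrow>
     set_borel_measurable lebesgue U Z \<and>
     (AE x in lebesgue. x \<in> U \<longrightarrow> norm (Z x) \<le> 1) \<and>
     has_weak_div Z g U \<and> L2_loc g U \<and>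
     (\<exists>c. AE x in lebesgue. x \<in> U \<longrightarrow> g x = c) \<and>
     normal_trace_is Z g U \<sigma>"

definition calibrable11 :: "'a::euclidean_space set \<Rightarrow> ('a \<Rightarrow> real) \<Rightarrow> bool" where
  "calibrable11 U \<sigma> \<longleftrightarrow> signature U \<sigma> \<and> (\<exists>Z g. calibration U \<sigma> Z g)"

end

theory Submission
  imports Defs
begin

text \<open>All three calibrations are radial fields \<open>(A * r\<^sup>1\<^sup>-\<^sup>n + B * r) * (x - a) / r\<close> with
  \<open>r = norm (x - a)\<close>, whose divergence is the constant \<open>n * B\<close>; the prescribed signs on the
  boundary spheres determine \<open>A\<close> and \<open>B\<close>, and convexity of the profile bounds it by 1. In polar
  coordinates the Gauss--Green formula reduces to the fundamental theorem of calculus along rays,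
  with the cone measure \<open>\<sigma>\<close> of the unit sphere as boundary measure.

  It remains to identify the normalized Hausdorff measure of dimension \<open>n - 1\<close> on the sphere with
  \<open>\<sigma>\<close>. The bound \<open>\<sigma> \<le> H\<close> is an isodiametric inequality: a small piece of the sphere, thickened
  radially, has all its differences in a flat cylinder, and Steiner symmetrization in an orthonormal
  basis adapted to the cylinder bounds its volume. Conversely \<open>H (S) \<le> \<sigma> (S)\<close> by Vitali covering
  of the sphere \<open>S\<close> with small caps, whose \<open>\<sigma>\<close>-measure is asymptotically that of a flat disc.
  Equality of the finite total masses then gives equality on all Borel subsets of \<open>S\<close>.\<close>

text \<open>The normal trace is tested against the normalized Hausdorff measure, so Gauss--Green
  must hold with the exact constant: a surface measure known only up to a factor \<open>c\<close>
  would give the trace \<open>c * s\<close> instead of the sign \<open>s\<close>. Hence a sharp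
  isodiametric bound on one side and asymptotically flat caps on the other. Since the first bound
  holds on all Borel sets, the second is needed for a single number only, the total mass of the
  sphere.

  The coefficients are read off from the flux \<open>A + B * r ^ n\<close> of the field through the
  sphere of radius \<open>r\<close>, per unit of \<open>cone_measure\<close>. It must be
  \<open>s * R ^ (n - 1)\<close> on an outer boundary sphere and \<open>- s * R ^ (n - 1)\<close> on
  an inner one, where the outer normal points to the centre. A ball has no inner sphere, and
  \<open>A = 0\<close> removes the singularity at the centre; an exterior has no outer sphere, and
  \<open>B = 0\<close> keeps the field bounded and makes its divergence vanish. For an annulus the
  two conditions are a linear system with exactly one solution.\<close>

section \<open>Hausdorff measure\<close>

text \<open>Caratheodory's criterion for metric outer measures. The part \<open>Tk k\<close> of
  \<open>T\<close> at distance at least \<open>1 / (k + 1)\<close> from \<open>F\<close> is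
  separated from \<open>T \<inter> F\<close>, so \<open>sep\<close> applies to this pair. The rest
  of \<open>T - F\<close> lies in the shells \<open>R i\<close> with \<open>i \<ge> k\<close>.
  Shells of equal parity are separated from one another, which bounds the sum of all
  \<open>f (R i)\<close> by \<open>f T + f T\<close>; for finite \<open>f T\<close> the tails of
  that sum therefore vanish.\<close>

lemma closed_in_lambda_system:
  fixes f :: "'a::metric_space set \<Rightarrow> ennreal"
  assumes oms: "outer_measure_space UNIV f"
    and sep: "\<And>A B e. e > 0 \<Longrightarrow> (\<And>x y. x \<in> A \<Longrightarrow> y \<in> B \<Longrightarrow> e \<le> dist x y) \<Longrightarrow> f A + f B \<le> f (A \<union> B)"
    and F: "closed F"
  shows "F \<in> lambda_system UNIV UNIV f"
proof (cases "F = {}")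
  case True
  then show ?thesis
    using oms by (auto simp: lambda_system_def outer_measure_space_def positive_def)
next
  case False
  have pos: "f {} = 0" and mono: "\<And>A B. A \<subseteq> B \<Longrightarrow> f A \<le> f B"
    and csa: "countably_subadditive UNIV f"
    using oms by (auto simp: outer_measure_space_def positive_def increasing_def)
  have sub: "f (A \<union> B) \<le> f A + f B" for A B
  proof -
    interpret sigma_algebra UNIV UNIV using sigma_algebra_Pow[of UNIV] by simp
    show ?thesis
      using countably_subadditive_subadditive[of f] csa pos
      by (auto simp: subadditive_def positive_def countably_subadditive_def)
         (metis Diff_disjoint Un_Diff_cancel Diff_subset add_left_mono mono order_trans)
  qed
  \<comment> \<open>\<open>countably_subadditive\<close> speaks of disjoint families only;
    \<open>disjointed\<close> and monotonicity remove the restriction.\<close>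
  have csub: "f (\<Union>i. A i) \<le> (\<Sum>i. f (A i))" for A :: "nat \<Rightarrow> 'a set"
  proof -
    have "f (\<Union>i. A i) = f (\<Union>i. disjointed A i)" by (simp add: UN_disjointed_eq)
    also have "\<dots> \<le> (\<Sum>i. f (disjointed A i))"
      using csa by (auto simp: countably_subadditive_def disjoint_family_disjointed)
    also have "\<dots> \<le> (\<Sum>i. f (A i))"
      by (intro suminf_le mono disjointed_subset summableI)
    finally show ?thesis .
  qed
  define d where "d x = infdist x F" for x
  have d_lip: "d x - d y \<le> dist x y" for x y
    using infdist_triangle[of x F y] by (simp add: d_def)
  have main: "f (T \<inter> F) + f (T - F) \<le> f T" if fin: "f T < top" for T
  proof -
    define R where "R k = {x \<in> T. 1 / (real k + 2) \<le> d x \<and> d x < 1 / (real k + 1)}" for k :: nat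
    define Tk where "Tk k = {x \<in> T. 1 / (real k + 1) \<le> d x}" for k :: nat
    have alt: "(\<Sum>j<N. f (R (2 * j + p))) \<le> f (\<Union>j<N. R (2 * j + p))" for N p
    proof (induction N)
      case (Suc N)
      have far: "f (R (2 * N + p)) + f (\<Union>j<N. R (2 * j + p))
            \<le> f (R (2 * N + p) \<union> (\<Union>j<N. R (2 * j + p)))"
      \<comment> \<open>For \<open>N > 0\<close> the gap is the width of the shell with index
        \<open>2 * N + p - 1\<close>, which lies in between. For \<open>N = 0\<close> the union is
        empty, and the formula for the gap could divide by zero.\<close>
      proof (cases "N = 0")
        case False
        show ?thesis
        proof (rule sep)
          show "0 < 1 / (2 * real N + real p) - 1 / (2 * real N + real p + 1)"
          proof -
            have "1 / (2 * real N + real p + 1) < 1 / (2 * real N + real p)"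
              using False by (intro divide_strict_left_mono) (auto intro!: mult_pos_pos add_pos_nonneg)
            then show ?thesis by simp
          qed
        next
          fix x y assume x: "x \<in> R (2 * N + p)" and y: "y \<in> (\<Union>j<N. R (2 * j + p))"
          then obtain j where j: "j < N" "y \<in> R (2 * j + p)" by auto
          have "1 / (2 * real N + real p) \<le> 1 / (2 * real j + real p + 2)"
            using j by (intro divide_left_mono) auto
          also have "\<dots> \<le> d y" using j by (auto simp: R_def)
          finally have "1 / (2 * real N + real p) \<le> d y" .
          moreover have "d x < 1 / (2 * real N + real p + 1)" using x by (auto simp: R_def)
          ultimately show "1 / (2 * real N + real p) - 1 / (2 * real N + real p + 1) \<le> dist x y"
            using d_lip[of y x] by (simp add: dist_commute)
        qed
      qed (use pos in auto)
      have "(\<Sum>j<Suc N. f (R (2 * j + p))) \<le> f (R (2 * N + p)) + f (\<Union>j<N. R (2 * j + p))"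
        using Suc.IH by (simp add: add.commute add_left_mono)
      also note far
      also have "R (2 * N + p) \<union> (\<Union>j<N. R (2 * j + p)) = (\<Union>j<Suc N. R (2 * j + p))"
        by (simp add: lessThan_Suc)
      finally show ?case .
    qed simp
    have alt': "(\<Sum>j<N. f (R (2 * j + p))) \<le> f T" for N p
      by (rule order_trans[OF alt]) (auto intro!: mono simp: R_def)
    have "(\<Sum>j<2 * N. f (R j)) = (\<Sum>j<N. f (R (2 * j))) + (\<Sum>j<N. f (R (2 * j + 1)))" for N
      by (induction N) (auto simp: algebra_simps)
    then have even: "(\<Sum>j<2 * N. f (R j)) \<le> f T + f T" for N
      using alt'[where N=N and p=0] alt'[where N=N and p=1] by (simp add: add_mono)
    have Sfin: "(\<Sum>j. f (R j)) \<le> f T + f T"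
    proof (rule suminf_le_const[OF summableI])
      fix N
      have "(\<Sum>j<N. f (R j)) \<le> (\<Sum>j<2 * N. f (R j))" by (intro sum_mono2) auto
      then show "(\<Sum>j<N. f (R j)) \<le> f T + f T" using even[of N] by (rule order_trans)
    qed
    \<comment> \<open>This avoids subtraction in \<open>ennreal\<close>: the first \<open>k\<close>
      shells are added on the left, so that the tail on the right becomes the full sum. Letting
      \<open>k\<close> grow puts the full sum on both sides, where it cancels because it is
      finite.\<close>
    have "(\<Sum>i<k. f (R i)) + (f (T \<inter> F) + f (T - F)) \<le> f T + (\<Sum>j. f (R j))" for k
    proof -
      define R' where "R' i = (if i < k then {} else R i)" for i
      have "T - F \<subseteq> Tk k \<union> (\<Union>i. R' i)"
      proof
        fix x assume x: "x \<in> T - F"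
        then have "d x > 0"
          using F False in_closed_iff_infdist_zero[of F x] infdist_nonneg[of x F]
          by (auto simp: d_def less_le)
        show "x \<in> Tk k \<union> (\<Union>i. R' i)"
        proof (cases "1 / (real k + 1) \<le> d x")
          case True then show ?thesis using x by (auto simp: Tk_def)
        next
          case f: False
          have 1: "real k + 1 < 1 / d x" using f \<open>d x > 0\<close> by (simp add: field_simps)
          \<comment> \<open>\<open>x\<close> lies in the shell \<open>R m\<close> exactly when
            \<open>m + 1 < 1 / d x \<le> m + 2\<close>, that is, when the ceiling of
            \<open>1 / d x\<close> is \<open>m + 2\<close>.\<close>
          define m where "m = nat (\<lceil>1 / d x\<rceil> - 2)"
          have c: "1 / d x \<le> \<lceil>1 / d x\<rceil>" "\<lceil>1 / d x\<rceil> < 1 / d x + 1" by linarith+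
          have "\<lceil>1 / d x\<rceil> \<ge> int k + 2" using 1 c by linarith
          then have m: "real m = \<lceil>1 / d x\<rceil> - 2" "m \<ge> k" unfolding m_def by auto
          have "1 / d x \<le> real m + 2" "real m + 1 < 1 / d x" using m c by linarith+
          then have "x \<in> R m" using x \<open>d x > 0\<close> by (auto simp: R_def field_simps)
          then have "x \<in> R' m" using m by (simp add: R'_def)
          then show ?thesis by blast
        qed
      qed
      then have "f (T - F) \<le> f (Tk k) + (\<Sum>i. f (R' i))"
        by (rule order_trans[OF mono order_trans[OF sub add_left_mono[OF csub]]])
      then have "(\<Sum>i<k. f (R i)) + (f (T \<inter> F) + f (T - F))
          \<le> (f (T \<inter> F) + f (Tk k)) + ((\<Sum>i<k. f (R i)) + (\<Sum>i. f (R' i)))"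
        by (simp add: add_left_mono ac_simps)
      also have "f (T \<inter> F) + f (Tk k) \<le> f (T \<inter> F \<union> Tk k)"
      proof (rule sep)
        fix x y assume "x \<in> T \<inter> F" "y \<in> Tk k"
        then show "1 / (real k + 1) \<le> dist x y"
          using d_lip[of y x] by (auto simp: Tk_def d_def dist_commute)
      qed auto
      also have "\<dots> \<le> f T" by (intro mono) (auto simp: Tk_def)
      also have e1: "(\<Sum>i<k. f (R i)) = (\<Sum>i. if i < k then f (R i) else 0)"
        by (subst suminf_finite[of "{..<k}"]) auto
      also have "\<dots> + (\<Sum>i. f (R' i)) = (\<Sum>i. (if i < k then f (R i) else 0) + f (R' i))"
        by (rule suminf_add) auto
      also have "\<dots> = (\<Sum>i. f (R i))"
        by (intro suminf_cong) (auto simp: R'_def pos)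
      finally show ?thesis unfolding e1 by simp
    qed
    from ennreal_suminf_bound_add[OF this]
    have "(\<Sum>i. f (R i)) + (f (T \<inter> F) + f (T - F)) \<le> (\<Sum>i. f (R i)) + f T"
      by (simp add: ac_simps)
    moreover have "(\<Sum>i. f (R i)) < top"
      using Sfin fin by (meson ennreal_add_less_top le_less_trans)
    ultimately show ?thesis by (auto simp: ennreal_add_left_cancel_le)
  qed
  have "f (F \<inter> T) + f (- F \<inter> T) = f T" for T
  proof (rule antisym)
    show "f T \<le> f (F \<inter> T) + f (- F \<inter> T)"
      using sub[of "F \<inter> T" "- F \<inter> T"] by (simp add: Int_Un_distrib2[symmetric])
    show "f (F \<inter> T) + f (- F \<inter> T) \<le> f T"
      using main[of T] by (cases "f T = top") (auto simp: Int_commute Diff_eq less_top)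
  qed
  then show ?thesis by (auto simp: lambda_system_def Compl_eq_Diff_UNIV)
qed

section \<open>Covers of bounded mesh and the Hausdorff outer measure\<close>

lemma hausdorff_pre_le:
  assumes "A \<subseteq> (\<Union>i. C i)" "\<And>i. bounded (C i)" "\<And>i. diameter (C i) \<le> \<delta>"
  shows "hausdorff_pre s \<delta> A \<le> (\<Sum>i. ennreal (hausdorff_piece s (C i)))"
  unfolding hausdorff_pre_def using assms by (intro INF_lower) auto

lemma hausdorff_pre_mono: "A \<subseteq> B \<Longrightarrow> hausdorff_pre s \<delta> A \<le> hausdorff_pre s \<delta> B"
  unfolding hausdorff_pre_def by (intro INF_superset_mono) auto

lemma hausdorff_pre_antimono: "\<delta> \<le> \<delta>' \<Longrightarrow> hausdorff_pre s \<delta>' A \<le> hausdorff_pre s \<delta> A"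
  unfolding hausdorff_pre_def by (intro INF_superset_mono) (auto intro: order_trans)

lemma hausdorff_pre_empty: "\<delta> > 0 \<Longrightarrow> hausdorff_pre s \<delta> {} = 0"
  using hausdorff_pre_le[of "{}" "\<lambda>_. {}" \<delta> s] by (simp add: hausdorff_piece_def)

lemma hausdorff_pre_UN:
  "hausdorff_pre s \<delta> (\<Union>n. A n) \<le> (\<Sum>n::nat. hausdorff_pre s \<delta> (A n))"
proof (rule ennreal_le_epsilon)
  fix e :: real assume "0 < e" and fin: "(\<Sum>n. hausdorff_pre s \<delta> (A n)) < top"
  then have *: "\<And>n. hausdorff_pre s \<delta> (A n) < hausdorff_pre s \<delta> (A n) + e * (1/2)^Suc n"
    by (auto simp add: less_top dest!: ennreal_suminf_lessD)
  then have "\<forall>n. \<exists>B. A n \<subseteq> (\<Union>i. B i) \<and> (\<forall>i::nat. bounded (B i) \<and> diameter (B i) \<le> \<delta>) \<and>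
      (\<Sum>i. ennreal (hausdorff_piece s (B i))) \<le> hausdorff_pre s \<delta> (A n) + e * (1/2)^Suc n"
    unfolding hausdorff_pre_def INF_less_iff using less_imp_le by blast
  then obtain B where B: "\<And>n. A n \<subseteq> (\<Union>i. B n i)"
      "\<And>n i::nat. bounded (B n i) \<and> diameter (B n i) \<le> \<delta>"
      "\<And>n. (\<Sum>i. ennreal (hausdorff_piece s (B n i))) \<le> hausdorff_pre s \<delta> (A n) + e * (1/2)^Suc n"
    by metis
  define C where "C = case_prod B o prod_decode"
  have "hausdorff_pre s \<delta> (\<Union>n. A n) \<le> (\<Sum>i. ennreal (hausdorff_piece s (C i)))"
  proof (rule hausdorff_pre_le)
    show "(\<Union>n. A n) \<subseteq> (\<Union>i. C i)"
      using B(1) by (auto simp add: C_def subset_eq) (metis prod.case prod_encode_inverse)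
  qed (use B(2) in \<open>auto simp: C_def split: prod.split\<close>)
  also have "\<dots> = (\<Sum>n. \<Sum>i. ennreal (hausdorff_piece s (B n i)))"
    unfolding C_def comp_def by (intro suminf_ennreal_2dimen) auto
  also have "\<dots> \<le> (\<Sum>n. hausdorff_pre s \<delta> (A n) + e * (1/2) ^ Suc n)"
    by (intro suminf_le allI B(3)) auto
  also have "\<dots> = (\<Sum>n. hausdorff_pre s \<delta> (A n)) + (\<Sum>n. ennreal e * ennreal ((1/2) ^ Suc n))"
    using \<open>0 < e\<close> by (subst suminf_add[symmetric])
                     (auto simp del: ennreal_suminf_cmult simp add: ennreal_mult[symmetric])
  also have "\<dots> = (\<Sum>n. hausdorff_pre s \<delta> (A n)) + e"
    unfolding ennreal_suminf_cmult
    by (subst suminf_ennreal_eq[OF zero_le_power power_half_series]) auto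
  finally show "hausdorff_pre s \<delta> (\<Union>n. A n) \<le> (\<Sum>n. hausdorff_pre s \<delta> (A n)) + e" .
qed

lemma hausdorff_pre_Un:
  assumes "\<delta> > 0"
  shows "hausdorff_pre s \<delta> (A \<union> B) \<le> hausdorff_pre s \<delta> A + hausdorff_pre s \<delta> B"
proof -
  have "A \<union> B = (\<Union>n::nat. if n = 0 then A else if n = 1 then B else {})"
    by (auto split: if_splits)
  also have "hausdorff_pre s \<delta> \<dots> \<le>
      (\<Sum>n. hausdorff_pre s \<delta> (if n = 0 then A else if n = 1 then B else {}))"
    by (rule hausdorff_pre_UN)
  also have "\<dots> = hausdorff_pre s \<delta> A + hausdorff_pre s \<delta> B"
    using assms by (subst suminf_finite[of "{0, 1}"]) (auto simp: hausdorff_pre_empty)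
  finally show ?thesis .
qed

text \<open>A covering set whose diameter is below the gap \<open>e\<close> cannot meet both
  \<open>A\<close> and \<open>B\<close>. Sorting the members of a cover by whether they meet
  \<open>A\<close> splits it into a cover of \<open>A\<close> and a cover of \<open>B\<close> with
  the same total cost.\<close>

lemma hausdorff_pre_separated:
  assumes "0 < \<delta>" "\<delta> < e" "\<And>x y. x \<in> A \<Longrightarrow> y \<in> B \<Longrightarrow> e \<le> dist x y"
  shows "hausdorff_pre s \<delta> A + hausdorff_pre s \<delta> B \<le> hausdorff_pre s \<delta> (A \<union> B)"
  unfolding hausdorff_pre_def[of s \<delta> "A \<union> B"]
proof (intro INF_greatest, clarify)
  fix C :: "nat \<Rightarrow> 'a set"
  assume C: "A \<union> B \<subseteq> (\<Union>i. C i)" "\<forall>i. bounded (C i) \<and> diameter (C i) \<le> \<delta>"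
  define CA where "CA i = (if C i \<inter> A = {} then {} else C i)" for i
  define CB where "CB i = (if C i \<inter> A = {} then C i else {})" for i
  have "B \<subseteq> (\<Union>i. CB i)"
  proof
    fix y assume y: "y \<in> B"
    then obtain i where i: "y \<in> C i" using C by auto
    have "C i \<inter> A = {}"
    proof (rule ccontr)
      assume "C i \<inter> A \<noteq> {}"
      then obtain x where x: "x \<in> C i" "x \<in> A" by auto
      then have "dist x y \<le> \<delta>"
        using diameter_bounded_bound[of "C i" x y] C(2) i by (meson order_trans)
      then show False using assms x y by fastforce
    qed
    then show "y \<in> (\<Union>i. CB i)" using i by (auto simp: CB_def)
  qed
  moreover have "A \<subseteq> (\<Union>i. CA i)" using C by (fastforce simp: CA_def)
  ultimately have "hausdorff_pre s \<delta> A + hausdorff_pre s \<delta> B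
      \<le> (\<Sum>i. ennreal (hausdorff_piece s (CA i))) + (\<Sum>i. ennreal (hausdorff_piece s (CB i)))"
    using C(2) assms(1) by (intro add_mono hausdorff_pre_le) (auto simp: CA_def CB_def)
  also have "\<dots> = (\<Sum>i. ennreal (hausdorff_piece s (CA i)) + ennreal (hausdorff_piece s (CB i)))"
    by (rule suminf_add) auto
  also have "\<dots> = (\<Sum>i. ennreal (hausdorff_piece s (C i)))"
    by (intro suminf_cong) (auto simp: CA_def CB_def hausdorff_piece_def)
  finally show "hausdorff_pre s \<delta> A + hausdorff_pre s \<delta> B \<le> (\<Sum>i. ennreal (hausdorff_piece s (C i)))" .
qed

lemma hausdorff_pre_le_outer: "\<delta> > 0 \<Longrightarrow> hausdorff_pre s \<delta> A \<le> hausdorff_outer s A"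
  unfolding hausdorff_outer_def by (intro SUP_upper) auto

lemma hausdorff_outer_separated:
  assumes "0 < e" "\<And>x y. x \<in> A \<Longrightarrow> y \<in> B \<Longrightarrow> e \<le> dist x y"
  shows "hausdorff_outer s A + hausdorff_outer s B \<le> hausdorff_outer s (A \<union> B)"
  unfolding hausdorff_outer_def[of s A] hausdorff_outer_def[of s B]
proof (subst SUP_add_directed_ennreal[symmetric])
  fix \<delta> \<delta>' :: real assume "\<delta> \<in> {0<..}" "\<delta>' \<in> {0<..}"
  then show "\<exists>k\<in>{0<..}. hausdorff_pre s \<delta> A + hausdorff_pre s \<delta>' B \<le> hausdorff_pre s k A + hausdorff_pre s k B"
    by (intro bexI[of _ "min \<delta> \<delta>'"] add_mono hausdorff_pre_antimono) auto
next
  show "(SUP \<delta>\<in>{0<..}. hausdorff_pre s \<delta> A + hausdorff_pre s \<delta> B) \<le> hausdorff_outer s (A \<union> B)"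
  proof (rule SUP_least)
    fix \<delta> :: real assume "\<delta> \<in> {0<..}"
    then have d: "0 < min \<delta> (e/2)" "min \<delta> (e/2) < e" using assms(1) by auto
    have "hausdorff_pre s \<delta> A + hausdorff_pre s \<delta> B
        \<le> hausdorff_pre s (min \<delta> (e/2)) A + hausdorff_pre s (min \<delta> (e/2)) B"
      by (intro add_mono hausdorff_pre_antimono) auto
    also have "\<dots> \<le> hausdorff_pre s (min \<delta> (e/2)) (A \<union> B)"
      using d assms(2) by (intro hausdorff_pre_separated) auto
    also have "\<dots> \<le> hausdorff_outer s (A \<union> B)" by (rule hausdorff_pre_le_outer[OF d(1)])
    finally show "hausdorff_pre s \<delta> A + hausdorff_pre s \<delta> B \<le> hausdorff_outer s (A \<union> B)" .
  qed
qed

lemma outer_measure_space_hausdorff: "outer_measure_space UNIV (hausdorff_outer s)"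
  unfolding outer_measure_space_def
proof (intro conjI)
  show "positive UNIV (hausdorff_outer s)"
    by (auto simp: positive_def hausdorff_outer_def hausdorff_pre_empty)
  show "increasing UNIV (hausdorff_outer s)"
    unfolding increasing_def hausdorff_outer_def by (auto intro!: SUP_mono hausdorff_pre_mono)
  show "countably_subadditive UNIV (hausdorff_outer s)"
    unfolding countably_subadditive_def hausdorff_outer_def[of s "\<Union>(_ ` _)"]
    by (auto intro!: SUP_least order_trans[OF hausdorff_pre_UN] suminf_le hausdorff_pre_le_outer)
qed

text \<open>\<open>measure_of\<close> returns the zero measure unless the given function is a
  measure on the given sigma-algebra. This lemma is what makes \<open>hausdorff_measure\<close>
  agree with \<open>hausdorff_outer\<close> on Borel sets.\<close>

lemma measure_space_hausdorff:
  "measure_space UNIV (sets borel) (hausdorff_outer s :: 'a::euclidean_space set \<Rightarrow> _)"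
proof -
  interpret sigma_algebra "UNIV :: 'a set" UNIV using sigma_algebra_Pow[of UNIV] by simp
  have ms: "measure_space UNIV (lambda_system UNIV UNIV (hausdorff_outer s)) (hausdorff_outer s :: 'a set \<Rightarrow> _)"
    by (rule caratheodory_lemma[OF outer_measure_space_hausdorff])
  have "sigma_sets UNIV (Collect closed) \<subseteq> lambda_system UNIV UNIV (hausdorff_outer s :: 'a set \<Rightarrow> _)"
  proof (rule sigma_algebra.sigma_sets_subset)
    show "sigma_algebra UNIV (lambda_system UNIV UNIV (hausdorff_outer s :: 'a set \<Rightarrow> _))"
      using ms by (simp add: measure_space_def)
    show "Collect closed \<subseteq> lambda_system UNIV UNIV (hausdorff_outer s :: 'a set \<Rightarrow> _)"
    proof clarify
      fix F :: "'a set" assume "closed F"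
      then show "F \<in> lambda_system UNIV UNIV (hausdorff_outer s)"
        using closed_in_lambda_system outer_measure_space_hausdorff hausdorff_outer_separated by blast
    qed
  qed
  then have "sets borel \<subseteq> lambda_system UNIV UNIV (hausdorff_outer s :: 'a set \<Rightarrow> _)"
    by (simp add: borel_eq_closed)
  then show ?thesis
    using ms sets.sigma_algebra_axioms[of "borel :: 'a measure"] by (auto intro: measure_down)
qed

lemma sets_hausdorff_measure [measurable_cong, simp]: "sets (hausdorff_measure s) = sets borel"
  unfolding hausdorff_measure_def using sets.sigma_sets_eq[of borel] by (simp add: )

lemma space_hausdorff_measure [simp]: "space (hausdorff_measure s) = UNIV"
  unfolding hausdorff_measure_def by simp

lemma emeasure_hausdorff_measure:
  "E \<in> sets borel \<Longrightarrow> emeasure (hausdorff_measure s) E = hausdorff_outer s E"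
  using measure_space_hausdorff[of s] unfolding hausdorff_measure_def
  by (intro emeasure_measure_of_sigma) (auto simp: measure_space_def)

lemma hausdorff_const_eq: "hausdorff_const s = unit_ball_vol s"
  by (simp add: hausdorff_const_def unit_ball_vol_def)

text \<open>\<open>0 powr 0\<close> is \<open>0\<close> while \<open>0 ^ 0\<close> is
  \<open>1\<close>. The clause for \<open>s = 0\<close> in \<open>hausdorff_piece\<close> repairs
  exactly this case, so natural powers cover dimension 1, where points have positive weight, without
  a separate argument.\<close>

lemma hausdorff_piece_of_nat:
  assumes "bounded C"
  shows "hausdorff_piece (real k) C = (if C = {} then 0 else unit_ball_vol (real k) * (diameter C / 2) ^ k)"
proof (cases "diameter C = 0")
  case False
  then have "diameter C > 0" using diameter_ge_0[OF assms] by simp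
  then show ?thesis by (simp add: hausdorff_piece_def hausdorff_const_eq powr_realpow)
qed (simp add: hausdorff_piece_def hausdorff_const_eq)

section \<open>Scaling of Hausdorff measure under homotheties\<close>

lemma hausdorff_outer_affine_le:
  fixes E :: "'a::euclidean_space set"
  assumes "R > 0" "s \<ge> 0"
  shows "hausdorff_outer s ((\<lambda>x. a + R *\<^sub>R x) ` E) \<le> ennreal (R powr s) * hausdorff_outer s E"
  unfolding hausdorff_outer_def[of s "(\<lambda>x. a + R *\<^sub>R x) ` E"]
proof (rule SUP_least)
  fix \<delta> :: real assume "\<delta> \<in> {0<..}"
  then have \<delta>: "\<delta> > 0" by simp
  let ?f = "\<lambda>x. a + R *\<^sub>R x"
  \<comment> \<open>Moving the factor to the left leaves the infimum over covers of \<open>E\<close>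
    alone on the right, where it can be treated one cover at a time.\<close>
  have "ennreal (R powr - s) * hausdorff_pre s \<delta> (?f ` E) \<le> hausdorff_pre s (\<delta> / R) E"
    unfolding hausdorff_pre_def[of s "\<delta> / R" E]
  proof (rule INF_greatest, clarify)
    fix C :: "nat \<Rightarrow> 'a set"
    assume C: "E \<subseteq> (\<Union>i. C i)" "\<forall>i. bounded (C i) \<and> diameter (C i) \<le> \<delta> / R"
    have diam: "diameter (?f ` C i) \<le> R * diameter (C i)" for i
    proof (rule diameter_le)
      show "?f ` C i \<noteq> {} \<or> 0 \<le> R * diameter (C i)"
        using assms C(2) diameter_ge_0[of "C i"] by auto
      fix x y assume "x \<in> ?f ` C i" "y \<in> ?f ` C i"
      then obtain u v where uv: "u \<in> C i" "v \<in> C i" "x = ?f u" "y = ?f v" by auto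
      have "norm (x - y) = R * dist u v"
        using assms(1) by (simp add: uv dist_norm scaleR_diff_right[symmetric])
      also have "\<dots> \<le> R * diameter (C i)"
        using assms(1) C(2) uv diameter_bounded_bound[of "C i" u v] by simp
      finally show "norm (x - y) \<le> R * diameter (C i)" .
    qed
    have bd: "bounded (?f ` C i)" for i
      using bounded_translation[OF bounded_scaling[of "C i" R], of a] C(2) by (simp add: image_image)
    have "hausdorff_pre s \<delta> (?f ` E) \<le> (\<Sum>i. ennreal (hausdorff_piece s (?f ` C i)))"
    proof -
      have "diameter (?f ` C i) \<le> \<delta>" for i
      proof -
        have "R * diameter (C i) \<le> \<delta>" using C(2) assms(1) by (auto simp: field_simps)
        then show ?thesis using diam[of i] by simp
      qed
      then show ?thesis using C(1) bd by (intro hausdorff_pre_le) (auto simp: image_UN[symmetric])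
    qed
    also have "\<dots> \<le> (\<Sum>i. ennreal (R powr s * hausdorff_piece s (C i)))"
    proof (intro suminf_le summableI allI ennreal_leI)
      fix i
      have "0 \<le> diameter (?f ` C i) / 2" using diameter_ge_0[OF bd[of i]] by simp
      moreover have "diameter (?f ` C i) / 2 \<le> R * (diameter (C i) / 2)" using diam[of i] by simp
      ultimately have "(diameter (?f ` C i) / 2) powr s \<le> (R * (diameter (C i) / 2)) powr s"
        using assms(2) by (intro powr_mono2) auto
      also have "\<dots> = R powr s * (diameter (C i) / 2) powr s"
        by (rule powr_mult)
      finally show "hausdorff_piece s (?f ` C i) \<le> R powr s * hausdorff_piece s (C i)"
        using assms mult_left_mono[of "(diameter (?f ` C i) / 2) powr s"
              "R powr s * (diameter (C i) / 2) powr s" "unit_ball_vol s"]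
        by (auto simp: hausdorff_piece_def hausdorff_const_eq ac_simps)
    qed
    also have "\<dots> = ennreal (R powr s) * (\<Sum>i. ennreal (hausdorff_piece s (C i)))"
      by (subst ennreal_suminf_cmult[symmetric]) (simp add: ennreal_mult')
    finally have "ennreal (R powr - s) * hausdorff_pre s \<delta> (?f ` E)
        \<le> ennreal (R powr - s) * (ennreal (R powr s) * (\<Sum>i. ennreal (hausdorff_piece s (C i))))"
      by (rule mult_left_mono) simp
    also have "\<dots> = (\<Sum>i. ennreal (hausdorff_piece s (C i)))"
      using assms(1) by (simp add: mult.assoc[symmetric] ennreal_mult[symmetric] powr_minus)
    finally show "ennreal (R powr - s) * hausdorff_pre s \<delta> (?f ` E)
        \<le> (\<Sum>i. ennreal (hausdorff_piece s (C i)))" .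
  qed
  also have "\<dots> \<le> hausdorff_outer s E"
    unfolding hausdorff_outer_def using \<delta> assms(1) by (intro SUP_upper) auto
  finally have "ennreal (R powr s) * (ennreal (R powr - s) * hausdorff_pre s \<delta> (?f ` E))
      \<le> ennreal (R powr s) * hausdorff_outer s E"
    by (rule mult_left_mono) simp
  then show "hausdorff_pre s \<delta> (?f ` E) \<le> ennreal (R powr s) * hausdorff_outer s E"
    using assms(1) by (simp add: mult.assoc[symmetric] ennreal_mult[symmetric] powr_minus)
qed

lemma hausdorff_outer_affine:
  fixes E :: "'a::euclidean_space set"
  assumes "R > 0" "s \<ge> 0"
  shows "hausdorff_outer s ((\<lambda>x. a + R *\<^sub>R x) ` E) = ennreal (R powr s) * hausdorff_outer s E"
proof (rule antisym)
  show "hausdorff_outer s ((\<lambda>x. a + R *\<^sub>R x) ` E) \<le> ennreal (R powr s) * hausdorff_outer s E"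
    by (rule hausdorff_outer_affine_le[OF assms])
  let ?F = "(\<lambda>x. a + R *\<^sub>R x) ` E"
  have "(\<lambda>x. - (a /\<^sub>R R) + (1 / R) *\<^sub>R x) ` ?F = E"
    using assms(1) by (simp add: image_image scaleR_add_right divide_inverse_commute)
  then have "hausdorff_outer s E \<le> ennreal ((1 / R) powr s) * hausdorff_outer s ?F"
    using hausdorff_outer_affine_le[of "1 / R" s "- (a /\<^sub>R R)" ?F] assms by simp
  then have "ennreal (R powr s) * hausdorff_outer s E
      \<le> ennreal (R powr s) * (ennreal ((1 / R) powr s) * hausdorff_outer s ?F)"
    by (rule mult_left_mono) simp
  also have "\<dots> = hausdorff_outer s ?F"
    using assms(1) by (simp add: mult.assoc[symmetric] ennreal_mult[symmetric] powr_divide)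
  finally show "ennreal (R powr s) * hausdorff_outer s E \<le> hausdorff_outer s ?F" .
qed

section \<open>Steiner symmetrization\<close>

text \<open>Only the hulls matter: the hypothesis gives \<open>Sup E - Inf F \<le> q\<close> and
  \<open>Sup F - Inf E \<le> q\<close>, and adding the two bounds the total length of the
  hulls.\<close>

lemma emeasure_lborel_add_le_of_diff_bound:
  fixes E F :: "real set"
  assumes "E \<noteq> {}" "F \<noteq> {}" and d: "\<And>t s. t \<in> E \<Longrightarrow> s \<in> F \<Longrightarrow> \<bar>t - s\<bar> \<le> q"
  shows "emeasure lborel E + emeasure lborel F \<le> ennreal (2 * q)"
proof -
  obtain t0 s0 where ts: "t0 \<in> E" "s0 \<in> F" using assms by auto
  have bE: "bdd_above E" "bdd_below E"
    using d[OF _ ts(2)] by (force intro!: bdd_aboveI[of _ "s0 + q"] bdd_belowI[of _ "s0 - q"] simp: abs_le_iff)+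
  have bF: "bdd_above F" "bdd_below F"
    using d[OF ts(1)] by (force intro!: bdd_aboveI[of _ "t0 + q"] bdd_belowI[of _ "t0 - q"] simp: abs_le_iff)+
  have "Sup E \<le> s + q" if "s \<in> F" for s
    using d[OF _ that] assms(1) by (intro cSup_least) (force simp: abs_le_iff)+
  then have "Sup E - q \<le> Inf F" using assms(2) by (intro cInf_greatest) force+
  moreover have "Sup F \<le> t + q" if "t \<in> E" for t
    using d[OF that] assms(2) by (intro cSup_least) (force simp: abs_le_iff)+
  then have "Sup F - q \<le> Inf E" using assms(1) by (intro cInf_greatest) force+
  ultimately have le: "(Sup E - Inf E) + (Sup F - Inf F) \<le> 2 * q" by linarith
  have E: "Inf E \<le> Sup E" and F: "Inf F \<le> Sup F"
    using ts bE bF by (meson cInf_lower cSup_upper order_trans)+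
  have "emeasure lborel E \<le> emeasure lborel {Inf E..Sup E}"
    using bE by (intro emeasure_mono) (auto intro: cInf_lower cSup_upper)
  moreover have "emeasure lborel F \<le> emeasure lborel {Inf F..Sup F}"
    using bF by (intro emeasure_mono) (auto intro: cInf_lower cSup_upper)
  ultimately have "emeasure lborel E + emeasure lborel F
      \<le> ennreal (Sup E - Inf E) + ennreal (Sup F - Inf F)"
    using E F by (simp add: add_mono)
  also have "\<dots> = ennreal ((Sup E - Inf E) + (Sup F - Inf F))"
    using E F by (subst ennreal_plus) auto
  also have "\<dots> \<le> ennreal (2 * q)" using le by (rule ennreal_leI)
  finally show ?thesis .
qed

lemma emeasure_lborel_centered_interval:
  "emeasure lborel {t::real. ennreal (2 * \<bar>t\<bar>) < m} = m"
proof (cases m)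
  case (real r)
  have "{t::real. ennreal (2 * \<bar>t\<bar>) < m} = {- (r / 2)<..<r / 2}"
    using real by (auto simp: ennreal_less_iff abs_if split: if_splits)
  then show ?thesis using real by simp
qed (simp add: ennreal_less_top)

text \<open>Each section of \<open>A\<close> in direction \<open>j\<close> is replaced by the open
  interval of the same length centred at \<open>0\<close>. Comparing in \<open>ennreal\<close> turns
  a section of infinite length into the whole line. The section does not depend on the value
  \<open>x j\<close>.\<close>

definition steiner :: "'i \<Rightarrow> ('i \<Rightarrow> real) set \<Rightarrow> 'i set \<Rightarrow> ('i \<Rightarrow> real) set" where
  "steiner j A I = {x \<in> space (Pi\<^sub>M I (\<lambda>_. lborel)).
     ennreal (2 * \<bar>x j\<bar>) < emeasure lborel {t. x(j := t) \<in> A}}"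

lemma measurable_fun_upd_section:
  assumes "j \<in> I"
  shows "(\<lambda>(x, t). x(j := t)) \<in> measurable (Pi\<^sub>M I (\<lambda>_. lborel) \<Otimes>\<^sub>M lborel) (Pi\<^sub>M I (\<lambda>_. lborel :: real measure))"
proof -
  have "I = I \<union> {j}" using assms by auto
  then show ?thesis
    by (auto intro!: measurable_fun_upd[where J=I] simp: split_beta')
qed

lemma sets_section:
  assumes "j \<in> I" "A \<in> sets (Pi\<^sub>M I (\<lambda>_. lborel :: real measure))" "x \<in> space (Pi\<^sub>M I (\<lambda>_. lborel :: real measure))"
  shows "{t. x(j := t) \<in> A} \<in> sets borel"
proof -
  have "(\<lambda>t. x(j := t)) \<in> measurable lborel (Pi\<^sub>M I (\<lambda>_. lborel :: real measure))"
    using measurable_compose[OF measurable_Pair1'[OF assms(3)] measurable_fun_upd_section[OF assms(1)]] by simp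
  from measurable_sets[OF this assms(2)] show ?thesis by (simp add: vimage_def)
qed

lemma sets_steiner:
  assumes "j \<in> I" "A \<in> sets (Pi\<^sub>M I (\<lambda>_. lborel))"
  shows "steiner j A I \<in> sets (Pi\<^sub>M I (\<lambda>_. lborel))"
proof -
  let ?M = "Pi\<^sub>M I (\<lambda>_. lborel :: real measure)"
  let ?Q = "(\<lambda>(x, t). x(j := t)) -` A \<inter> space (?M \<Otimes>\<^sub>M (lborel :: real measure))"
  have "?Q \<in> sets (?M \<Otimes>\<^sub>M lborel)"
    using measurable_sets[OF measurable_fun_upd_section[OF assms(1)] assms(2)] .
  from lborel.measurable_emeasure_Pair[OF this]
  have "(\<lambda>x. emeasure lborel (Pair x -` ?Q)) \<in> borel_measurable ?M" .
  then have [measurable]: "(\<lambda>x. emeasure lborel {t. x(j := t) \<in> A}) \<in> borel_measurable ?M"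
    by (rule measurable_cong[THEN iffD1, rotated]) (auto simp: space_pair_measure vimage_def intro!: arg_cong2[where f=emeasure])
  have [measurable]: "(\<lambda>x. x j) \<in> borel_measurable ?M" using assms(1)
    by measurable
  show ?thesis unfolding steiner_def by measurable
qed

text \<open>By Tonelli both measures are integrals of the lengths of \<open>j\<close>-sections, and
  these lengths agree by \<open>emeasure_lborel_centered_interval\<close>.\<close>

lemma emeasure_steiner:
  assumes "finite I" "j \<in> I" "A \<in> sets (Pi\<^sub>M I (\<lambda>_. lborel))"
  shows "emeasure (Pi\<^sub>M I (\<lambda>_. lborel)) (steiner j A I) = emeasure (Pi\<^sub>M I (\<lambda>_. lborel)) A"
proof -
  interpret product_sigma_finite "\<lambda>_. lborel :: real measure" by standard
  define J where "J = I - {j}"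
  have I: "I = insert j J" "finite J" "j \<notin> J" using assms by (auto simp: J_def)
  let ?M = "\<lambda>I. Pi\<^sub>M I (\<lambda>_. lborel :: real measure)"
  have fub: "emeasure (?M I) B = (\<integral>\<^sup>+x. emeasure lborel {t. x(j := t) \<in> B} \<partial>?M J)"
    if B: "B \<in> sets (?M I)" for B
  proof -
    have "emeasure (?M I) B = (\<integral>\<^sup>+x. indicator B x \<partial>?M I)" using B by simp
    also have "\<dots> = (\<integral>\<^sup>+x. \<integral>\<^sup>+t. indicator B (x(j := t)) \<partial>lborel \<partial>?M J)"
    proof -
      have "indicator B \<in> borel_measurable (?M (insert j J))" using B I(1) by simp
      from product_nn_integral_insert[OF I(2,3) this] show ?thesis by (simp add: I(1))
    qed
    also have "\<dots> = (\<integral>\<^sup>+x. emeasure lborel {t. x(j := t) \<in> B} \<partial>?M J)"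
    proof (intro nn_integral_cong)
      fix x assume x: "x \<in> space (?M J)"
      have "x(j := 0) \<in> space (?M I)" using x I by (auto simp: space_PiM PiE_def extensional_def)
      from sets_section[OF assms(2) B this]
      have "{t. x(j := t) \<in> B} \<in> sets borel" by simp
      then have "emeasure lborel {t. x(j := t) \<in> B} = (\<integral>\<^sup>+t. indicator {t. x(j := t) \<in> B} t \<partial>lborel)" by simp
      then show "(\<integral>\<^sup>+t. indicator B (x(j := t)) \<partial>lborel) = emeasure lborel {t. x(j := t) \<in> B}"
        by (simp add: indicator_def)
    qed
    finally show ?thesis .
  qed
  have "emeasure lborel {t. x(j := t) \<in> steiner j A I} = emeasure lborel {t. x(j := t) \<in> A}"
    if x: "x \<in> space (?M J)" for x
  proof -
    have "x(j := t) \<in> space (?M I)" for t using x I by (auto simp: space_PiM PiE_def extensional_def)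
    then have "{t. x(j := t) \<in> steiner j A I} = {t. ennreal (2 * \<bar>t\<bar>) < emeasure lborel {t. x(j := t) \<in> A}}"
      by (auto simp: steiner_def)
    then show ?thesis by (simp add: emeasure_lborel_centered_interval)
  qed
  then show ?thesis
    using assms by (simp add: fub sets_steiner cong: nn_integral_cong)
qed

text \<open>If no pair of section points were at least as far apart as \<open>x j\<close> and
  \<open>y j\<close>, the two section lengths would add up to at most
  \<open>2 * \<bar>x j - y j\<bar>\<close>. But they exceed \<open>2 * \<bar>x j\<bar>\<close> and
  \<open>2 * \<bar>y j\<bar>\<close> respectively, which contradicts the triangle
  inequality.\<close>

lemma steiner_diff:
  assumes "j \<in> I" and x: "x \<in> steiner j A I" and y: "y \<in> steiner j A I"
  obtains t s where "x(j := t) \<in> A" "y(j := s) \<in> A" "\<bar>x j - y j\<bar> \<le> \<bar>t - s\<bar>"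
proof -
  define E where "E = {t. x(j := t) \<in> A}"
  define F where "F = {t. y(j := t) \<in> A}"
  have "\<exists>t\<in>E. \<exists>s\<in>F. \<bar>x j - y j\<bar> < \<bar>t - s\<bar>"
  proof (rule ccontr)
    assume "\<not> ?thesis"
    then have le: "\<bar>t - s\<bar> \<le> \<bar>x j - y j\<bar>" if "t \<in> E" "s \<in> F" for t s using that by force
    have ne: "E \<noteq> {}" "F \<noteq> {}" using x y by (auto simp: steiner_def E_def[symmetric] F_def[symmetric])
    have "ennreal (2 * \<bar>x j\<bar>) + ennreal (2 * \<bar>y j\<bar>) < emeasure lborel E + emeasure lborel F"
      using x y by (intro add_strict_mono) (auto simp: steiner_def E_def F_def)
    also have "\<dots> \<le> ennreal (2 * \<bar>x j - y j\<bar>)"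
      by (rule emeasure_lborel_add_le_of_diff_bound[OF ne le])
    finally have "ennreal (2 * \<bar>x j\<bar> + 2 * \<bar>y j\<bar>) < ennreal (2 * \<bar>x j - y j\<bar>)"
      by (subst ennreal_plus) auto
    then show False using abs_triangle_ineq4[of "x j" "y j"] by (simp add: ennreal_less_iff del: ennreal_plus)
  qed
  then show thesis using that by (auto simp: E_def F_def)
qed

text \<open>Symmetrization in direction \<open>j\<close> changes only the \<open>j\<close>-th
  coordinate of a difference and, by \<open>steiner_diff\<close>, never beyond what already occurs
  in \<open>A\<close>. Hence any \<open>Q\<close> that is monotone in the absolute values of the
  coordinates survives. After all directions the set is symmetric about \<open>0\<close>, and
  \<open>2 * x\<close> is the difference of its members \<open>x\<close> and
  \<open>- x\<close>.\<close>

lemma steiner_symmetrization: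
  fixes A :: "('i \<Rightarrow> real) set"
  assumes "finite I" and A: "A \<in> sets (Pi\<^sub>M I (\<lambda>_. lborel))"
    and D: "\<And>x y. x \<in> A \<Longrightarrow> y \<in> A \<Longrightarrow> Q (\<lambda>i. x i - y i)"
    and mono: "\<And>z w. Q z \<Longrightarrow> (\<And>i. i \<in> I \<Longrightarrow> \<bar>w i\<bar> \<le> \<bar>z i\<bar>) \<Longrightarrow> Q w"
  obtains B where "B \<in> sets (Pi\<^sub>M I (\<lambda>_. lborel))"
    "emeasure (Pi\<^sub>M I (\<lambda>_. lborel)) B = emeasure (Pi\<^sub>M I (\<lambda>_. lborel)) A"
    "\<And>x. x \<in> B \<Longrightarrow> Q (\<lambda>i. 2 * x i)"
proof -
  let ?M = "Pi\<^sub>M I (\<lambda>_. lborel :: real measure)"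
  \<comment> \<open>The last conjunct says that \<open>B\<close> is invariant under sign changes in
    the coordinates of \<open>J\<close>. Later symmetrizations preserve this, because such a sign
    change leaves the section in a new direction unchanged.\<close>
  have "\<exists>B. B \<in> sets ?M \<and> emeasure ?M B = emeasure ?M A \<and>
      (\<forall>x\<in>B. \<forall>y\<in>B. Q (\<lambda>i. x i - y i)) \<and>
      (\<forall>x\<in>B. \<forall>y\<in>space ?M. (\<forall>i\<in>J. \<bar>y i\<bar> = \<bar>x i\<bar>) \<and> (\<forall>i\<in>I - J. y i = x i) \<longrightarrow> y \<in> B)"
    if "finite J" "J \<subseteq> I" for J
    using that
  proof (induction J)
    case empty
    show ?case
    proof (intro exI[of _ A] conjI ballI impI)
      fix x y assume x: "x \<in> A" and y: "y \<in> space ?M"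
        and eq: "(\<forall>i\<in>{}. \<bar>y i\<bar> = \<bar>x i\<bar>) \<and> (\<forall>i\<in>I - {}. y i = x i)"
      have "x \<in> space ?M" using x A sets.sets_into_space by blast
      then have "y i = x i" for i
        using y eq by (cases "i \<in> I") (auto simp: space_PiM PiE_def extensional_def)
      then have "y = x" by auto
      then show "y \<in> A" using x by simp
    qed (use A D in auto)
  next
    case (insert j J)
    then obtain B where B: "B \<in> sets ?M" "emeasure ?M B = emeasure ?M A"
      "\<And>x y. x \<in> B \<Longrightarrow> y \<in> B \<Longrightarrow> Q (\<lambda>i. x i - y i)"
      "\<And>x y. x \<in> B \<Longrightarrow> y \<in> space ?M \<Longrightarrow> (\<forall>i\<in>J. \<bar>y i\<bar> = \<bar>x i\<bar>) \<Longrightarrow> (\<forall>i\<in>I - J. y i = x i) \<Longrightarrow> y \<in> B"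
      by auto
    have j: "j \<in> I" "j \<notin> J" using insert by auto
    have upd: "y(j := t) \<in> space ?M" if "y \<in> space ?M" for y t
      using that j by (auto simp: space_PiM PiE_def extensional_def)
    show ?case
    proof (intro exI[of _ "steiner j B I"] conjI ballI impI)
      show "steiner j B I \<in> sets ?M" using j B by (intro sets_steiner)
      show "emeasure ?M (steiner j B I) = emeasure ?M A"
        using emeasure_steiner[OF \<open>finite I\<close> j(1) B(1)] B(2) by simp
      fix x assume x: "x \<in> steiner j B I"
      {
        fix y assume y: "y \<in> steiner j B I"
        obtain t s where ts: "x(j := t) \<in> B" "y(j := s) \<in> B" "\<bar>x j - y j\<bar> \<le> \<bar>t - s\<bar>"
          using steiner_diff[OF j(1) x y] .
        show "Q (\<lambda>i. x i - y i)" by (rule mono[OF B(3)[OF ts(1,2)]]) (use ts(3) in auto)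
      }
      {
        fix y assume y: "y \<in> space ?M"
          and eq: "(\<forall>i\<in>insert j J. \<bar>y i\<bar> = \<bar>x i\<bar>) \<and> (\<forall>i\<in>I - insert j J. y i = x i)"
        have x': "x \<in> space ?M" using x by (simp add: steiner_def)
        have "x(j := t) \<in> B \<longleftrightarrow> y(j := t) \<in> B" for t
          using B(4)[OF _ upd[OF x'], of "y(j := t)" t] B(4)[OF _ upd[OF y], of "x(j := t)" t] eq by auto
        then show "y \<in> steiner j B I" using x y eq by (simp add: steiner_def)
      }
    qed
  qed
  from this[OF \<open>finite I\<close> order_refl] obtain B where B: "B \<in> sets ?M" "emeasure ?M B = emeasure ?M A"
      "\<And>x y. x \<in> B \<Longrightarrow> y \<in> B \<Longrightarrow> Q (\<lambda>i. x i - y i)"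
      "\<And>x y. x \<in> B \<Longrightarrow> y \<in> space ?M \<Longrightarrow> (\<forall>i\<in>I. \<bar>y i\<bar> = \<bar>x i\<bar>) \<Longrightarrow> y \<in> B"
    by auto
  show thesis
  proof (rule that[OF B(1,2)])
    fix x assume x: "x \<in> B"
    \<comment> \<open>Points of the product space are \<open>undefined\<close> outside
      \<open>I\<close>, so the negative has to be restricted.\<close>
    have "restrict (\<lambda>i. - x i) I \<in> B" by (rule B(4)[OF x]) (auto simp: space_PiM)
    from B(3)[OF x this] show "Q (\<lambda>i. 2 * x i)" by (rule mono) auto
  qed
qed

section \<open>Rotation invariance and cylinders\<close>

lemma nn_integral_lborel_translate:
  fixes f :: "'a::euclidean_space \<Rightarrow> ennreal"
  assumes [measurable]: "f \<in> borel_measurable borel"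
  shows "(\<integral>\<^sup>+x. f (c + x) \<partial>lborel) = (\<integral>\<^sup>+x. f x \<partial>lborel)"
proof -
  have "(\<integral>\<^sup>+x. f x \<partial>lborel) = (\<integral>\<^sup>+x. f x \<partial>distr lborel borel ((+) c))"
    by (simp add: lborel_distr_plus)
  then show ?thesis by (simp add: nn_integral_distr)
qed

text \<open>Tonelli, applied twice to the indicator of
  \<open>norm x < 1 \<and> x + T y \<in> B\<close>, reduces the claim to unit balls, which \<open>T\<close> preserves.\<close>
lemma lborel_distr_orthogonal:
  fixes T :: "'a::euclidean_space \<Rightarrow> 'a"
  assumes T: "orthogonal_transformation T"
  shows "distr lborel borel T = lborel"
proof (rule measure_eqI)
  fix B assume "B \<in> sets (distr lborel borel T)"
  then have B [measurable]: "B \<in> sets borel" by simp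
  have lin: "linear T" and nrm: "\<And>v. norm (T v) = norm v" and surj: "surj T"
    using T orthogonal_transformation_surj by (auto simp: orthogonal_transformation)
  have T_meas [measurable]: "T \<in> borel_measurable borel"
    using lin by (intro borel_measurable_continuous_onI linear_continuous_on) (simp add: linear_conv_bounded_linear)
  let ?A = "ball (0::'a) 1"
  let ?L = "lborel :: 'a measure"
  have [measurable]: "?A \<in> sets borel" by simp
  have ball: "emeasure ?L (T -` ball x 1) = emeasure ?L ?A" for x
  proof -
    obtain x' where x': "x = T x'" using surj by (metis surjD)
    have "T -` ball x 1 = ball x' 1"
      using nrm lin by (auto simp: x' dist_norm linear_diff[symmetric])
    then show ?thesis by (simp add: emeasure_ball)
  qed
  have transl: "(\<integral>\<^sup>+y. indicator B (x + T y) \<partial>?L) = (\<integral>\<^sup>+y. indicator B (T y) \<partial>?L)" for x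
  proof -
    obtain x' where x': "x = T x'" using surj by (metis surjD)
    have "(\<integral>\<^sup>+y. indicator B (x + T y) \<partial>?L) = (\<integral>\<^sup>+y. indicator B (T (x' + y)) \<partial>?L)"
      using lin by (simp add: x' linear_add)
    also have "\<dots> = (\<integral>\<^sup>+y. indicator B (T y) \<partial>?L)"
      by (rule nn_integral_lborel_translate) measurable
    finally show ?thesis .
  qed
  have "emeasure ?L ?A * emeasure ?L (T -` B) = (\<integral>\<^sup>+x. indicator ?A x * (\<integral>\<^sup>+y. indicator B (T y) \<partial>?L) \<partial>?L)"
  proof -
    have "emeasure ?L (T -` B) = (\<integral>\<^sup>+y. indicator (T -` B) y \<partial>?L)"
      using measurable_sets[OF T_meas B] by simp
    also have "\<dots> = (\<integral>\<^sup>+y. indicator B (T y) \<partial>?L)" by (simp add: indicator_def)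
    finally show ?thesis by (subst nn_integral_multc) simp_all
  qed
  also have "\<dots> = (\<integral>\<^sup>+x. indicator ?A x * (\<integral>\<^sup>+y. indicator B (x + T y) \<partial>?L) \<partial>?L)"
    by (simp add: transl)
  also have "\<dots> = (\<integral>\<^sup>+x. \<integral>\<^sup>+y. indicator ?A x * indicator B (x + T y) \<partial>?L \<partial>?L)"
    by (simp add: nn_integral_cmult)
  also have "\<dots> = (\<integral>\<^sup>+y. \<integral>\<^sup>+x. indicator ?A x * indicator B (x + T y) \<partial>?L \<partial>?L)"
    by (rule lborel_pair.Fubini') measurable
  also have "\<dots> = (\<integral>\<^sup>+y. \<integral>\<^sup>+x. indicator ?A (x - T y) * indicator B x \<partial>?L \<partial>?L)"
  proof (rule nn_integral_cong)
    fix y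
    show "(\<integral>\<^sup>+x. indicator ?A x * indicator B (x + T y) \<partial>?L) = (\<integral>\<^sup>+x. indicator ?A (x - T y) * indicator B x \<partial>?L)"
      using nn_integral_lborel_translate[of "\<lambda>x. indicator ?A (x - T y) * indicator B x" "T y"]
      by (simp add: add.commute)
  qed
  also have "\<dots> = (\<integral>\<^sup>+x. \<integral>\<^sup>+y. indicator ?A (x - T y) * indicator B x \<partial>?L \<partial>?L)"
    by (rule lborel_pair.Fubini') measurable
  also have "\<dots> = (\<integral>\<^sup>+x. emeasure ?L ?A * indicator B x \<partial>?L)"
  proof (intro nn_integral_cong)
    fix x
    have "(\<integral>\<^sup>+y. indicator ?A (x - T y) * indicator B x \<partial>?L) = (\<integral>\<^sup>+y. indicator ?A (x - T y) \<partial>?L) * indicator B x"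
      by (simp add: nn_integral_multc)
    also have "(\<integral>\<^sup>+y. indicator ?A (x - T y) \<partial>?L) = (\<integral>\<^sup>+y. indicator (T -` ball x 1) y \<partial>?L)"
      by (simp add: indicator_def dist_norm norm_minus_commute)
    also have "\<dots> = emeasure ?L ?A"
      using measurable_sets[OF T_meas, of "ball x 1"] ball[of x] by simp
    finally show "(\<integral>\<^sup>+y. indicator ?A (x - T y) * indicator B x \<partial>?L) = emeasure ?L ?A * indicator B x" .
  qed
  also have "\<dots> = emeasure ?L ?A * emeasure ?L B" by (simp add: nn_integral_cmult)
  finally have eq: "emeasure ?L ?A * emeasure ?L (T -` B) = emeasure ?L ?A * emeasure ?L B" .
  have "emeasure ?L ?A = ennreal (unit_ball_vol DIM('a))" by (simp add: emeasure_ball)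
  moreover have "\<not> unit_ball_vol (real DIM('a)) \<le> 0" by (simp add: not_le)
  ultimately have "emeasure ?L (T -` B) = emeasure ?L B"
    using eq by (auto simp: ennreal_mult_cancel_left ennreal_eq_0_iff)
  then show "emeasure (distr lborel borel T) B = emeasure lborel B"
    by (simp add: emeasure_distr)
qed simp

text \<open>Reflection in the hyperplane orthogonal to \<open>e - b\<close> exchanges
  \<open>e\<close> and \<open>b\<close>, since both have the same norm.\<close>

lemma householder_reflection:
  fixes e b :: "'a::euclidean_space"
  assumes "norm e = 1" "norm b = 1"
  obtains T where "orthogonal_transformation T" "T e = b"
proof (cases "e = b")
  case True
  then show ?thesis using that[of "\<lambda>x. x"] by simp
next
  case False
  define u where "u = e - b"
  have ee: "e \<bullet> e = 1" "b \<bullet> b = 1" using assms by (simp_all add: norm_eq_1)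
  \<comment> \<open>This makes the coefficient of \<open>u\<close> in \<open>T e\<close> equal to
    \<open>1\<close>, so that \<open>T e = e - u = b\<close>.\<close>
  have uu: "u \<bullet> u = 2 * (e \<bullet> u)" by (simp add: u_def inner_diff ee inner_commute)
  have "u \<noteq> 0" using False by (simp add: u_def)
  then have u0: "u \<bullet> u \<noteq> 0" by simp
  define T where "T x = x - (2 * (x \<bullet> u) / (u \<bullet> u)) *\<^sub>R u" for x
  show ?thesis
  proof (rule that)
    show "orthogonal_transformation T"
      unfolding orthogonal_transformation_def
    proof (intro conjI allI)
      show "linear T"
        by (rule linearI) (simp_all add: T_def algebra_simps add_divide_distrib inner_add_left)
      fix v w
      show "T v \<bullet> T w = v \<bullet> w"
        using u0 by (simp add: T_def inner_diff inner_commute field_simps power2_eq_square)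
    qed
    show "T e = b" using uu u0 by (simp add: T_def) (simp add: u_def)
  qed
qed


section \<open>Volumes of cylinders and the isodiametric bound\<close>

text \<open>In the product space over an index set, the cross section is an object of the same kind
  over the smaller set \<open>J\<close>. Tonelli in the coordinate \<open>b\<close> then leaves the
  volume of a ball in \<open>card J\<close> coordinates times a length.\<close>

lemma emeasure_PiM_cylinder:
  assumes "finite J" "b \<notin> J" "\<rho> > 0" "l \<le> u"
  shows "emeasure (Pi\<^sub>M (insert b J) (\<lambda>_. lborel))
      {f \<in> space (Pi\<^sub>M (insert b J) (\<lambda>_. lborel)). sqrt (\<Sum>i\<in>J. (f i)\<^sup>2) \<le> \<rho> \<and> l \<le> f b \<and> f b \<le> u}
    = ennreal (unit_ball_vol (real (card J)) * \<rho> ^ card J * (u - l))" (is "emeasure (?M (insert b J)) ?C = _")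
proof -
  interpret product_sigma_finite "\<lambda>_. lborel :: real measure" by standard
  let ?B = "{f. sqrt (\<Sum>i\<in>J. (f i)\<^sup>2) \<le> \<rho>} \<inter> space (?M J)"
  have B: "?B \<in> sets (?M J)" using assms(1) by measurable
  have C: "?C \<in> sets (?M (insert b J))" using assms(1) by measurable
  have "emeasure (?M (insert b J)) ?C = (\<integral>\<^sup>+f. indicator ?C f \<partial>?M (insert b J))"
    using C by simp
  also have "\<dots> = (\<integral>\<^sup>+x. \<integral>\<^sup>+t. indicator ?C (x(b := t)) \<partial>lborel \<partial>?M J)"
    using C by (intro product_nn_integral_insert assms) simp
  also have "\<dots> = (\<integral>\<^sup>+x. indicator ?B x * ennreal (u - l) \<partial>?M J)"
  proof (intro nn_integral_cong)
    fix x assume x: "x \<in> space (?M J)"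
    have "x(b := t) \<in> space (?M (insert b J))" for t
      using x by (auto simp: space_PiM PiE_def extensional_def)
    moreover have "(\<Sum>i\<in>J. ((x(b := t)) i)\<^sup>2) = (\<Sum>i\<in>J. (x i)\<^sup>2)" for t
      using assms(2) by (intro sum.cong) auto
    ultimately have "indicator ?C (x(b := t)) = (indicator ?B x * indicator {l..u} t :: ennreal)" for t
      using x by (auto simp: indicator_def)
    then show "(\<integral>\<^sup>+t. indicator ?C (x(b := t)) \<partial>lborel) = indicator ?B x * ennreal (u - l)"
      using assms(4) by (simp add: nn_integral_cmult)
  qed
  also have "\<dots> = emeasure (?M J) ?B * ennreal (u - l)"
    using B by (simp add: nn_integral_multc)
  also have "\<dots> = ennreal (unit_ball_vol (real (card J)) * \<rho> ^ card J * (u - l))"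
    using assms by (simp add: emeasure_cball_aux ennreal_mult)
  finally show ?thesis .
qed

lemma norm_minus_Basis_component:
  assumes "b \<in> Basis"
  shows "norm (x - (x \<bullet> b) *\<^sub>R b) = sqrt (\<Sum>i\<in>Basis - {b}. (x \<bullet> i)\<^sup>2)"
proof -
  have "norm (x - (x \<bullet> b) *\<^sub>R b) = sqrt (\<Sum>i\<in>Basis. ((x - (x \<bullet> b) *\<^sub>R b) \<bullet> i)\<^sup>2)"
    by (subst norm_eq_sqrt_inner, subst euclidean_inner) (simp add: power2_eq_square)
  also have "(\<Sum>i\<in>Basis. ((x - (x \<bullet> b) *\<^sub>R b) \<bullet> i)\<^sup>2) = (\<Sum>i\<in>Basis - {b}. ((x - (x \<bullet> b) *\<^sub>R b) \<bullet> i)\<^sup>2)"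
    using assms by (intro sum.mono_neutral_right) (auto simp: inner_diff_left)
  also have "\<dots> = (\<Sum>i\<in>Basis - {b}. (x \<bullet> i)\<^sup>2)"
    using assms by (intro sum.cong) (auto simp: inner_diff_left inner_Basis)
  finally show ?thesis .
qed

lemma emeasure_lborel_PiM:
  fixes S :: "'a::euclidean_space set"
  assumes "S \<in> sets borel"
  shows "emeasure lborel S = emeasure (Pi\<^sub>M Basis (\<lambda>_. lborel))
     {f \<in> space (Pi\<^sub>M Basis (\<lambda>_. lborel)). (\<Sum>b\<in>Basis. f b *\<^sub>R b) \<in> S}"
  by (subst lborel_eq, subst emeasure_distr) (auto simp: assms vimage_def Int_def conj_commute)

lemma Basis_sum_inner:
  fixes b :: "'a::euclidean_space"
  assumes "b \<in> Basis"
  shows "(\<Sum>i\<in>Basis. f i *\<^sub>R i) \<bullet> b = f b"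
  using assms by (simp add: inner_sum_left inner_Basis if_distrib cong: if_cong)

definition cylinder :: "'a::euclidean_space \<Rightarrow> real \<Rightarrow> real \<Rightarrow> real \<Rightarrow> 'a set" where
  "cylinder e \<rho> l u = {x. norm (x - (x \<bullet> e) *\<^sub>R e) \<le> \<rho> \<and> l \<le> x \<bullet> e \<and> x \<bullet> e \<le> u}"

lemma closed_cylinder: "closed (cylinder e \<rho> l u)"
  unfolding cylinder_def by (intro closed_Collect_conj closed_Collect_le continuous_intros)

lemma vimage_cylinder:
  assumes "orthogonal_transformation T"
  shows "T -` cylinder (T e) \<rho> l u = cylinder e \<rho> l u"
proof -
  have "linear T" "\<And>v. norm (T v) = norm v" "\<And>v w. T v \<bullet> T w = v \<bullet> w"
    using assms by (simp_all add: orthogonal_transformation_linear orthogonal_transformation_norm, simp add: orthogonal_transformation_def)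
  moreover have "T x - c *\<^sub>R T e = T (x - c *\<^sub>R e)" for x c
    using \<open>linear T\<close> by (simp add: linear_diff linear_scale)
  ultimately show ?thesis by (auto simp: cylinder_def)
qed

lemma emeasure_vimage_orthogonal:
  fixes T :: "'a::euclidean_space \<Rightarrow> 'a"
  assumes "orthogonal_transformation T" "S \<in> sets borel"
  shows "emeasure lborel (T -` S) = emeasure lborel S" "T -` S \<in> sets borel"
proof -
  have T_meas: "T \<in> measurable borel borel"
    using orthogonal_transformation_linear[OF assms(1)]
    by (intro borel_measurable_continuous_onI linear_continuous_on) (simp add: linear_conv_bounded_linear)
  show "T -` S \<in> sets borel" using measurable_sets[OF T_meas assms(2)] by simp
  have "emeasure lborel S = emeasure (distr lborel borel T) S"
    by (simp add: lborel_distr_orthogonal[OF assms(1)])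
  also have "\<dots> = emeasure lborel (T -` S)" using T_meas assms(2) by (simp add: emeasure_distr)
  finally show "emeasure lborel (T -` S) = emeasure lborel S" ..
qed

lemma emeasure_cylinder:
  fixes e :: "'a::euclidean_space"
  assumes "norm e = 1" "\<rho> > 0" "l \<le> u"
  shows "emeasure lborel (cylinder e \<rho> l u)
    = ennreal (unit_ball_vol (real (DIM('a) - 1)) * \<rho> ^ (DIM('a) - 1) * (u - l))"
proof -
  obtain b :: 'a where b: "b \<in> Basis" using nonempty_Basis by blast
  obtain T where T: "orthogonal_transformation T" "T e = b"
    using householder_reflection[OF assms(1)] b norm_Basis by metis
  have eqB: "insert b (Basis - {b}) = (Basis :: 'a set)" using b by auto
  let ?M = "Pi\<^sub>M (Basis :: 'a set) (\<lambda>_. lborel :: real measure)"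
  have "emeasure lborel (cylinder e \<rho> l u) = emeasure lborel (cylinder b \<rho> l u)"
    using emeasure_vimage_orthogonal(1)[OF T(1), of "cylinder b \<rho> l u"] vimage_cylinder[OF T(1), of e \<rho> l u] T(2)
    by (simp add: closed_cylinder borel_closed)
  also have "\<dots> = emeasure ?M {f \<in> space ?M. (\<Sum>b\<in>Basis. f b *\<^sub>R b) \<in> cylinder b \<rho> l u}"
    by (rule emeasure_lborel_PiM) (simp add: closed_cylinder borel_closed)
  also have "{f \<in> space ?M. (\<Sum>b\<in>Basis. f b *\<^sub>R b) \<in> cylinder b \<rho> l u}
      = {f \<in> space ?M. sqrt (\<Sum>i\<in>Basis - {b}. (f i)\<^sup>2) \<le> \<rho> \<and> l \<le> f b \<and> f b \<le> u}"
    unfolding cylinder_def norm_minus_Basis_component[OF b] by (simp add: Basis_sum_inner b)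
  also have "emeasure ?M \<dots> = ennreal (unit_ball_vol (real (card (Basis - {b}))) * \<rho> ^ card (Basis - {b}) * (u - l))"
    using emeasure_PiM_cylinder[of "Basis - {b}" b \<rho> l u, unfolded eqB] assms by simp
  also have "card (Basis - {b}) = DIM('a) - 1" using b by simp
  finally show ?thesis .
qed

text \<open>In a basis containing the axis, membership in the cylinder depends monotonically on the
  absolute values of the coordinates, so it is an admissible \<open>Q\<close> for
  \<open>steiner_symmetrization\<close>. The symmetrized set has the same volume, and doubling its
  points leads into the cylinder, so it fits into the cylinder of half the radius and half the
  height.\<close>

lemma isodiametric_cylinder:
  fixes A :: "'a::euclidean_space set"
  assumes A: "A \<in> sets borel" and "norm e = 1" "\<rho> > 0" "w \<ge> 0"
    and diff: "\<And>x y. x \<in> A \<Longrightarrow> y \<in> A \<Longrightarrow> x - y \<in> cylinder e \<rho> (- w) w"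
  shows "emeasure lborel A \<le> ennreal (unit_ball_vol (real (DIM('a) - 1)) * (\<rho> / 2) ^ (DIM('a) - 1) * w)"
proof -
  obtain b :: 'a where b: "b \<in> Basis" using nonempty_Basis by blast
  obtain T where T: "orthogonal_transformation T" "T b = e"
    using householder_reflection[of b e] assms(2) b norm_Basis by metis
  have eqB: "insert b (Basis - {b}) = (Basis :: 'a set)" using b by auto
  let ?M = "Pi\<^sub>M (Basis :: 'a set) (\<lambda>_. lborel :: real measure)"
  let ?A = "{f \<in> space ?M. (\<Sum>b\<in>Basis. f b *\<^sub>R b) \<in> T -` A}"
  have TA: "T -` A \<in> sets borel" by (rule emeasure_vimage_orthogonal[OF T(1) A])
  define Q where "Q z \<longleftrightarrow> sqrt (\<Sum>i\<in>Basis - {b}. (z i)\<^sup>2) \<le> \<rho> \<and> \<bar>z b\<bar> \<le> w" for z :: "'a \<Rightarrow> real"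
  have "?A \<in> sets ?M"
    using TA by measurable
  then obtain B where B: "B \<in> sets ?M" "emeasure ?M B = emeasure ?M ?A" "\<And>x. x \<in> B \<Longrightarrow> Q (\<lambda>i. 2 * x i)"
  proof (rule steiner_symmetrization[of Basis ?A Q, rotated])
    fix x y assume "x \<in> ?A" "y \<in> ?A"
    moreover define X Y where "X = (\<Sum>b\<in>Basis. x b *\<^sub>R b)" and "Y = (\<Sum>b\<in>Basis. y b *\<^sub>R b)"
    ultimately have "T X - T Y \<in> cylinder e \<rho> (- w) w" using diff by auto
    then have "X - Y \<in> T -` cylinder (T b) \<rho> (- w) w"
      using T orthogonal_transformation_linear[OF T(1)] by (simp add: linear_diff)
    then have "X - Y \<in> cylinder b \<rho> (- w) w" by (simp add: vimage_cylinder[OF T(1)])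
    then show "Q (\<lambda>i. x i - y i)"
      unfolding cylinder_def norm_minus_Basis_component[OF b]
      using b by (auto simp: Q_def X_def Y_def Basis_sum_inner inner_diff_left)
  next
    fix z z' :: "'a \<Rightarrow> real" assume Q: "Q z" and le: "\<And>i. i \<in> Basis \<Longrightarrow> \<bar>z' i\<bar> \<le> \<bar>z i\<bar>"
    have "(\<Sum>i\<in>Basis - {b}. (z' i)\<^sup>2) \<le> (\<Sum>i\<in>Basis - {b}. (z i)\<^sup>2)"
      using le by (intro sum_mono) (auto simp: abs_le_square_iff)
    then have "sqrt (\<Sum>i\<in>Basis - {b}. (z' i)\<^sup>2) \<le> sqrt (\<Sum>i\<in>Basis - {b}. (z i)\<^sup>2)" by simp
    then show "Q z'" using Q le[OF b] unfolding Q_def by linarith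
  qed auto
  have "emeasure lborel A = emeasure ?M ?A"
    using emeasure_vimage_orthogonal(1)[OF T(1) A] emeasure_lborel_PiM[OF TA] by simp
  also have "\<dots> = emeasure ?M B" using B by simp
  also have "\<dots> \<le> emeasure ?M {f \<in> space ?M. sqrt (\<Sum>i\<in>Basis - {b}. (f i)\<^sup>2) \<le> \<rho> / 2 \<and> - (w / 2) \<le> f b \<and> f b \<le> w / 2}"
  proof (rule emeasure_mono)
    show "B \<subseteq> {f \<in> space ?M. sqrt (\<Sum>i\<in>Basis - {b}. (f i)\<^sup>2) \<le> \<rho> / 2 \<and> - (w / 2) \<le> f b \<and> f b \<le> w / 2}"
    proof
      fix f assume f: "f \<in> B"
      have "(\<Sum>i\<in>Basis - {b}. (2 * f i)\<^sup>2) = 2\<^sup>2 * (\<Sum>i\<in>Basis - {b}. (f i)\<^sup>2)"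
        by (simp add: sum_distrib_left power_mult_distrib)
      then have "sqrt (\<Sum>i\<in>Basis - {b}. (2 * f i)\<^sup>2) = 2 * sqrt (\<Sum>i\<in>Basis - {b}. (f i)\<^sup>2)"
        by (simp add: real_sqrt_mult)
      then show "f \<in> {f \<in> space ?M. sqrt (\<Sum>i\<in>Basis - {b}. (f i)\<^sup>2) \<le> \<rho> / 2 \<and> - (w / 2) \<le> f b \<and> f b \<le> w / 2}"
        using B(3)[OF f] f B(1) sets.sets_into_space[OF B(1)] by (auto simp: Q_def)
    qed
    show "{f \<in> space ?M. sqrt (\<Sum>i\<in>Basis - {b}. (f i)\<^sup>2) \<le> \<rho> / 2 \<and> - (w / 2) \<le> f b \<and> f b \<le> w / 2} \<in> sets ?M"
      using b by measurable
  qed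
  also have "\<dots> = ennreal (unit_ball_vol (real (card (Basis - {b}))) * (\<rho> / 2) ^ card (Basis - {b}) * w)"
    using emeasure_PiM_cylinder[of "Basis - {b}" b "\<rho> / 2" "- (w / 2)" "w / 2", unfolded eqB] assms by simp
  also have "card (Basis - {b}) = DIM('a) - 1" using b by simp
  finally show ?thesis .
qed

section \<open>The cone measure on the unit sphere\<close>

text \<open>The cone over a piece of the unit sphere has volume \<open>1 / DIM('a)\<close> times the
  area of the piece, which explains the factor. \<open>sgn\<close> is the radial projection to the
  sphere; it sends the centre to \<open>0\<close>, but the centre is a null set. Keeping all Borel
  sets of the space allows a direct comparison with \<open>hausdorff_measure\<close>.\<close>

definition cone_measure :: "'a::euclidean_space measure" where
  "cone_measure = scale_measure (ennreal (real DIM('a))) (distr (restrict_space lborel (ball 0 1)) borel sgn)"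

definition radial_measure :: "nat \<Rightarrow> real measure" where
  "radial_measure n = density lborel (\<lambda>r. ennreal (r ^ (n - 1)) * indicator {0<..} r)"

lemma sets_cone_measure [measurable_cong, simp]: "sets cone_measure = sets borel"
  by (simp add: cone_measure_def)

lemma space_cone_measure [simp]: "space cone_measure = UNIV"
  using sets_eq_imp_space_eq[OF sets_cone_measure] by simp

lemma sets_radial_measure [measurable_cong, simp]: "sets (radial_measure n) = sets borel"
  by (simp add: radial_measure_def)

lemma space_radial_measure [simp]: "space (radial_measure n) = UNIV"
  by (simp add: radial_measure_def)

lemma emeasure_cone_measure:
  fixes E :: "'a::euclidean_space set"
  assumes [measurable]: "E \<in> sets borel"
  shows "emeasure cone_measure E = ennreal (real DIM('a)) * emeasure lborel {x. norm x < 1 \<and> sgn x \<in> E}"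
proof -
  have "emeasure (distr (restrict_space lborel (ball 0 1)) borel sgn) E
      = emeasure (restrict_space lborel (ball 0 1)) (sgn -` E \<inter> ball 0 1)"
    by (subst emeasure_distr) (auto simp: space_restrict_space intro!: measurable_restrict_space1)
  also have "\<dots> = emeasure lborel (sgn -` E \<inter> ball 0 1)"
    by (rule emeasure_restrict_space) auto
  also have "sgn -` E \<inter> ball 0 1 = {x. norm x < 1 \<and> sgn x \<in> E}" by auto
  finally show ?thesis by (simp add: cone_measure_def)
qed

lemma emeasure_cone_measure_finite: "emeasure (cone_measure :: 'a::euclidean_space measure) UNIV < top"
proof -
  have "{x::'a. norm x < 1 \<and> sgn x \<in> UNIV} = ball 0 1" by auto
  then show ?thesis
    by (simp add: emeasure_cone_measure emeasure_ball ennreal_mult_less_top)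
qed

lemma finite_measure_cone_measure: "finite_measure cone_measure"
  using emeasure_cone_measure_finite by (intro finite_measureI) (auto simp: less_top)

lemma emeasure_cone_measure_outside:
  assumes [measurable]: "E \<in> sets borel" and "E \<inter> sphere 0 1 = {}"
  shows "emeasure cone_measure E = 0"
proof -
  have "{x. norm x < 1 \<and> sgn x \<in> E} \<subseteq> {0}"
  proof
    fix x assume "x \<in> {x. norm x < 1 \<and> sgn x \<in> E}"
    then have "sgn x \<notin> sphere 0 1" using assms(2) by auto
    then show "x \<in> {0}" by (auto simp: norm_sgn split: if_splits)
  qed
  then have "emeasure lborel {x. norm x < 1 \<and> sgn x \<in> E} = 0"
    by (intro emeasure_lborel_countable) (auto dest: countable_subset)
  then show ?thesis by (simp add: emeasure_cone_measure)
qed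

lemma emeasure_cone_measure_Int_sphere:
  assumes [measurable]: "E \<in> sets borel"
  shows "emeasure cone_measure (E \<inter> sphere 0 1) = emeasure cone_measure E"
proof -
  have "emeasure cone_measure E = emeasure cone_measure ((E \<inter> sphere 0 1) \<union> (E - sphere 0 1))"
    by (rule arg_cong[where f="emeasure cone_measure"]) auto
  also have "\<dots> = emeasure cone_measure (E \<inter> sphere 0 1)"
  proof (rule emeasure_Un_null_set)
    show "E - sphere 0 1 \<in> null_sets cone_measure"
      using emeasure_cone_measure_outside[of "E - sphere 0 1"] by (auto simp: null_sets_def)
  qed simp
  finally show ?thesis ..
qed

lemma emeasure_lborel_cone_ball:
  fixes E :: "'a::euclidean_space set"
  assumes [measurable]: "E \<in> sets borel" and "r > 0"
  shows "emeasure lborel {x. norm x < r \<and> sgn x \<in> E} = ennreal (r ^ DIM('a) / DIM('a)) * emeasure cone_measure E"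
proof -
  let ?S = "{x. norm x < r \<and> sgn x \<in> E}"
  have "emeasure lborel ?S = emeasure (density (distr lborel borel (\<lambda>x. 0 + r *\<^sub>R x)) (\<lambda>_. ennreal (\<bar>r\<bar> ^ DIM('a)))) ?S"
    using lborel_affine[of r "0::'a"] assms(2) by simp
  also have "\<dots> = ennreal (r ^ DIM('a)) * emeasure (distr lborel borel (\<lambda>x. r *\<^sub>R x)) ?S"
    using assms(2) by (simp add: emeasure_density_const)
  also have "emeasure (distr lborel borel (\<lambda>x. r *\<^sub>R x)) ?S = emeasure lborel ((\<lambda>x. r *\<^sub>R x) -` ?S)"
    by (simp add: emeasure_distr)
  also have "(\<lambda>x. r *\<^sub>R x) -` ?S = {x. norm x < 1 \<and> sgn x \<in> E}"
    using assms(2) by (auto simp: sgn_scaleR)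
  also have "emeasure lborel {x. norm x < 1 \<and> sgn x \<in> E} = ennreal (1 / DIM('a)) * emeasure cone_measure E"
    by (simp add: emeasure_cone_measure mult.assoc[symmetric] ennreal_mult[symmetric])
  finally show ?thesis
    using assms(2) by (simp add: mult.assoc[symmetric] ennreal_mult[symmetric])
qed

lemma emeasure_radial_measure_lessThan:
  assumes "n > 0"
  shows "emeasure (radial_measure n) {..<r} = (if r \<le> 0 then 0 else ennreal (r ^ n / n))"
proof -
  have "emeasure (radial_measure n) {..<r} = (\<integral>\<^sup>+t. ennreal (t ^ (n - 1)) * indicator {0<..<r} t \<partial>lborel)"
    unfolding radial_measure_def by (subst emeasure_density) (auto intro!: nn_integral_cong simp: indicator_def)
  also have "\<dots> = (if r \<le> 0 then 0 else ennreal (r ^ n / n))"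
  proof (cases "r \<le> 0")
    case False
    have "(\<integral>\<^sup>+t. ennreal (t ^ (n - 1)) * indicator {0<..<r} t \<partial>lborel) = (\<integral>\<^sup>+t. ennreal (t ^ (n - 1)) * indicator {0..r} t \<partial>lborel)"
    proof (intro nn_integral_cong_AE)
      have "AE t in lborel. t \<noteq> 0 \<and> t \<noteq> r" by (intro AE_conjI AE_lborel_singleton)
      then show "AE t in lborel. ennreal (t ^ (n - 1)) * indicator {0<..<r} t = ennreal (t ^ (n - 1)) * indicator {0..r} t"
        by eventually_elim (auto simp: indicator_def)
    qed
    also have "\<dots> = ennreal (r ^ n / n - 0 ^ n / n)"
    proof (rule nn_integral_FTC_Icc)
      fix x :: real
      show "((\<lambda>t. t ^ n / real n) has_real_derivative x ^ (n - 1)) (at x)"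
        using assms by (auto intro!: derivative_eq_intros)
    qed (use False in auto)
    finally show ?thesis using False assms by (simp add: zero_power)
  qed simp
  finally show ?thesis .
qed

text \<open>For fixed \<open>E\<close> both sides are measures in \<open>A\<close>. They agree on
  the half-lines \<open>{..<r}\<close> by scaling the cone over \<open>E\<close>, and half-lines are
  an intersection-stable generator on which the measures are finite.\<close>

lemma emeasure_polar:
  fixes E :: "'a::euclidean_space set"
  assumes A: "A \<in> sets borel" and E [measurable]: "E \<in> sets borel"
  shows "emeasure lborel {x. norm x \<in> A \<and> sgn x \<in> E} = emeasure (radial_measure DIM('a)) A * emeasure cone_measure E"
proof -
  define M where "M = distr (restrict_space lborel (sgn -` E)) borel (norm :: 'a \<Rightarrow> real)"
  define N where "N = scale_measure (emeasure cone_measure E) (radial_measure DIM('a))"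
  have sE: "sgn -` E \<in> sets borel" using measurable_sets[OF borel_measurable_sgn E] by simp
  have M: "emeasure M X = emeasure lborel {x. norm x \<in> X \<and> sgn x \<in> E}" if [measurable]: "X \<in> sets borel" for X
  proof -
    have "emeasure M X = emeasure (restrict_space lborel (sgn -` E)) (norm -` X \<inter> sgn -` E)"
      unfolding M_def by (subst emeasure_distr) (auto simp: space_restrict_space intro!: measurable_restrict_space1)
    also have "\<dots> = emeasure lborel (norm -` X \<inter> sgn -` E)"
      by (rule emeasure_restrict_space) (use sE in auto)
    also have "norm -` X \<inter> sgn -` E = {x. norm x \<in> X \<and> sgn x \<in> E}" by auto
    finally show ?thesis .
  qed
  have N: "emeasure N X = emeasure (radial_measure DIM('a)) X * emeasure cone_measure E" for X
    by (simp add: N_def mult.commute)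
  have less: "emeasure M {..<r} = emeasure N {..<r}" for r
  proof (cases "r \<le> 0")
    case True
    then have e: "{x. norm x \<in> {..<r} \<and> sgn x \<in> E} = {}"
      by (auto simp: not_less intro: order_trans[OF True norm_ge_zero])
    have "emeasure M {..<r} = 0" by (subst M) (simp_all only: e emeasure_empty, simp)
    then show ?thesis using True by (simp add: N emeasure_radial_measure_lessThan)
  next
    case False
    then show ?thesis
      using emeasure_lborel_cone_ball[OF E, of r] by (simp add: M N emeasure_radial_measure_lessThan)
  qed
  have "M = N"
  proof (rule measure_eqI_generator_eq[where E="range lessThan" and \<Omega>=UNIV and A="\<lambda>i. {..<real i}"])
    show "Int_stable (range (lessThan :: real \<Rightarrow> real set))"
    proof -
      have "{..<a} \<inter> {..<b} = {..<min a b}" for a b :: real by auto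
      then show ?thesis by (auto simp: Int_stable_def)
    qed
    show "sets M = sigma_sets UNIV (range lessThan)"
      by (simp add: M_def borel_Iio)
    show "sets N = sigma_sets UNIV (range lessThan)"
      by (simp add: N_def) (simp add: borel_Iio)
    show "(\<Union>i. {..<real i}) = UNIV" using reals_Archimedean2 by auto
    fix i :: nat
    have "emeasure cone_measure E < top"
      by (rule le_less_trans[OF emeasure_mono emeasure_cone_measure_finite]) auto
    then show "emeasure M {..<real i} \<noteq> \<infinity>"
      unfolding less N by (auto simp: emeasure_radial_measure_lessThan ennreal_mult_eq_top_iff)
  qed (use less in auto)
  then show ?thesis using M[OF A] N[of A] by simp
qed

lemma emeasure_radial_measure_Ico_bounds:
  assumes "0 < a" "a \<le> b"
  shows "ennreal (a ^ (n - 1) * (b - a)) \<le> emeasure (radial_measure n) {a..<b}"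
    and "emeasure (radial_measure n) {a..<b} \<le> ennreal (b ^ (n - 1) * (b - a))"
proof -
  have eq: "emeasure (radial_measure n) {a..<b} = (\<integral>\<^sup>+t. ennreal (t ^ (n - 1)) * indicator {a..<b} t \<partial>lborel)"
    unfolding radial_measure_def using assms
    by (subst emeasure_density) (auto intro!: nn_integral_cong simp: indicator_def)
  have const: "(\<integral>\<^sup>+t. ennreal c * indicator {a..<b} t \<partial>lborel) = ennreal (c * (b - a))" if "c \<ge> 0" for c
    using assms that by (simp add: nn_integral_cmult_indicator ennreal_mult)
  have "ennreal (a ^ (n - 1) * (b - a)) = (\<integral>\<^sup>+t. ennreal (a ^ (n - 1)) * indicator {a..<b} t \<partial>lborel)"
    using assms by (simp add: const)
  also have "\<dots> \<le> emeasure (radial_measure n) {a..<b}"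
    unfolding eq using assms by (intro nn_integral_mono) (auto simp: indicator_def intro!: ennreal_leI power_mono)
  finally show "ennreal (a ^ (n - 1) * (b - a)) \<le> emeasure (radial_measure n) {a..<b}" .
  have "emeasure (radial_measure n) {a..<b} \<le> (\<integral>\<^sup>+t. ennreal (b ^ (n - 1)) * indicator {a..<b} t \<partial>lborel)"
    unfolding eq using assms by (intro nn_integral_mono) (auto simp: indicator_def intro!: ennreal_leI power_mono)
  also have "\<dots> = ennreal (b ^ (n - 1) * (b - a))" using assms by (simp add: const)
  finally show "emeasure (radial_measure n) {a..<b} \<le> ennreal (b ^ (n - 1) * (b - a))" .
qed


section \<open>Cone measure of small pieces of the sphere\<close>

lemma power2_norm_minus_projection:
  fixes e :: "'a::real_inner"
  assumes "norm e = 1"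
  shows "(norm (z - (z \<bullet> e) *\<^sub>R e))\<^sup>2 = (norm z)\<^sup>2 - (z \<bullet> e)\<^sup>2"
proof -
  have "e \<bullet> e = 1" using assms by (simp add: norm_eq_1)
  then show ?thesis
    unfolding power2_norm_eq_inner by (simp add: inner_diff inner_commute power2_eq_square)
qed

text \<open>Thicken \<open>C\<close> radially to the cone piece of height \<open>h\<close>; its differences lie in a
  cylinder around the axis \<open>e \<in> C\<close>, so the isodiametric bound in dimension \<open>DIM('a)\<close> applies.\<close>
lemma cone_measure_le_diam:
  fixes C :: "'a::euclidean_space set"
  assumes C: "C \<in> sets borel" "C \<subseteq> sphere 0 1"
    and d: "\<And>x y. x \<in> C \<Longrightarrow> y \<in> C \<Longrightarrow> dist x y \<le> d" and dh: "0 < d" "d \<le> h" "h < 1"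
  shows "ennreal ((1 - h) ^ (DIM('a) - 1)) * emeasure cone_measure C
    \<le> ennreal (unit_ball_vol (real (DIM('a) - 1)) * (d / 2) ^ (DIM('a) - 1) * (1 + h) ^ DIM('a))"
proof (cases "C = {}")
  case False
  then obtain e where e: "e \<in> C" by auto
  let ?k = "DIM('a) - 1"
  let ?K = "{x. norm x \<in> {1 - h..<1} \<and> sgn x \<in> C}"
  \<comment> \<open>The bound for the axial extent of \<open>?K\<close>: the radii vary by at most
    \<open>h\<close>, and a unit vector at distance at most \<open>d\<close> from \<open>e\<close>
    has axial coordinate at least \<open>1 - d\<^sup>2 / 2\<close>.\<close>
  define w where "w = h + d\<^sup>2 / 2"
  have h: "0 < h" using dh by simp
  have ne: "norm e = 1" using e C by auto
  have ee: "e \<bullet> e = 1" using ne by (simp add: norm_eq_1)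
  have proj: "norm (z - (z \<bullet> e) *\<^sub>R e) \<le> norm z" for z
  proof -
    have "(norm (z - (z \<bullet> e) *\<^sub>R e))\<^sup>2 \<le> (norm z)\<^sup>2"
      using power2_norm_minus_projection[OF ne, of z] by simp
    then show ?thesis by (rule power2_le_imp_le) simp
  qed
  have inner_e: "1 - d\<^sup>2 / 2 \<le> x \<bullet> e \<and> x \<bullet> e \<le> 1" if "x \<in> C" for x
  proof -
    have nx: "norm x = 1" using that C by auto
    have "(dist x e)\<^sup>2 = 2 - 2 * (x \<bullet> e)"
      using nx ne by (simp add: dist_norm power2_norm_eq_inner inner_diff inner_commute norm_eq_1)
    moreover have "(dist x e)\<^sup>2 \<le> d\<^sup>2" using d[OF that e] by (intro power_mono) auto
    ultimately have "1 - d\<^sup>2 / 2 \<le> x \<bullet> e" by simp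
    moreover have "x \<bullet> e \<le> 1" using norm_cauchy_schwarz[of x e] nx ne by simp
    ultimately show ?thesis by simp
  qed
  have d2: "d\<^sup>2 / 2 \<le> 1"
    using dh mult_mono[of d 1 d 1] by (simp add: power2_eq_square)
  have K: "x - y \<in> cylinder e (d * (1 + h)) (- w) w" if x: "x \<in> ?K" and y: "y \<in> ?K" for x y
  proof -
    define r s u v where "r = norm x" "s = norm y" "u = sgn x" "v = sgn y"
    have xy: "x = r *\<^sub>R u" "y = s *\<^sub>R v"
      by (cases "x = 0"; cases "y = 0"; simp add: r_s_u_v_def sgn_div_norm)+
    have rs: "1 - h \<le> r" "r < 1" "1 - h \<le> s" "s < 1" and uv: "u \<in> C" "v \<in> C"
      using x y by (auto simp: r_s_u_v_def)
    define P where "P z = z - (z \<bullet> e) *\<^sub>R e" for z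
    \<comment> \<open>Since \<open>P e = 0\<close>, the vector \<open>v\<close> in the radial term
      may be replaced by \<open>v - e\<close>. That term is then at most \<open>h * d\<close>
      instead of order \<open>h\<close>, which keeps the radius of the cylinder close to
      \<open>d\<close>.\<close>
    have "P (x - y) = r *\<^sub>R P (u - v) + (r - s) *\<^sub>R P (v - e)"
      by (simp add: P_def xy algebra_simps inner_diff_left ee)
    also have "norm \<dots> \<le> r * norm (P (u - v)) + \<bar>r - s\<bar> * norm (P (v - e))"
      using rs dh by (intro order_trans[OF norm_triangle_ineq]) simp
    also have "\<dots> \<le> 1 * d + h * d"
      using d[OF uv] d[OF uv(2) e] proj[of "u - v"] proj[of "v - e"] rs dh
      by (intro add_mono mult_mono) (auto simp: P_def dist_norm)
    finally have 1: "norm (P (x - y)) \<le> d * (1 + h)" by (simp add: algebra_simps)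
    have bnd: "1 - w \<le> t * (z \<bullet> e) \<and> t * (z \<bullet> e) \<le> 1" if "1 - h \<le> t" "t < 1" "z \<in> C" for t z
    proof
      have z: "1 - d\<^sup>2 / 2 \<le> z \<bullet> e" "z \<bullet> e \<le> 1" using inner_e[OF that(3)] by auto
      have "0 \<le> h * (d\<^sup>2 / 2)" using h by simp
      then have "1 - w \<le> (1 - h) * (1 - d\<^sup>2 / 2)" by (simp add: w_def algebra_simps)
      also have "\<dots> \<le> t * (z \<bullet> e)" using that z d2 dh by (intro mult_mono) auto
      finally show "1 - w \<le> t * (z \<bullet> e)" .
      have "t * (z \<bullet> e) \<le> 1 * 1" using that z d2 dh by (intro mult_mono) auto
      then show "t * (z \<bullet> e) \<le> 1" by simp
    qed
    have "\<bar>(x - y) \<bullet> e\<bar> \<le> w"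
      using bnd[OF rs(1,2) uv(1)] bnd[OF rs(3,4) uv(2)] by (simp add: xy inner_diff_left abs_le_iff)
    with 1 show ?thesis by (auto simp: cylinder_def P_def abs_le_iff)
  qed
  have [measurable]: "C \<in> sets borel" by fact
  have "?K \<in> sets borel" by measurable
  then have "emeasure lborel ?K \<le> ennreal (unit_ball_vol (real ?k) * (d * (1 + h) / 2) ^ ?k * w)"
    by (intro isodiametric_cylinder[OF _ ne _ _ K]) (use h dh in \<open>auto simp: w_def\<close>)
  \<comment> \<open>Because \<open>d \<le> h\<close>, the height is \<open>h\<close> up to the
    factor \<open>1 + h\<close>. This \<open>h\<close> cancels below against the radial thickness of
    \<open>?K\<close>.\<close>
  also have "\<dots> \<le> ennreal (unit_ball_vol (real ?k) * (d * (1 + h) / 2) ^ ?k * (h * (1 + h)))"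
  proof (intro ennreal_leI mult_left_mono)
    have "d\<^sup>2 \<le> h\<^sup>2" using dh by (intro power_mono) auto
    moreover have "h * (1 + h) = h + h\<^sup>2" by (simp add: power2_eq_square algebra_simps)
    ultimately show "w \<le> h * (1 + h)" using zero_le_power2[of h] unfolding w_def by linarith
  qed (use dh h in auto)
  also have "unit_ball_vol (real ?k) * (d * (1 + h) / 2) ^ ?k * (h * (1 + h))
      = h * (unit_ball_vol (real ?k) * (d / 2) ^ ?k * (1 + h) ^ DIM('a))"
    using power_minus_mult[of "DIM('a)" "1 + h"] by (simp add: power_mult_distrib power_divide)
  finally have "emeasure lborel ?K \<le> ennreal h * ennreal (unit_ball_vol (real ?k) * (d / 2) ^ ?k * (1 + h) ^ DIM('a))"
    using h by (simp add: ennreal_mult')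
  moreover have "ennreal h * (ennreal ((1 - h) ^ ?k) * emeasure cone_measure C) \<le> emeasure lborel ?K"
  proof -
    have "ennreal ((1 - h) ^ ?k * (1 - (1 - h))) * emeasure cone_measure C \<le> emeasure (radial_measure DIM('a)) {1 - h..<1} * emeasure cone_measure C"
      using dh h by (intro mult_right_mono emeasure_radial_measure_Ico_bounds(1)) auto
    also have "\<dots> = emeasure lborel ?K"
      using emeasure_polar[of "{1 - h..<1}" C] by simp
    finally show ?thesis using h dh by (simp add: ennreal_mult' mult_ac)
  qed
  ultimately have "ennreal h * (ennreal ((1 - h) ^ ?k) * emeasure cone_measure C)
     \<le> ennreal h * ennreal (unit_ball_vol (real ?k) * (d / 2) ^ ?k * (1 + h) ^ DIM('a))" by simp
  then show ?thesis using h by (subst (asm) ennreal_mult_le_mult_iff) auto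
qed simp

text \<open>\<open>cone_measure_le_diam\<close> needs a positive \<open>d\<close> and a Borel set. A
  covering set is therefore replaced by its closure, which has the same diameter, and the bound for
  all \<open>d\<close> slightly above the diameter is passed to the limit. This includes diameter
  \<open>0\<close>.\<close>

lemma cone_measure_le_diameter:
  fixes C :: "'a::euclidean_space set"
  assumes C: "bounded C" and dh: "diameter C < h" "h < 1"
  shows "ennreal ((1 - h) ^ (DIM('a) - 1)) * emeasure cone_measure (closure C)
    \<le> ennreal ((1 + h) ^ DIM('a)) * ennreal (hausdorff_piece (real (DIM('a) - 1)) C)"
proof (cases "C = {}")
  case False
  let ?k = "DIM('a) - 1"
  let ?C = "closure C \<inter> sphere 0 1"
  let ?D = "diameter C"
  let ?f = "\<lambda>d. unit_ball_vol (real ?k) * (d / 2) ^ ?k * (1 + h) ^ DIM('a)"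
  have D0: "0 \<le> ?D" by (rule diameter_ge_0[OF C])
  have fin: "emeasure cone_measure (closure C) < top"
    by (rule le_less_trans[OF emeasure_mono emeasure_cone_measure_finite]) auto
  define s where "s = (1 - h) ^ ?k * measure cone_measure (closure C)"
  have s: "ennreal ((1 - h) ^ ?k) * emeasure cone_measure (closure C) = ennreal s"
    using fin dh by (simp add: s_def ennreal_mult emeasure_eq_ennreal_measure less_top)
  have le: "s \<le> ?f d" if "?D < d" "d < h" for d
  proof -
    have "ennreal ((1 - h) ^ ?k) * emeasure cone_measure ?C \<le> ennreal (?f d)"
    proof (rule cone_measure_le_diam)
      fix x y assume "x \<in> ?C" "y \<in> ?C"
      then have "dist x y \<le> diameter (closure C)"
        using diameter_bounded_bound[of "closure C" x y] C by auto
      then show "dist x y \<le> d" using that C by (simp add: diameter_closure)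
    qed (use that dh D0 in auto)
    then have "ennreal s \<le> ennreal (?f d)"
      by (simp only: emeasure_cone_measure_Int_sphere[OF borel_closed[OF closed_closure]] s)
    then show ?thesis using that D0 dh by (subst (asm) ennreal_le_iff) auto
  qed
  have "s \<le> ?f ?D"
  proof (rule tendsto_lowerbound)
    show "(?f \<longlongrightarrow> ?f ?D) (at_right ?D)" by (intro tendsto_intros) simp
    show "\<forall>\<^sub>F d in at_right ?D. s \<le> ?f d"
      using le dh(1) by (auto simp: eventually_at_right_field)
  qed simp
  then have "ennreal s \<le> ennreal (?f ?D)" by (rule ennreal_leI)
  also have "?f ?D = (1 + h) ^ DIM('a) * hausdorff_piece (real ?k) C"
    using C False by (simp only: hausdorff_piece_of_nat) simp
  also have "ennreal ((1 + h) ^ DIM('a) * hausdorff_piece (real ?k) C)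
      = ennreal ((1 + h) ^ DIM('a)) * ennreal (hausdorff_piece (real ?k) C)"
    using dh D0 by (intro ennreal_mult') auto
  finally show ?thesis unfolding s .
qed simp

text \<open>The thickened cap \<open>?K\<close> contains a flat cylinder. Its radius
  \<open>r * (1 - r)\<close> keeps the slope against the axis at most \<open>r\<close>, as the axial
  coordinate is at least \<open>1 - r\<close>; its top \<open>1 - r\<^sup>2\<close> keeps it inside
  the unit ball. Its height is again \<open>r * (1 - r)\<close>, and one factor \<open>r\<close>
  cancels against the thickness of \<open>?K\<close>.\<close>

lemma cone_measure_cball_ge:
  fixes e :: "'a::euclidean_space"
  assumes e: "norm e = 1" and r: "0 < r" "r < 1"
  shows "ennreal (unit_ball_vol (real (DIM('a) - 1)) * r ^ (DIM('a) - 1) * (1 - r) ^ DIM('a))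
    \<le> emeasure cone_measure (cball e r)"
proof -
  let ?k = "DIM('a) - 1"
  let ?K = "{x. norm x \<in> {1 - r..<1} \<and> sgn x \<in> cball e r}"
  have ee: "e \<bullet> e = 1" using e by (simp add: norm_eq_1)
  have sub: "cylinder e (r * (1 - r)) (1 - r) (1 - r\<^sup>2) \<subseteq> ?K"
  proof
    fix x assume x: "x \<in> cylinder e (r * (1 - r)) (1 - r) (1 - r\<^sup>2)"
    define q p where "q = x \<bullet> e" and "p = norm (x - q *\<^sub>R e)"
    have p: "0 \<le> p" "p \<le> r * (1 - r)" and q: "1 - r \<le> q" "q \<le> 1 - r\<^sup>2"
      using x by (auto simp: cylinder_def p_def q_def)
    have q0: "q > 0" using q r by simp
    have nx: "(norm x)\<^sup>2 = p\<^sup>2 + q\<^sup>2"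
      using power2_norm_minus_projection[OF e, of x] by (simp add: p_def q_def)
    have qx: "q \<le> norm x" by (rule power2_le_imp_le) (simp_all add: nx)
    have "p\<^sup>2 + q\<^sup>2 \<le> (r * (1 - r))\<^sup>2 + (1 - r\<^sup>2)\<^sup>2"
      using p q q0 by (intro add_mono power_mono) auto
    also have "\<dots> = 1 - r\<^sup>2 - 2 * r ^ 3 * (1 - r)"
      by (simp add: power2_eq_square power3_eq_cube algebra_simps)
    also have "\<dots> < 1"
    proof -
      have "0 < r\<^sup>2" "0 \<le> 2 * r ^ 3 * (1 - r)" using r by auto
      then show ?thesis by linarith
    qed
    finally have "(norm x)\<^sup>2 < 1\<^sup>2" by (simp add: nx)
    then have x1: "norm x < 1" by (rule power2_less_imp_less) simp
    have x0: "norm x > 0" using qx q0 by linarith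
    have "(dist e (sgn x))\<^sup>2 = 2 - 2 * q / norm x"
    proof -
      have "sgn x \<bullet> sgn x = 1" using x0 by (metis norm_eq_1 norm_sgn norm_zero less_irrefl)
      moreover have "e \<bullet> sgn x = q / norm x" by (simp add: q_def sgn_div_norm inner_commute divide_inverse_commute)
      ultimately show ?thesis
        by (simp add: dist_norm power2_norm_eq_inner inner_diff ee inner_commute)
    qed
    \<comment> \<open>With \<open>t\<close> the angle between \<open>x\<close> and \<open>e\<close>,
      this reads \<open>2 - 2 * cos t \<le> (tan t)\<^sup>2\<close>, where
      \<open>cos t = q / norm x\<close> and \<open>tan t = p / q\<close>.\<close>
    also have "\<dots> \<le> p\<^sup>2 / q\<^sup>2"
    proof -
      have "2 * norm x * q\<^sup>2 - 2 * q * q\<^sup>2 \<le> p\<^sup>2 * norm x"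
      proof -
        have "2 * q\<^sup>2 * (norm x - q) \<le> (norm x + q) * norm x * (norm x - q)"
        proof (rule mult_right_mono)
          have "q * q \<le> norm x * norm x" "q * q \<le> q * norm x" using qx q0 by (auto intro: mult_mono)
          then show "2 * q\<^sup>2 \<le> (norm x + q) * norm x" by (simp add: power2_eq_square algebra_simps)
        qed (use qx in simp)
        also have "\<dots> = ((norm x)\<^sup>2 - q\<^sup>2) * norm x" by (simp add: power2_eq_square algebra_simps)
        also have "\<dots> = p\<^sup>2 * norm x" by (simp add: nx)
        finally show ?thesis by (simp add: algebra_simps)
      qed
      then show ?thesis using x0 q0 by (simp add: field_simps)
    qed
    also have "\<dots> \<le> r\<^sup>2"
    proof -
      have "r * (1 - r) \<le> r * q" using q r by (intro mult_left_mono) auto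
      then have "p \<le> r * q" using p by simp
      then have "p / q \<le> r" using q0 by (simp add: divide_le_eq)
      then show ?thesis unfolding power_divide[symmetric] using p q0 by (intro power_mono) auto
    qed
    finally have "dist e (sgn x) \<le> r" by (rule power2_le_imp_le) (use r in simp)
    then show "x \<in> ?K" using x1 qx q by simp
  qed
  have "ennreal r * ennreal (unit_ball_vol (real ?k) * r ^ ?k * (1 - r) ^ DIM('a))
      = ennreal (unit_ball_vol (real ?k) * (r * (1 - r)) ^ ?k * (1 - r\<^sup>2 - (1 - r)))"
  proof -
    have "(1 - r) ^ DIM('a) = (1 - r) ^ ?k * (1 - r)"
      using power_minus_mult[of "DIM('a)" "1 - r"] by simp
    moreover have "1 - r\<^sup>2 - (1 - r) = r * (1 - r)" by (simp add: power2_eq_square algebra_simps)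
    ultimately have "r * (unit_ball_vol (real ?k) * r ^ ?k * (1 - r) ^ DIM('a))
        = unit_ball_vol (real ?k) * (r * (1 - r)) ^ ?k * (1 - r\<^sup>2 - (1 - r))"
      by (simp add: power_mult_distrib)
    then show ?thesis using r by (simp only: ennreal_mult'[symmetric] less_imp_le)
  qed
  also have "\<dots> = emeasure lborel (cylinder e (r * (1 - r)) (1 - r) (1 - r\<^sup>2))"
  proof (rule emeasure_cylinder[symmetric])
    show "1 - r \<le> 1 - r\<^sup>2" using r mult_left_mono[of r 1 r] by (simp add: power2_eq_square)
  qed (use e r in auto)
  also have "\<dots> \<le> emeasure lborel ?K"
  proof (rule emeasure_mono[OF sub])
    have [measurable]: "cball e r \<in> sets borel" by simp
    have "?K \<in> sets borel" by measurable
    then show "?K \<in> sets lborel" by simp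
  qed
  also have "\<dots> = emeasure (radial_measure DIM('a)) {1 - r..<1} * emeasure cone_measure (cball e r)"
    by (rule emeasure_polar) auto
  also have "\<dots> \<le> ennreal r * emeasure cone_measure (cball e r)"
    using emeasure_radial_measure_Ico_bounds(2)[of "1 - r" 1 "DIM('a)"] r by (intro mult_right_mono) auto
  finally show ?thesis using r by (subst (asm) ennreal_mult_le_mult_iff) auto
qed

section \<open>Hausdorff measure of the sphere\<close>

lemma hausdorff_pre_bounded_le:
  assumes "bounded C" "diameter C \<le> \<delta>" "\<delta> > 0"
  shows "hausdorff_pre s \<delta> C \<le> ennreal (hausdorff_piece s C)"
proof -
  have "hausdorff_pre s \<delta> C \<le> (\<Sum>i::nat. ennreal (hausdorff_piece s (if i = 0 then C else {})))"
    using assms by (intro hausdorff_pre_le) (auto split: if_splits)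
  also have "\<dots> = ennreal (hausdorff_piece s C)"
    by (subst suminf_finite[of "{0}"]) (auto simp: hausdorff_piece_def)
  finally show ?thesis .
qed

text \<open>Summing \<open>cone_measure_le_diameter\<close> over a cover of mesh
  \<open>h / 2\<close> loses only the factor \<open>q h\<close>, which tends to \<open>1\<close> as
  \<open>h\<close> tends to \<open>0\<close>. The half makes the diameters strictly smaller than
  \<open>h\<close>.\<close>

lemma cone_measure_le_hausdorff_outer:
  fixes E :: "'a::euclidean_space set"
  assumes E: "E \<in> sets borel"
  shows "emeasure cone_measure E \<le> hausdorff_outer (real (DIM('a) - 1)) E"
proof -
  let ?k = "DIM('a) - 1"
  define q where "q h = (1 - h) ^ ?k / (1 + h) ^ DIM('a)" for h :: real
  interpret finite_measure "cone_measure :: 'a measure" by (rule finite_measure_cone_measure)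
  define s where "s = measure cone_measure E"
  have s: "emeasure cone_measure E = ennreal s" by (simp add: s_def emeasure_eq_measure)
  have le: "ennreal (q h * s) \<le> hausdorff_outer (real ?k) E" if h: "0 < h" "h < 1" for h
  proof -
    have q0: "0 \<le> q h" using h by (simp add: q_def)
    have "ennreal (q h) * emeasure cone_measure E \<le> hausdorff_pre (real ?k) (h / 2) E"
      unfolding hausdorff_pre_def
    proof (rule INF_greatest, clarify)
      fix C :: "nat \<Rightarrow> 'a set"
      assume C: "E \<subseteq> (\<Union>i. C i)" "\<forall>i. bounded (C i) \<and> diameter (C i) \<le> h / 2"
      have "emeasure cone_measure E \<le> emeasure cone_measure (\<Union>i. closure (C i))"
      proof (rule emeasure_mono)
        show "E \<subseteq> (\<Union>i. closure (C i))" using C(1) closure_subset by blast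
      qed simp
      also have "\<dots> \<le> (\<Sum>i. emeasure cone_measure (closure (C i)))"
        by (intro emeasure_subadditive_countably) auto
      finally have "ennreal (q h) * emeasure cone_measure E
          \<le> ennreal (q h) * (\<Sum>i. emeasure cone_measure (closure (C i)))"
        by (rule mult_left_mono) simp
      also have "\<dots> = (\<Sum>i. ennreal (q h) * emeasure cone_measure (closure (C i)))"
        by (rule ennreal_suminf_cmult[symmetric])
      also have "\<dots> \<le> (\<Sum>i. ennreal (hausdorff_piece (real ?k) (C i)))"
      proof (intro suminf_le summableI allI)
        fix i
        have "ennreal (q h) * emeasure cone_measure (closure (C i))
            = ennreal (1 / (1 + h) ^ DIM('a)) * (ennreal ((1 - h) ^ ?k) * emeasure cone_measure (closure (C i)))"
          using h by (simp add: q_def mult.assoc[symmetric] ennreal_mult[symmetric])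
        also have "\<dots> \<le> ennreal (1 / (1 + h) ^ DIM('a)) * (ennreal ((1 + h) ^ DIM('a)) * ennreal (hausdorff_piece (real ?k) (C i)))"
        proof (rule mult_left_mono)
          have "diameter (C i) \<le> h / 2" "h / 2 < h" using C(2) h by auto
          then have "diameter (C i) < h" by linarith
          then show "ennreal ((1 - h) ^ ?k) * emeasure cone_measure (closure (C i))
              \<le> ennreal ((1 + h) ^ DIM('a)) * ennreal (hausdorff_piece (real ?k) (C i))"
            using C(2) h by (intro cone_measure_le_diameter) auto
        qed simp
        also have "\<dots> = ennreal (hausdorff_piece (real ?k) (C i))"
        proof -
          have "1 / (1 + h) ^ DIM('a) * (1 + h) ^ DIM('a) = 1" using h by simp
          then have "ennreal (1 / (1 + h) ^ DIM('a)) * ennreal ((1 + h) ^ DIM('a)) = 1"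
            using h by (simp only: ennreal_mult[symmetric] zero_le_divide_1_iff zero_le_power) simp
          then show ?thesis by (simp only: mult.assoc[symmetric] mult_1)
        qed
        finally show "ennreal (q h) * emeasure cone_measure (closure (C i)) \<le> ennreal (hausdorff_piece (real ?k) (C i))" .
      qed
      finally show "ennreal (q h) * emeasure cone_measure E \<le> (\<Sum>i. ennreal (hausdorff_piece (real ?k) (C i)))" .
    qed
    also have "\<dots> \<le> hausdorff_outer (real ?k) E" using h by (intro hausdorff_pre_le_outer) simp
    finally show ?thesis using q0 by (simp add: s ennreal_mult')
  qed
  have "((\<lambda>h. ennreal (q h * s)) \<longlongrightarrow> ennreal (q 0 * s)) (at_right 0)"
    unfolding q_def by (intro tendsto_ennrealI tendsto_intros) simp
  then have "((\<lambda>h. ennreal (q h * s)) \<longlongrightarrow> ennreal s) (at_right 0)" by (simp add: q_def)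
  then show ?thesis unfolding s
  proof (rule tendsto_upperbound)
    show "\<forall>\<^sub>F h in at_right 0. ennreal (q h * s) \<le> hausdorff_outer (real ?k) E"
      using le by (auto simp: eventually_at_right_field intro!: exI[of _ 1])
  qed simp
qed

section \<open>Vitali covering of the sphere\<close>

text \<open>The first estimate has the near-optimal constant and serves the disjoint balls of a
  Vitali selection. The other two are crude doubling bounds for the five-fold enlargements. All of
  them compare a ball, used as its own cover, with the flat disc volume \<open>K\<close> through
  \<open>cone_measure_cball_ge\<close>.\<close>

lemma cap_estimates:
  fixes e :: "'a::euclidean_space"
  assumes e: "norm e = 1" and \<epsilon>: "\<epsilon> \<le> 1 / 10" "2 * \<epsilon> \<le> \<delta>" and \<rho>: "0 < \<rho>" "5 * \<rho> \<le> \<epsilon>"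
  defines "k \<equiv> DIM('a) - 1"
  shows "hausdorff_pre (real k) \<delta> (cball e \<rho>) \<le> ennreal (1 / (1 - \<epsilon>) ^ DIM('a) * measure cone_measure (cball e \<rho>))"
    and "hausdorff_pre (real k) \<delta> (cball e (5 * \<rho>)) \<le> ennreal (5 ^ k * 2 ^ DIM('a) * measure cone_measure (cball e \<rho>))"
    and "measure cone_measure (cball e (5 * \<rho>)) \<le> 10 ^ k * 3 ^ DIM('a) * measure cone_measure (cball e \<rho>)"
proof -
  interpret finite_measure "cone_measure :: 'a measure" by (rule finite_measure_cone_measure)
  let ?n = "DIM('a)"
  define m where "m = measure cone_measure (cball e \<rho>)"
  define K where "K = unit_ball_vol (real k) * \<rho> ^ k"
  have K0: "0 \<le> K" using \<rho> by (simp add: K_def)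
  have "ennreal (K * (1 - \<rho>) ^ ?n) \<le> ennreal m"
    using cone_measure_cball_ge[OF e, of \<rho>] \<rho> \<epsilon> by (simp add: K_def k_def m_def emeasure_eq_measure)
  then have Km: "K * (1 - \<rho>) ^ ?n \<le> m" by (simp add: m_def)
  have piece: "hausdorff_piece (real k) (cball e r) = unit_ball_vol (real k) * r ^ k" if "r > 0" for r
    using that by (simp add: hausdorff_piece_of_nat)
  have "K * (1 - \<epsilon>) ^ ?n \<le> K * (1 - \<rho>) ^ ?n"
    using K0 \<rho> \<epsilon> by (intro mult_left_mono power_mono) auto
  then have "K \<le> 1 / (1 - \<epsilon>) ^ ?n * m" using Km \<epsilon> by (simp add: field_simps)
  moreover have "hausdorff_pre (real k) \<delta> (cball e \<rho>) \<le> ennreal K"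
    using hausdorff_pre_bounded_le[of "cball e \<rho>" \<delta> "real k"] \<rho> \<epsilon> by (simp add: piece K_def)
  ultimately show "hausdorff_pre (real k) \<delta> (cball e \<rho>) \<le> ennreal (1 / (1 - \<epsilon>) ^ ?n * m)"
    by (meson ennreal_leI order_trans)
  have "K * (1 / 2) ^ ?n \<le> K * (1 - \<rho>) ^ ?n"
    using K0 \<rho> \<epsilon> by (intro mult_left_mono power_mono) auto
  then have "K * (1 / 2) ^ ?n \<le> m" using Km by linarith
  then have K2: "K \<le> 2 ^ ?n * m" by (simp add: power_divide field_simps)
  have p5: "hausdorff_piece (real k) (cball e (5 * \<rho>)) = 5 ^ k * K"
    using \<rho> by (simp add: piece K_def power_mult_distrib)
  have "hausdorff_pre (real k) \<delta> (cball e (5 * \<rho>)) \<le> ennreal (5 ^ k * K)"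
    using hausdorff_pre_bounded_le[of "cball e (5 * \<rho>)" \<delta> "real k"] \<rho> \<epsilon> by (simp add: p5)
  also have "\<dots> \<le> ennreal (5 ^ k * (2 ^ ?n * m))" using K2 by (intro ennreal_leI mult_left_mono) auto
  finally show "hausdorff_pre (real k) \<delta> (cball e (5 * \<rho>)) \<le> ennreal (5 ^ k * 2 ^ ?n * m)" by (simp add: mult.assoc)
  \<comment> \<open>This is the upper bound with \<open>h = 1 / 2\<close>: the enlarged ball has
    diameter \<open>10 * \<rho>\<close>, which is at most
    \<open>2 * \<epsilon> \<le> 1 / 5\<close>.\<close>
  have "ennreal ((1 - 1 / 2) ^ k) * emeasure cone_measure (closure (cball e (5 * \<rho>)))
      \<le> ennreal ((1 + 1 / 2) ^ ?n) * ennreal (hausdorff_piece (real k) (cball e (5 * \<rho>)))"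
    unfolding k_def by (rule cone_measure_le_diameter) (use \<rho> \<epsilon> in auto)
  then have "ennreal ((1 / 2) ^ k * measure cone_measure (cball e (5 * \<rho>))) \<le> ennreal ((3 / 2) ^ ?n * (5 ^ k * K))"
    unfolding p5 by (simp add: emeasure_eq_measure ennreal_mult')
  then have "(1 / 2) ^ k * measure cone_measure (cball e (5 * \<rho>)) \<le> (3 / 2) ^ ?n * (5 ^ k * K)"
    using K0 by simp
  also have "\<dots> \<le> (3 / 2) ^ ?n * (5 ^ k * (2 ^ ?n * m))" using K2 by (intro mult_left_mono) auto
  also have "\<dots> = 3 ^ ?n * 5 ^ k * m" by (simp add: power_divide)
  finally have "measure cone_measure (cball e (5 * \<rho>)) \<le> 2 ^ k * (3 ^ ?n * 5 ^ k * m)"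
    by (simp add: field_simps)
  also have "(2 :: real) ^ k * (3 ^ ?n * 5 ^ k * m) = 10 ^ k * 3 ^ ?n * m"
    using power_mult_distrib[of "2 :: real" 5 k] by simp
  finally show "measure cone_measure (cball e (5 * \<rho>)) \<le> 10 ^ k * 3 ^ ?n * m" .
qed

text \<open>Balls centred on the sphere and contained in \<open>V\<close>, with radius at most
  \<open>\<epsilon> / 5\<close>, cover \<open>V \<inter> sphere 0 1\<close>. The Vitali covering
  lemma selects disjoint balls \<open>X i\<close> whose enlargements \<open>Y i\<close> still cover.
  The \<open>Y i\<close> may leave \<open>V\<close>, so everything about them is bounded through
  \<open>X i\<close>.\<close>

lemma Vitali_caps:
  fixes V :: "'a::euclidean_space set"
  assumes V: "open V" and \<epsilon>: "0 < \<epsilon>" "\<epsilon> \<le> 1 / 10" "2 * \<epsilon> \<le> \<delta>"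
  defines "k \<equiv> DIM('a) - 1"
  obtains X Y :: "nat \<Rightarrow> 'a set" where "disjoint_family X" "V \<inter> sphere 0 1 \<subseteq> (\<Union>i. Y i)"
    "\<forall>i. closed (X i) \<and> X i \<subseteq> V \<and> closed (Y i) \<and>
       hausdorff_pre (real k) \<delta> (X i) \<le> ennreal (1 / (1 - \<epsilon>) ^ DIM('a) * measure cone_measure (X i)) \<and>
       hausdorff_pre (real k) \<delta> (Y i) \<le> ennreal (5 ^ k * 2 ^ DIM('a) * measure cone_measure (X i)) \<and>
       measure cone_measure (Y i) \<le> 10 ^ k * 3 ^ DIM('a) * measure cone_measure (X i)"
proof -
  define K where "K = {(e::'a, \<rho>::real). norm e = 1 \<and> 0 < \<rho> \<and> 5 * \<rho> \<le> \<epsilon> \<and> cball e \<rho> \<subseteq> V}"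
  have cover: "V \<inter> sphere 0 1 \<subseteq> (\<Union>i\<in>K. cball (fst i) (snd i))"
  proof
    fix e assume e: "e \<in> V \<inter> sphere 0 1"
    then obtain r where r: "r > 0" "cball e r \<subseteq> V" using V open_contains_cball by blast
    have "(e, min r (\<epsilon> / 5)) \<in> K" using e r \<epsilon> by (auto simp: K_def)
    then show "e \<in> (\<Union>i\<in>K. cball (fst i) (snd i))" using r \<epsilon> by force
  qed
  have rad: "0 < snd i \<and> snd i \<le> \<epsilon>" if "i \<in> K" for i using that by (auto simp: K_def)
  obtain C where C: "countable C" "C \<subseteq> K"
    "pairwise (\<lambda>i j. disjnt (cball (fst i) (snd i)) (cball (fst j) (snd j))) C"
    "V \<inter> sphere 0 1 \<subseteq> (\<Union>i\<in>C. cball (fst i) (5 * snd i))"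
    using Vitali_covering_lemma_cballs[OF cover rad] by blast
  define g where "g = from_nat_into C"
  define J where "J = to_nat_on C ` C"
  have g: "g j \<in> C" "to_nat_on C (g j) = j" if "j \<in> J" for j
    using that C(1) by (auto simp: g_def J_def)
  have gK: "norm (fst (g j)) = 1" "0 < snd (g j)" "5 * snd (g j) \<le> \<epsilon>" "cball (fst (g j)) (snd (g j)) \<subseteq> V"
    if "j \<in> J" for j
  proof -
    have "g j \<in> K" using g(1)[OF that] C(2) by blast
    then show "norm (fst (g j)) = 1" "0 < snd (g j)" "5 * snd (g j) \<le> \<epsilon>" "cball (fst (g j)) (snd (g j)) \<subseteq> V"
      by (simp_all add: K_def case_prod_beta)
  qed
  \<comment> \<open>The selected family may be finite; indices that enumerate no ball receive the
    empty set.\<close>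
  define X where "X j = (if j \<in> J then cball (fst (g j)) (snd (g j)) else {})" for j
  define Y where "Y j = (if j \<in> J then cball (fst (g j)) (5 * snd (g j)) else {})" for j
  have e0: "hausdorff_pre (real k) \<delta> {} = 0" using \<epsilon> by (intro hausdorff_pre_empty) simp
  show thesis
  proof (rule that[of X Y])
    show "disjoint_family X"
    proof (unfold disjoint_family_on_def, intro ballI impI)
      fix i j :: nat assume "i \<noteq> j"
      show "X i \<inter> X j = {}"
      proof (cases "i \<in> J \<and> j \<in> J")
        case True
        then have "g i \<noteq> g j" using g \<open>i \<noteq> j\<close> by metis
        then show ?thesis using C(3) g True by (auto simp: pairwise_def disjnt_def X_def)
      qed (auto simp: X_def)
    qed
    show "V \<inter> sphere 0 1 \<subseteq> (\<Union>i. Y i)"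
    proof
      fix x assume "x \<in> V \<inter> sphere 0 1"
      then obtain c where c: "c \<in> C" "x \<in> cball (fst c) (5 * snd c)" using C(4) by blast
      then have "x \<in> Y (to_nat_on C c)" using C(1) by (auto simp: Y_def J_def g_def)
      then show "x \<in> (\<Union>i. Y i)" by blast
    qed
    have "closed (X i)" "X i \<subseteq> V" "closed (Y i)" for i using gK(4) by (auto simp: X_def Y_def)
    moreover have "hausdorff_pre (real k) \<delta> (X i) \<le> ennreal (1 / (1 - \<epsilon>) ^ DIM('a) * measure cone_measure (X i))"
      "hausdorff_pre (real k) \<delta> (Y i) \<le> ennreal (5 ^ k * 2 ^ DIM('a) * measure cone_measure (X i))"
      "measure cone_measure (Y i) \<le> 10 ^ k * 3 ^ DIM('a) * measure cone_measure (X i)"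
      for i
      using cap_estimates[OF gK(1) \<epsilon>(2,3) gK(2,3), of i] e0 by (auto simp: X_def Y_def k_def)
    ultimately show "\<forall>i. closed (X i) \<and> X i \<subseteq> V \<and> closed (Y i) \<and>
       hausdorff_pre (real k) \<delta> (X i) \<le> ennreal (1 / (1 - \<epsilon>) ^ DIM('a) * measure cone_measure (X i)) \<and>
       hausdorff_pre (real k) \<delta> (Y i) \<le> ennreal (5 ^ k * 2 ^ DIM('a) * measure cone_measure (X i)) \<and>
       measure cone_measure (Y i) \<le> 10 ^ k * 3 ^ DIM('a) * measure cone_measure (X i)" by blast
  qed
qed

text \<open>One Vitali selection captures a fixed fraction \<open>1 / (2 * D)\<close> of the measure at the optimal
  rate \<open>A\<close>; iterating it turns the crude rate \<open>A + C\<close> into \<open>A\<close>.\<close>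
lemma hausdorff_pre_sphere_le:
  fixes V :: "'a::euclidean_space set"
  assumes V: "open V" and \<epsilon>: "0 < \<epsilon>" "\<epsilon> \<le> 1 / 10" "2 * \<epsilon> \<le> \<delta>"
  shows "hausdorff_pre (real (DIM('a) - 1)) \<delta> (V \<inter> sphere 0 1) \<le> ennreal (1 / (1 - \<epsilon>) ^ DIM('a) * measure cone_measure V)"
proof -
  interpret finite_measure "cone_measure :: 'a measure" by (rule finite_measure_cone_measure)
  define k where "k = DIM('a) - 1"
  define A where "A = 1 / (1 - \<epsilon>) ^ DIM('a)"
  define C where "C = (5 ^ k * 2 ^ DIM('a) :: real)"
  define D where "D = (10 ^ k * 3 ^ DIM('a) :: real)"
  let ?p = "hausdorff_pre (real k) \<delta>"
  let ?m = "measure (cone_measure :: 'a measure)"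
  have \<delta>: "\<delta> > 0" using \<epsilon> by simp
  have A0: "A \<ge> 0" and C0: "C \<ge> 0" and D1: "D \<ge> 1"
    using \<epsilon> by (auto simp: A_def C_def D_def intro: order_trans[OF _ mult_mono[of 1 _ 1]])
  define \<theta> where "\<theta> = 1 - 1 / (2 * D)"
  have th: "0 \<le> \<theta>" "\<theta> < 1" using D1 by (auto simp: \<theta>_def field_simps)
  have iter: "?p (V \<inter> sphere 0 1) \<le> ennreal ((A + C * \<theta> ^ j) * ?m V)" if "open V" for j V
    using that
  proof (induction j arbitrary: V)
    case (0 V)
    obtain X Y :: "nat \<Rightarrow> 'a set" where * : "disjoint_family X" "V \<inter> sphere 0 1 \<subseteq> (\<Union>i. Y i)"
    "\<forall>i. closed (X i) \<and> X i \<subseteq> V \<and> closed (Y i) \<and>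
       hausdorff_pre (real (DIM('a) - 1)) \<delta> (X i) \<le> ennreal (1 / (1 - \<epsilon>) ^ DIM('a) * ?m (X i)) \<and>
       hausdorff_pre (real (DIM('a) - 1)) \<delta> (Y i) \<le> ennreal (5 ^ (DIM('a) - 1) * 2 ^ DIM('a) * ?m (X i)) \<and>
       ?m (Y i) \<le> 10 ^ (DIM('a) - 1) * 3 ^ DIM('a) * ?m (X i)"
      by (rule Vitali_caps[OF 0 \<epsilon>]) (blast intro: that)
    note XY = *(1) *(3)[rule_format, THEN conjunct1] *(3)[rule_format, THEN conjunct2, THEN conjunct1]
      *(3)[rule_format, THEN conjunct2, THEN conjunct2, THEN conjunct1] *(2)
      *(3)[rule_format, THEN conjunct2, THEN conjunct2, THEN conjunct2, THEN conjunct1, folded k_def, folded A_def]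
      *(3)[rule_format, THEN conjunct2, THEN conjunct2, THEN conjunct2, THEN conjunct2, THEN conjunct1, folded k_def, folded C_def]
      *(3)[rule_format, THEN conjunct2, THEN conjunct2, THEN conjunct2, THEN conjunct2, THEN conjunct2, folded k_def, folded D_def]
    have "?p (V \<inter> sphere 0 1) \<le> (\<Sum>i. ?p (Y i))"
      by (rule order_trans[OF hausdorff_pre_mono[OF XY(5)] hausdorff_pre_UN])
    also have "\<dots> \<le> (\<Sum>i. ennreal C * emeasure cone_measure (X i))"
      using XY(7) C0 by (intro suminf_le summableI) (simp add: emeasure_eq_measure ennreal_mult')
    also have "\<dots> = ennreal C * emeasure cone_measure (\<Union>i. X i)"
      using XY(1,2) by (subst ennreal_suminf_cmult, subst suminf_emeasure) auto
    also have "\<dots> \<le> ennreal C * emeasure cone_measure V"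
      using XY(3) 0 by (intro mult_left_mono emeasure_mono) auto
    also have "\<dots> = ennreal (C * ?m V)" using C0 by (simp add: emeasure_eq_measure ennreal_mult')
    also have "\<dots> \<le> ennreal ((A + C * \<theta> ^ 0) * ?m V)"
      using A0 by (intro ennreal_leI) (simp add: distrib_right)
    finally show ?case .
  next
    case (Suc j V)
    obtain X Y :: "nat \<Rightarrow> 'a set" where * : "disjoint_family X" "V \<inter> sphere 0 1 \<subseteq> (\<Union>i. Y i)"
    "\<forall>i. closed (X i) \<and> X i \<subseteq> V \<and> closed (Y i) \<and>
       hausdorff_pre (real (DIM('a) - 1)) \<delta> (X i) \<le> ennreal (1 / (1 - \<epsilon>) ^ DIM('a) * ?m (X i)) \<and>
       hausdorff_pre (real (DIM('a) - 1)) \<delta> (Y i) \<le> ennreal (5 ^ (DIM('a) - 1) * 2 ^ DIM('a) * ?m (X i)) \<and>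
       ?m (Y i) \<le> 10 ^ (DIM('a) - 1) * 3 ^ DIM('a) * ?m (X i)"
      by (rule Vitali_caps[OF Suc.prems \<epsilon>]) (blast intro: that)
    note XY = *(1) *(3)[rule_format, THEN conjunct1] *(3)[rule_format, THEN conjunct2, THEN conjunct1]
      *(3)[rule_format, THEN conjunct2, THEN conjunct2, THEN conjunct1] *(2)
      *(3)[rule_format, THEN conjunct2, THEN conjunct2, THEN conjunct2, THEN conjunct1, folded k_def, folded A_def]
      *(3)[rule_format, THEN conjunct2, THEN conjunct2, THEN conjunct2, THEN conjunct2, THEN conjunct1, folded k_def, folded C_def]
      *(3)[rule_format, THEN conjunct2, THEN conjunct2, THEN conjunct2, THEN conjunct2, THEN conjunct2, folded k_def, folded D_def]
    have sums: "(\<lambda>i. ?m (X i)) sums ?m (\<Union>i. X i)"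
      using XY(1,2) by (intro finite_measure_UNION) auto
    have "?m V \<le> D * ?m (\<Union>i. X i)"
    proof -
      have "emeasure cone_measure V = emeasure cone_measure (V \<inter> sphere 0 1)"
        using emeasure_cone_measure_Int_sphere[of V] Suc.prems by simp
      also have "\<dots> \<le> emeasure cone_measure (\<Union>i. Y i)"
        using XY(4,5) by (intro emeasure_mono) auto
      also have "\<dots> \<le> (\<Sum>i. emeasure cone_measure (Y i))"
        using XY(4) by (intro emeasure_subadditive_countably) auto
      also have "\<dots> \<le> (\<Sum>i. ennreal D * emeasure cone_measure (X i))"
        using XY(8) D1 by (intro suminf_le summableI) (simp add: emeasure_eq_measure ennreal_mult'[symmetric] ennreal_leI del: ennreal_mult')
      also have "\<dots> = ennreal D * emeasure cone_measure (\<Union>i. X i)"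
        using XY(1,2) by (subst ennreal_suminf_cmult, subst suminf_emeasure) auto
      finally show ?thesis using D1 by (simp add: emeasure_eq_measure ennreal_mult'[symmetric])
    qed
    then have half: "?m V / (2 * D) \<le> ?m (\<Union>i. X i) - ?m V / (2 * D)"
      using D1 by (simp add: field_simps)
    \<comment> \<open>All \<open>X i\<close> together carry at least the fraction
      \<open>1 / D\<close> of the measure. Giving up half of it leaves room to stop after finitely
      many of them.\<close>
    obtain N where N: "?m V / (2 * D) \<le> (\<Sum>i<N. ?m (X i))"
    proof (cases "?m V = 0")
      case True
      then show ?thesis using that[of 0] by simp
    next
      case False
      then have "0 < ?m V / (2 * D)" using D1 by (simp add: zero_less_measure_iff)
      then have "?m V / (2 * D) < ?m (\<Union>i. X i)" using half by linarith
      then have "\<forall>\<^sub>F N in sequentially. ?m V / (2 * D) < (\<Sum>i<N. ?m (X i))"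
        using sums order_tendstoD(1) unfolding sums_def by blast
      then show ?thesis using that by (auto simp: eventually_sequentially intro: less_imp_le)
    qed
    \<comment> \<open>A finite union of closed sets is closed, so \<open>V - U\<close> is open and
      the induction hypothesis applies to it.\<close>
    define U where "U = (\<Union>i<N. X i)"
    define s where "s = (\<Sum>i<N. ?m (X i))"
    have "closed U" using XY(2) by (auto simp: U_def)
    have mU: "?m U = s"
      unfolding U_def s_def using XY(1,2)
      by (intro finite_measure_finite_Union) (auto simp: disjoint_family_on_def)
    have pU: "?p U \<le> ennreal (A * s)"
    proof -
      have "?p (\<Union>i<M. X i) \<le> (\<Sum>i<M. ?p (X i))" for M
      proof (induction M)
        case (Suc M)
        have "?p (\<Union>i<Suc M. X i) \<le> ?p (X M) + ?p (\<Union>i<M. X i)"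
          using hausdorff_pre_Un[OF \<delta>, of "real k" "X M" "\<Union>i<M. X i"] by (simp add: lessThan_Suc)
        also have "\<dots> \<le> ?p (X M) + (\<Sum>i<M. ?p (X i))" by (rule add_left_mono[OF Suc])
        finally show ?case by (simp add: add.commute)
      qed (simp add: hausdorff_pre_empty[OF \<delta>])
      then have "?p U \<le> (\<Sum>i<N. ennreal (A * ?m (X i)))"
        unfolding U_def by (rule order_trans) (intro sum_mono XY(6))
      also have "\<dots> = ennreal (A * s)"
        using A0 by (subst sum_ennreal) (auto simp: s_def sum_distrib_left)
      finally show ?thesis .
    qed
    have "open (V - U)" using Suc.prems \<open>closed U\<close> by (intro open_Diff)
    have "U \<subseteq> V" using XY(3) by (auto simp: U_def)
    then have mVU: "?m (V - U) = ?m V - s"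
      using Suc.prems \<open>closed U\<close> by (subst finite_measure_Diff) (auto simp: mU)
    have s: "s \<le> ?m V" unfolding mU[symmetric] using \<open>U \<subseteq> V\<close> Suc.prems by (intro finite_measure_mono) auto
    have "?p (V \<inter> sphere 0 1) \<le> ?p (U \<union> ((V - U) \<inter> sphere 0 1))"
      by (intro hausdorff_pre_mono) auto
    also have "\<dots> \<le> ?p U + ?p ((V - U) \<inter> sphere 0 1)" by (rule hausdorff_pre_Un[OF \<delta>])
    also have "\<dots> \<le> ennreal (A * s) + ennreal ((A + C * \<theta> ^ j) * (?m V - s))"
      using pU Suc.IH[OF \<open>open (V - U)\<close>] unfolding mVU by (rule add_mono)
    also have "\<dots> = ennreal (A * s + (A + C * \<theta> ^ j) * (?m V - s))"
      using A0 C0 th s by (intro ennreal_plus[symmetric]) (auto simp: s_def intro!: sum_nonneg mult_nonneg_nonneg)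
    also have "\<dots> \<le> ennreal ((A + C * \<theta> ^ Suc j) * ?m V)"
    proof (rule ennreal_leI)
      \<comment> \<open>Both parts contribute the rate \<open>A\<close>. The excess
        \<open>C * \<theta> ^ j\<close> is paid only on \<open>V - U\<close>, whose measure is at
        most \<open>\<theta>\<close> times that of \<open>V\<close>.\<close>
      have "C * \<theta> ^ j * (?m V / (2 * D)) \<le> C * \<theta> ^ j * s"
        using N C0 th by (intro mult_left_mono) (auto simp: s_def)
      then show "A * s + (A + C * \<theta> ^ j) * (?m V - s) \<le> (A + C * \<theta> ^ Suc j) * ?m V"
        by (simp add: \<theta>_def algebra_simps)
    qed
    finally show ?case .
  qed
  have "(\<lambda>j. ennreal ((A + C * \<theta> ^ j) * ?m V)) \<longlonglongrightarrow> ennreal ((A + C * 0) * ?m V)"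
    using th by (intro tendsto_ennrealI tendsto_intros LIMSEQ_realpow_zero)
  then have "?p (V \<inter> sphere 0 1) \<le> ennreal ((A + C * 0) * ?m V)"
    by (rule tendsto_lowerbound) (use iter[OF V] in auto)
  then show ?thesis by (simp add: A_def k_def)
qed

lemma hausdorff_outer_sphere:
  "hausdorff_outer (real (DIM('a) - 1)) (sphere (0::'a::euclidean_space) 1) = emeasure cone_measure (sphere (0::'a) 1)"
proof (rule antisym)
  show "emeasure cone_measure (sphere (0::'a) 1) \<le> hausdorff_outer (real (DIM('a) - 1)) (sphere (0::'a) 1)"
    by (rule cone_measure_le_hausdorff_outer) simp
  interpret finite_measure "cone_measure :: 'a measure" by (rule finite_measure_cone_measure)
  let ?m = "measure (cone_measure :: 'a measure) UNIV"
  have "emeasure cone_measure (sphere (0::'a) 1) = ennreal ?m"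
    using emeasure_cone_measure_Int_sphere[of "UNIV :: 'a set"] by (simp add: emeasure_eq_measure)
  moreover have "hausdorff_outer (real (DIM('a) - 1)) (sphere (0::'a) 1) \<le> ennreal ?m"
    unfolding hausdorff_outer_def
  proof (rule SUP_least)
    fix \<delta> :: real assume "\<delta> \<in> {0<..}"
    then have \<delta>: "\<delta> > 0" by simp
    \<comment> \<open>\<open>\<epsilon>\<close> tends to \<open>0\<close> with
      \<open>\<delta>\<close> fixed: smaller caps stay admissible at scale \<open>\<delta>\<close>
      and become flatter.\<close>
    have "((\<lambda>\<epsilon>. ennreal (1 / (1 - \<epsilon>) ^ DIM('a) * ?m)) \<longlongrightarrow> ennreal (1 / (1 - 0) ^ DIM('a) * ?m)) (at_right 0)"
      by (intro tendsto_ennrealI tendsto_intros) simp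
    then have "hausdorff_pre (real (DIM('a) - 1)) \<delta> (sphere (0::'a) 1) \<le> ennreal (1 / (1 - 0) ^ DIM('a) * ?m)"
    proof (rule tendsto_lowerbound)
      show "\<forall>\<^sub>F \<epsilon> in at_right 0. hausdorff_pre (real (DIM('a) - 1)) \<delta> (sphere (0::'a) 1) \<le> ennreal (1 / (1 - \<epsilon>) ^ DIM('a) * ?m)"
        using hausdorff_pre_sphere_le[of "UNIV :: 'a set" _ \<delta>] \<delta>
        by (auto simp: eventually_at_right_field intro!: exI[of _ "min (1 / 10) (\<delta> / 2)"])
    qed simp
    then show "hausdorff_pre (real (DIM('a) - 1)) \<delta> (sphere (0::'a) 1) \<le> ennreal ?m" by simp
  qed
  ultimately show "hausdorff_outer (real (DIM('a) - 1)) (sphere (0::'a) 1) \<le> emeasure cone_measure (sphere (0::'a) 1)"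
    by simp
qed

lemma hausdorff_outer_eq_cone_measure:
  fixes E :: "'a::euclidean_space set"
  assumes E: "E \<in> sets borel" "E \<subseteq> sphere 0 1"
  shows "hausdorff_outer (real (DIM('a) - 1)) E = emeasure cone_measure E"
proof -
  let ?H = "hausdorff_measure (real (DIM('a) - 1)) :: 'a measure"
  let ?S = "sphere (0::'a) 1"
  have S: "emeasure ?H ?S = emeasure cone_measure ?S"
    by (simp only: emeasure_hausdorff_measure[OF borel_closed[OF closed_sphere]] hausdorff_outer_sphere)
  have le: "emeasure cone_measure F \<le> emeasure ?H F" if "F \<in> sets borel" for F
    using that cone_measure_le_hausdorff_outer[OF that] by (simp add: emeasure_hausdorff_measure)
  have D: "?S - E \<in> sets borel" using E by auto
  have "emeasure ?H E + emeasure ?H (?S - E) = emeasure ?H ?S"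
    using E by (subst plus_emeasure) (auto simp: Un_absorb1)
  also have "\<dots> = emeasure cone_measure E + emeasure cone_measure (?S - E)"
    unfolding S using E by (subst plus_emeasure) (auto simp: Un_absorb1)
  \<comment> \<open>The total masses agree, so the lower bound for \<open>?H\<close> on the
    complement of \<open>E\<close> in the sphere acts as an upper bound on \<open>E\<close>.\<close>
  also have "\<dots> \<le> emeasure cone_measure E + emeasure ?H (?S - E)"
    by (intro add_left_mono le D)
  finally have "emeasure ?H E + emeasure ?H (?S - E) \<le> emeasure cone_measure E + emeasure ?H (?S - E)" .
  moreover have "emeasure ?H (?S - E) \<noteq> top"
  proof -
    have "emeasure ?H (?S - E) \<le> emeasure ?H ?S" by (intro emeasure_mono) auto
    also have "\<dots> < top" unfolding S by (rule le_less_trans[OF emeasure_mono emeasure_cone_measure_finite]) auto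
    finally show ?thesis by simp
  qed
  ultimately have "emeasure ?H E \<le> emeasure cone_measure E"
    by (simp add: add.commute[of _ "emeasure ?H (?S - E)"] ennreal_add_left_cancel_le)
  then show ?thesis using le[OF E(1)] E(1) by (auto simp: emeasure_hausdorff_measure intro: antisym)
qed

section \<open>Polar coordinates and the Gauss--Green formula\<close>

text \<open>Both claims follow from one identity of measures: Hausdorff measure restricted to
  \<open>sphere a R\<close>, written as a density with an indicator, is
  \<open>R ^ (DIM('a) - 1)\<close> times the image of \<open>cone_measure\<close> under
  \<open>\<omega> \<mapsto> a + R *\<^sub>R \<omega>\<close>.\<close>

lemma set_integral_hausdorff_sphere:
  fixes f :: "'a::euclidean_space \<Rightarrow> real"
  assumes R: "R > 0" and f [measurable]: "f \<in> borel_measurable borel"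
  shows "set_lebesgue_integral (hausdorff_measure (real DIM('a) - 1)) (sphere a R) f
      = R ^ (DIM('a) - 1) * (\<integral>\<omega>. f (a + R *\<^sub>R \<omega>) \<partial>cone_measure)"
    and "set_integrable (hausdorff_measure (real DIM('a) - 1)) (sphere a R) f
      \<longleftrightarrow> integrable cone_measure (\<lambda>\<omega>. f (a + R *\<^sub>R \<omega>))"
proof -
  define k where "k = DIM('a) - 1"
  \<comment> \<open>\<open>normal_trace_is\<close> subtracts \<open>1\<close> in the reals, the
    lemmas above in the naturals; the two agree because the dimension is positive.\<close>
  have k: "real DIM('a) - 1 = real k" by (simp add: k_def)
  let ?H = "hausdorff_measure (real k) :: 'a measure"
  let ?T = "\<lambda>\<omega>::'a. a + R *\<^sub>R \<omega>"
  let ?S = "sphere a R"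
  let ?N = "density (distr cone_measure borel ?T) (\<lambda>_. ennreal (R ^ k))"
  have S [measurable]: "?S \<in> sets borel" by simp
  have T [measurable]: "?T \<in> borel_measurable cone_measure"
    by (simp add: measurable_cong_sets[OF sets_cone_measure refl])
  have eq: "density ?H (\<lambda>x. ennreal (indicator ?S x)) = ?N"
  proof (rule measure_eqI)
    fix E assume "E \<in> sets (density ?H (\<lambda>x. ennreal (indicator ?S x)))"
    then have E [measurable]: "E \<in> sets borel" by simp
    let ?E = "?T -` E \<inter> sphere 0 1"
    have TE: "?T -` E \<in> sets borel" using measurable_sets[OF T E] by simp
    have im: "?T ` ?E = E \<inter> ?S"
    proof (intro set_eqI iffI)
      fix x assume "x \<in> ?T ` ?E"
      then show "x \<in> E \<inter> ?S" using R by (auto simp: dist_norm)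
    next
      fix x assume x: "x \<in> E \<inter> ?S"
      have "x = ?T ((1 / R) *\<^sub>R (x - a))" using R by simp
      moreover have "(1 / R) *\<^sub>R (x - a) \<in> ?E" using x R by (auto simp: dist_norm norm_minus_commute)
      ultimately show "x \<in> ?T ` ?E" by (rule image_eqI)
    qed
    have "emeasure (density ?H (\<lambda>x. ennreal (indicator ?S x))) E = emeasure ?H (E \<inter> ?S)"
    proof -
      have "emeasure (density ?H (\<lambda>x. ennreal (indicator ?S x))) E = (\<integral>\<^sup>+x. ennreal (indicator ?S x) * indicator E x \<partial>?H)"
        by (rule emeasure_density) simp_all
      also have "(\<lambda>x. ennreal (indicator ?S x) * indicator E x) = indicator (E \<inter> ?S)"
        by (auto simp: indicator_def)
      finally show ?thesis using E S by simp
    qed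
    also have "\<dots> = hausdorff_outer (real k) (?T ` ?E)"
      using E S by (simp add: emeasure_hausdorff_measure im)
    also have "\<dots> = ennreal (R powr real k) * hausdorff_outer (real k) ?E"
      by (rule hausdorff_outer_affine[OF R]) simp
    also have "hausdorff_outer (real k) ?E = emeasure cone_measure ?E"
      unfolding k_def using TE by (intro hausdorff_outer_eq_cone_measure) auto
    also have "\<dots> = emeasure cone_measure (?T -` E)"
      by (rule emeasure_cone_measure_Int_sphere[OF TE])
    also have "ennreal (R powr real k) * emeasure cone_measure (?T -` E) = emeasure ?N E"
      using R by (simp add: emeasure_density_const emeasure_distr powr_realpow)
    finally show "emeasure (density ?H (\<lambda>x. ennreal (indicator ?S x))) E = emeasure ?N E" .
  qed simp
  have fH: "f \<in> borel_measurable ?H" "indicator ?S \<in> borel_measurable ?H"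
    by (simp_all add: measurable_cong_sets[OF sets_hausdorff_measure refl])
  have "set_lebesgue_integral ?H ?S f = integral\<^sup>L (density ?H (\<lambda>x. ennreal (indicator ?S x))) f"
    unfolding set_lebesgue_integral_def using fH by (subst integral_density) auto
  also have "\<dots> = R ^ k * (\<integral>\<omega>. f (?T \<omega>) \<partial>cone_measure)"
    unfolding eq using R by (subst integral_density) (auto simp: integral_distr)
  finally show "set_lebesgue_integral (hausdorff_measure (real DIM('a) - 1)) ?S f
      = R ^ (DIM('a) - 1) * (\<integral>\<omega>. f (?T \<omega>) \<partial>cone_measure)" by (simp only: k k_def[symmetric])
  have "set_integrable ?H ?S f \<longleftrightarrow> integrable (density ?H (\<lambda>x. ennreal (indicator ?S x))) f"
    unfolding set_integrable_def using fH by (subst integrable_density) auto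
  also have "\<dots> \<longleftrightarrow> integrable cone_measure (\<lambda>\<omega>. f (?T \<omega>))"
    unfolding eq using R by (subst integrable_density) (auto simp: integrable_distr_eq)
  finally show "set_integrable (hausdorff_measure (real DIM('a) - 1)) ?S f
      \<longleftrightarrow> integrable cone_measure (\<lambda>\<omega>. f (?T \<omega>))" by (simp only: k)
qed

section \<open>Integration in polar coordinates\<close>

lemma sigma_finite_radial_measure: "sigma_finite_measure (radial_measure n)"
proof -
  have "(\<lambda>r. ennreal (r ^ (n - 1)) * indicator {0<..} r) \<in> borel_measurable lborel" by measurable
  then show ?thesis
    unfolding radial_measure_def
    by (subst sigma_finite_measure.sigma_finite_iff_density_finite[OF sigma_finite_lborel]) (auto simp: ennreal_mult_eq_top_iff indicator_def)
qed

text \<open>\<open>emeasure_polar\<close> is this identity on rectangles, and rectangles determine a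
  product of sigma-finite measures.\<close>

lemma distr_lborel_polar:
  "radial_measure DIM('a) \<Otimes>\<^sub>M cone_measure
    = distr lborel (borel \<Otimes>\<^sub>M borel) (\<lambda>x::'a::euclidean_space. (norm x, sgn x))"
proof (rule pair_measure_eqI)
  show "sigma_finite_measure (radial_measure DIM('a))" by (rule sigma_finite_radial_measure)
  show "sigma_finite_measure (cone_measure :: 'a measure)"
    by (rule finite_measure.axioms(1)[OF finite_measure_cone_measure])
  show "sets (radial_measure DIM('a) \<Otimes>\<^sub>M cone_measure) = sets (distr lborel (borel \<Otimes>\<^sub>M borel) (\<lambda>x::'a. (norm x, sgn x)))"
    by (simp cong: sets_pair_measure_cong)
  fix A :: "real set" and B :: "'a set"
  assume "A \<in> sets (radial_measure DIM('a))" "B \<in> sets cone_measure"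
  then have AB: "A \<in> sets borel" "B \<in> sets borel" by auto
  have "emeasure (distr lborel (borel \<Otimes>\<^sub>M borel) (\<lambda>x::'a. (norm x, sgn x))) (A \<times> B)
      = emeasure lborel ((\<lambda>x::'a. (norm x, sgn x)) -` (A \<times> B) \<inter> space lborel)"
    using AB by (intro emeasure_distr) auto
  also have "(\<lambda>x::'a. (norm x, sgn x)) -` (A \<times> B) \<inter> space lborel = {x. norm x \<in> A \<and> sgn x \<in> B}" by auto
  finally show "emeasure (radial_measure DIM('a)) A * emeasure cone_measure B
      = emeasure (distr lborel (borel \<Otimes>\<^sub>M borel) (\<lambda>x::'a. (norm x, sgn x))) (A \<times> B)"
    by (simp add: emeasure_polar[OF AB])
qed

lemma norm_scaleR_sgn: "norm x *\<^sub>R sgn x = (x::'a::real_normed_vector)"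
  by (cases "x = 0") (simp_all add: sgn_div_norm)

text \<open>The order of integration matters for the use made of it: with the ray integral inside,
  the fundamental theorem of calculus applies for each direction separately.\<close>

lemma integral_polar:
  fixes F :: "'a::euclidean_space \<Rightarrow> real"
  assumes F: "integrable lborel F"
  shows "(\<integral>x. F x \<partial>lborel) = (\<integral>\<omega>. (\<integral>r. indicator {0<..} r * (r ^ (DIM('a) - 1) * F (r *\<^sub>R \<omega>)) \<partial>lborel) \<partial>cone_measure)"
proof -
  let ?\<rho> = "radial_measure DIM('a)" and ?\<sigma> = "cone_measure :: 'a measure"
  interpret S: finite_measure ?\<sigma> by (rule finite_measure_cone_measure)
  interpret P: pair_sigma_finite ?\<rho> ?\<sigma>
    by (simp add: pair_sigma_finite_def sigma_finite_radial_measure S.sigma_finite_measure_axioms)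
  have [measurable]: "F \<in> borel_measurable borel" using F borel_measurable_integrable by force
  have meas: "(\<lambda>(r, \<omega>). F (r *\<^sub>R \<omega>)) \<in> borel_measurable (borel \<Otimes>\<^sub>M borel)" by measurable
  have pm: "(\<lambda>x::'a. (norm x, sgn x)) \<in> lborel \<rightarrow>\<^sub>M borel \<Otimes>\<^sub>M borel" by measurable
  have int: "integrable (?\<rho> \<Otimes>\<^sub>M ?\<sigma>) (\<lambda>(r, \<omega>). F (r *\<^sub>R \<omega>))"
    unfolding distr_lborel_polar using F by (subst integrable_distr_eq[OF pm meas]) (simp add: norm_scaleR_sgn)
  have "(\<integral>x. F x \<partial>lborel) = (\<integral>x. (\<lambda>(r, \<omega>). F (r *\<^sub>R \<omega>)) (norm x, sgn x) \<partial>(lborel :: 'a measure))"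
    by (simp add: norm_scaleR_sgn)
  also have "\<dots> = integral\<^sup>L (?\<rho> \<Otimes>\<^sub>M ?\<sigma>) (\<lambda>(r, \<omega>). F (r *\<^sub>R \<omega>))"
    unfolding distr_lborel_polar by (rule integral_distr[OF pm meas, symmetric])
  also have "\<dots> = (\<integral>\<omega>. (\<integral>r. F (r *\<^sub>R \<omega>) \<partial>?\<rho>) \<partial>?\<sigma>)"
    by (rule P.integral_snd[symmetric, OF int])
  also have "(\<lambda>\<omega>. \<integral>r. F (r *\<^sub>R \<omega>) \<partial>?\<rho>) = (\<lambda>\<omega>. \<integral>r. indicator {0<..} r * (r ^ (DIM('a) - 1) * F (r *\<^sub>R \<omega>)) \<partial>lborel)"
  proof
    fix \<omega> :: 'a
    have "?\<rho> = density lborel (\<lambda>r. ennreal (indicator {0<..} r * r ^ (DIM('a) - 1)))"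
      unfolding radial_measure_def by (intro density_cong) (auto simp: indicator_def)
    then have "(\<integral>r. F (r *\<^sub>R \<omega>) \<partial>?\<rho>) = integral\<^sup>L (density lborel (\<lambda>r. ennreal (indicator {0<..} r * r ^ (DIM('a) - 1)))) (\<lambda>r. F (r *\<^sub>R \<omega>))"
      by simp
    also have "\<dots> = (\<integral>r. (indicator {0<..} r * r ^ (DIM('a) - 1)) *\<^sub>R F (r *\<^sub>R \<omega>) \<partial>lborel)"
      by (rule integral_density) (auto simp: indicator_def)
    finally show "(\<integral>r. F (r *\<^sub>R \<omega>) \<partial>?\<rho>) = (\<integral>r. indicator {0<..} r * (r ^ (DIM('a) - 1) * F (r *\<^sub>R \<omega>)) \<partial>lborel)"
      by (simp add: mult.assoc)
  qed
  finally show ?thesis .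
qed

section \<open>Radial fields and test functions\<close>

text \<open>The numerator is the flux that gets differentiated along rays. The field is a multiple
  of \<open>x - a\<close> rather than of a unit vector, so its value at the centre is
  \<open>0\<close>.\<close>

definition radial_field :: "'a::euclidean_space \<Rightarrow> real \<Rightarrow> real \<Rightarrow> 'a \<Rightarrow> 'a" where
  "radial_field a A B x = ((A + B * norm (x - a) ^ DIM('a)) / norm (x - a) ^ DIM('a)) *\<^sub>R (x - a)"

lemma borel_measurable_radial_field [measurable]: "radial_field a A B \<in> borel_measurable borel"
  unfolding radial_field_def by measurable

lemma test_fun_continuous: "test_fun \<phi> G \<Longrightarrow> continuous_on UNIV \<phi>"
  unfolding test_fun_def
  by (auto intro!: continuous_at_imp_continuous_on has_derivative_continuous)

lemma test_fun_ray_derivative: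
  assumes "test_fun \<phi> G"
  shows "((\<lambda>r. \<phi> (a + r *\<^sub>R \<omega>)) has_real_derivative G (a + r *\<^sub>R \<omega>) \<bullet> \<omega>) (at r)"
proof -
  have "((\<lambda>r. a + r *\<^sub>R \<omega>) has_derivative (\<lambda>h. h *\<^sub>R \<omega>)) (at r)"
    by (auto intro!: derivative_eq_intros)
  moreover have "(\<phi> has_derivative (\<lambda>h. G (a + r *\<^sub>R \<omega>) \<bullet> h)) (at (a + r *\<^sub>R \<omega>))"
    using assms by (simp add: test_fun_def)
  ultimately have "((\<lambda>r. \<phi> (a + r *\<^sub>R \<omega>)) has_derivative (\<lambda>h. G (a + r *\<^sub>R \<omega>) \<bullet> (h *\<^sub>R \<omega>))) (at r)"
    using has_derivative_compose[of "\<lambda>r. a + r *\<^sub>R \<omega>"] by blast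
  then show ?thesis
    unfolding has_field_derivative_def by (rule has_derivative_eq_rhs) (auto simp: fun_eq_iff)
qed

lemma test_fun_bounded:
  assumes "test_fun \<phi> G"
  obtains N where "\<And>x. \<bar>\<phi> x\<bar> \<le> N"
proof -
  let ?S = "closure {x. \<phi> x \<noteq> 0}"
  have "compact (\<phi> ` ?S)"
    using assms test_fun_continuous[OF assms]
    by (intro compact_continuous_image) (auto simp: test_fun_def intro: continuous_on_subset)
  then obtain N where N: "\<forall>y\<in>\<phi> ` ?S. norm y \<le> N" using compact_imp_bounded bounded_iff by blast
  have "\<bar>\<phi> x\<bar> \<le> max N 0" for x
    using N closure_subset[of "{x. \<phi> x \<noteq> 0}"] by (cases "\<phi> x = 0") force+
  then show thesis by (rule that)
qed

lemma integrable_cone_measure_test_fun: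
  assumes "test_fun \<phi> G"
  shows "integrable cone_measure (\<lambda>\<omega>. \<phi> (a + R *\<^sub>R \<omega>))"
proof -
  obtain N where N: "\<And>x. \<bar>\<phi> x\<bar> \<le> N" using test_fun_bounded[OF assms] by blast
  have [measurable]: "\<phi> \<in> borel_measurable borel"
    by (intro borel_measurable_continuous_onI test_fun_continuous[OF assms])
  show ?thesis
    using N by (intro finite_measure.integrable_const_bound[OF finite_measure_cone_measure, of _ N]) auto
qed

lemma AE_cone_measure_norm: "AE \<omega> in cone_measure. norm \<omega> = 1"
proof (rule AE_I)
  show "{\<omega> \<in> space cone_measure. norm \<omega> \<noteq> 1} \<subseteq> - sphere 0 1" by auto
  show "emeasure cone_measure (- sphere (0::'a) 1) = 0" by (rule emeasure_cone_measure_outside) auto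
qed auto

lemma integral_lborel_translate:
  fixes f :: "'a::euclidean_space \<Rightarrow> real"
  assumes [measurable]: "f \<in> borel_measurable borel"
  shows "(\<integral>x. f (c + x) \<partial>lborel) = (\<integral>x. f x \<partial>lborel)"
    and "integrable lborel (\<lambda>x. f (c + x)) \<longleftrightarrow> integrable lborel f"
proof -
  have "(\<integral>x. f x \<partial>lborel) = (\<integral>x. f x \<partial>distr lborel borel ((+) c))" by (simp add: lborel_distr_plus)
  then show "(\<integral>x. f (c + x) \<partial>lborel) = (\<integral>x. f x \<partial>lborel)" by (simp add: integral_distr)
  have "integrable lborel f \<longleftrightarrow> integrable (distr lborel borel ((+) c)) f" by (simp add: lborel_distr_plus)
  then show "integrable lborel (\<lambda>x. f (c + x)) \<longleftrightarrow> integrable lborel f" by (simp add: integrable_distr_eq)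
qed

lemma set_integral_lebesgue_eq_lborel:
  fixes f :: "'a::euclidean_space \<Rightarrow> real"
  assumes [measurable]: "U \<in> sets borel" "f \<in> borel_measurable borel"
  shows "set_lebesgue_integral lebesgue U f = set_lebesgue_integral lborel U f"
  unfolding set_lebesgue_integral_def by (rule integral_completion) measurable

text \<open>The radial part of \<open>radial_field a A B\<close> times \<open>r ^ (n - 1)\<close> is \<open>A + B * r ^ n\<close>, so in polar
  coordinates the integrand is the derivative of \<open>(A + B * r ^ n) * \<phi> (a + r *\<^sub>R \<omega>)\<close>.
  A negative inner radius \<open>c\<close> gives the full ball.\<close>
lemma Gauss_Green_radial:
  fixes a :: "'a::euclidean_space"
  assumes \<phi>: "test_fun \<phi> G" and R0: "R0 = max c 0" and R01: "R0 < R1"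
    and U: "U = {x. c < dist a x \<and> dist a x < R1}"
    and bnd: "\<And>x. x \<in> U \<Longrightarrow> norm (radial_field a A B x) \<le> 1"
  shows "(\<integral>x\<in>U. radial_field a A B x \<bullet> G x \<partial>lebesgue) + (\<integral>x\<in>U. (real DIM('a) * B) * \<phi> x \<partial>lebesgue)
    = (A + B * R1 ^ DIM('a)) * (\<integral>\<omega>. \<phi> (a + R1 *\<^sub>R \<omega>) \<partial>cone_measure)
      - (A + B * R0 ^ DIM('a)) * (\<integral>\<omega>. \<phi> (a + R0 *\<^sub>R \<omega>) \<partial>cone_measure)"
proof -
  let ?n = "DIM('a)"
  let ?Z = "radial_field a A B"
  have cont: "continuous_on UNIV \<phi>" "continuous_on UNIV G"
    using \<phi> test_fun_continuous by (auto simp: test_fun_def)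
  have [measurable]: "\<phi> \<in> borel_measurable borel" "G \<in> borel_measurable borel"
    using cont by (auto intro: borel_measurable_continuous_onI)
  have Um [measurable]: "U \<in> sets borel" unfolding U by measurable
  have comp: "compact (cball a R1)" by simp
  obtain M where M: "\<forall>x\<in>cball a R1. norm (G x) \<le> M"
    using compact_imp_bounded[OF compact_continuous_image[OF continuous_on_subset[OF cont(2)] comp]]
    by (auto simp: bounded_iff)
  obtain N where N: "\<And>x. \<bar>\<phi> x\<bar> \<le> N" using test_fun_bounded[OF \<phi>] by blast
  have Ufin: "emeasure lborel U < \<infinity>"
  proof -
    have "emeasure lborel U \<le> emeasure lborel (ball a R1)" by (intro emeasure_mono) (auto simp: U)
    also have "\<dots> < \<infinity>" by (rule emeasure_lborel_ball_finite)
    finally show ?thesis .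
  qed
  have UsubB: "U \<subseteq> cball a R1" by (auto simp: U)
  \<comment> \<open>The pointwise bound on the field gives integrability up to the boundary and near
    a possible singularity at the centre; the polar formula requires it.\<close>
  have int1: "set_integrable lborel U (\<lambda>x. ?Z x \<bullet> G x)"
    unfolding set_integrable_def
  proof (rule integrableI_bounded_set_indicator[where B=M])
    have "norm (?Z x \<bullet> G x) \<le> M" if "x \<in> U" for x
    proof -
      have "norm (?Z x \<bullet> G x) \<le> norm (?Z x) * norm (G x)" by (simp add: Cauchy_Schwarz_ineq2)
      also have "\<dots> \<le> 1 * M" using bnd[OF that] M UsubB that by (intro mult_mono) auto
      finally show ?thesis by simp
    qed
    then show "AE x in lborel. x \<in> U \<longrightarrow> norm (?Z x \<bullet> G x) \<le> M" by simp
  qed (use Ufin in auto)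
  have int2: "set_integrable lborel U (\<lambda>x. real ?n * B * \<phi> x)"
    unfolding set_integrable_def
  proof (rule integrableI_bounded_set_indicator[where B="\<bar>real ?n * B\<bar> * N"])
    show "AE x in lborel. x \<in> U \<longrightarrow> norm (real ?n * B * \<phi> x) \<le> \<bar>real ?n * B\<bar> * N"
      using N by (auto simp: abs_mult intro!: mult_left_mono)
  qed (use Ufin in auto)
  define g where "g x = indicator U x *\<^sub>R (?Z x \<bullet> G x + real ?n * B * \<phi> x)" for x
  have g_meas [measurable]: "g \<in> borel_measurable borel" unfolding g_def by measurable
  have g_int: "integrable lborel g"
    using set_integral_add(1)[OF int1 int2] by (simp add: g_def[abs_def] set_integrable_def)
  have "(\<integral>x\<in>U. ?Z x \<bullet> G x \<partial>lebesgue) + (\<integral>x\<in>U. (real ?n * B) * \<phi> x \<partial>lebesgue)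
      = (\<integral>x\<in>U. ?Z x \<bullet> G x \<partial>lborel) + (\<integral>x\<in>U. (real ?n * B) * \<phi> x \<partial>lborel)"
    by (simp add: set_integral_lebesgue_eq_lborel)
  also have "\<dots> = (\<integral>x. g x \<partial>lborel)"
    using set_integral_add(2)[OF int1 int2] by (simp add: g_def set_lebesgue_integral_def)
  also have "\<dots> = (\<integral>x. g (a + x) \<partial>lborel)" by (simp add: integral_lborel_translate)
  also have "\<dots> = (\<integral>\<omega>. (\<integral>r. indicator {0<..} r * (r ^ (?n - 1) * g (a + r *\<^sub>R \<omega>)) \<partial>lborel) \<partial>cone_measure)"
    by (rule integral_polar) (simp add: integral_lborel_translate g_int)
  also have "\<dots> = (\<integral>\<omega>. (A + B * R1 ^ ?n) * \<phi> (a + R1 *\<^sub>R \<omega>) - (A + B * R0 ^ ?n) * \<phi> (a + R0 *\<^sub>R \<omega>) \<partial>cone_measure)"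
  proof (rule integral_cong_AE)
    show "AE \<omega> in cone_measure. (\<integral>r. indicator {0<..} r * (r ^ (?n - 1) * g (a + r *\<^sub>R \<omega>)) \<partial>lborel)
      = (A + B * R1 ^ ?n) * \<phi> (a + R1 *\<^sub>R \<omega>) - (A + B * R0 ^ ?n) * \<phi> (a + R0 *\<^sub>R \<omega>)"
      using AE_cone_measure_norm
    proof eventually_elim
      fix \<omega> :: 'a assume \<omega>: "norm \<omega> = 1"
      \<comment> \<open>\<open>D\<close> is continuous on the whole line, even where the field is
        singular, so the fundamental theorem applies on the closed interval \<open>{R0..R1}\<close>.
        It agrees with the integrand off the endpoints, which form a null set.\<close>
      define D where "D r = (real ?n * B * r ^ (?n - 1)) * \<phi> (a + r *\<^sub>R \<omega>) + (A + B * r ^ ?n) * (G (a + r *\<^sub>R \<omega>) \<bullet> \<omega>)" for r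
      have D_cont: "continuous_on UNIV D"
        unfolding D_def
        by (intro continuous_intros continuous_on_compose2[OF cont(1)] continuous_on_compose2[OF cont(2)]) auto
      have D_eq: "r ^ (?n - 1) * g (a + r *\<^sub>R \<omega>) = D r" if r: "0 < r" "R0 < r" "r < R1" for r
      proof -
        have "a + r *\<^sub>R \<omega> \<in> U" using r \<omega> R0 by (auto simp: U dist_norm)
        moreover have "?Z (a + r *\<^sub>R \<omega>) = ((A + B * r ^ ?n) / r ^ ?n * r) *\<^sub>R \<omega>"
          using r \<omega> by (simp add: radial_field_def)
        moreover have "r ^ ?n = r ^ (?n - 1) * r" using power_minus_mult[of ?n r] by simp
        ultimately show ?thesis
          using r by (simp add: g_def D_def inner_commute field_simps)
      qed
      have g0: "g (a + r *\<^sub>R \<omega>) = 0" if "0 < r" "r < R0 \<or> R1 < r" for r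
      proof -
        have "dist a (a + r *\<^sub>R \<omega>) = r" using that \<omega> by (simp add: dist_norm)
        then have "a + r *\<^sub>R \<omega> \<notin> U" using that R0 by (auto simp: U)
        then show ?thesis by (simp add: g_def)
      qed
      have "(\<integral>r. indicator {0<..} r * (r ^ (?n - 1) * g (a + r *\<^sub>R \<omega>)) \<partial>lborel) = (\<integral>r. indicator {R0..R1} r *\<^sub>R D r \<partial>lborel)"
      proof (rule integral_cong_AE)
        show "(\<lambda>r. indicator {R0..R1} r *\<^sub>R D r) \<in> borel_measurable lborel"
          using borel_measurable_continuous_onI[OF D_cont] by simp
        have "AE r in lborel. r \<noteq> R0 \<and> r \<noteq> R1" by (intro AE_conjI AE_lborel_singleton)
        then show "AE r in lborel. indicator {0<..} r * (r ^ (?n - 1) * g (a + r *\<^sub>R \<omega>)) = indicator {R0..R1} r *\<^sub>R D r"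
        proof eventually_elim
          fix r assume r: "r \<noteq> R0 \<and> r \<noteq> R1"
          have R00: "0 \<le> R0" using R0 by simp
          consider "r \<le> 0" | "0 < r" "r < R0 \<or> R1 < r" | "0 < r" "R0 < r" "r < R1" using r by linarith
          then show "indicator {0<..} r * (r ^ (?n - 1) * g (a + r *\<^sub>R \<omega>)) = indicator {R0..R1} r *\<^sub>R D r"
          proof cases
            case 1
            then show ?thesis using r R00 by (auto simp: indicator_def)
          next
            case 2
            then show ?thesis using g0[OF 2] by (auto simp: indicator_def)
          next
            case 3
            then show ?thesis using D_eq[OF 3] by (auto simp: indicator_def)
          qed
        qed
      qed measurable
      also have "\<dots> = (A + B * R1 ^ ?n) * \<phi> (a + R1 *\<^sub>R \<omega>) - (A + B * R0 ^ ?n) * \<phi> (a + R0 *\<^sub>R \<omega>)"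
      proof (rule integral_FTC_Icc)
        show "R0 \<le> R1" using R01 by simp
        show "continuous_on {R0..R1} D" using D_cont by (rule continuous_on_subset) simp
        fix r
        have "((\<lambda>r. (A + B * r ^ ?n) * \<phi> (a + r *\<^sub>R \<omega>)) has_real_derivative D r) (at r)"
          unfolding D_def
          by (rule derivative_eq_intros test_fun_ray_derivative[OF \<phi>] refl | simp)+
        then show "((\<lambda>r. (A + B * r ^ ?n) * \<phi> (a + r *\<^sub>R \<omega>)) has_vector_derivative D r) (at r within {R0..R1})"
          by (auto simp: has_real_derivative_iff_has_vector_derivative intro: has_vector_derivative_at_within)
      qed
      finally show "(\<integral>r. indicator {0<..} r * (r ^ (?n - 1) * g (a + r *\<^sub>R \<omega>)) \<partial>lborel)
        = (A + B * R1 ^ ?n) * \<phi> (a + R1 *\<^sub>R \<omega>) - (A + B * R0 ^ ?n) * \<phi> (a + R0 *\<^sub>R \<omega>)" .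
    qed
  qed measurable
  also have "\<dots> = (A + B * R1 ^ ?n) * (\<integral>\<omega>. \<phi> (a + R1 *\<^sub>R \<omega>) \<partial>cone_measure)
      - (A + B * R0 ^ ?n) * (\<integral>\<omega>. \<phi> (a + R0 *\<^sub>R \<omega>) \<partial>cone_measure)"
    using integrable_cone_measure_test_fun[OF \<phi>] by simp
  finally show ?thesis .
qed


section \<open>Radial calibrations\<close>

text \<open>The trace identity contains the weak divergence: a test function supported inside the
  open set \<open>U\<close> vanishes on \<open>frontier U\<close>, which kills the boundary
  integral. With a constant divergence only the bound and the trace remain to be checked.\<close>

lemma calibration_const_div:
  fixes Z :: "'a::euclidean_space \<Rightarrow> 'a"
  assumes U: "open U" and Z [measurable]: "Z \<in> borel_measurable borel"
    and bnd: "\<And>x. x \<in> U \<Longrightarrow> norm (Z x) \<le> 1" and trace: "normal_trace_is Z (\<lambda>_. d) U \<sigma>"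
  shows "calibration U \<sigma> Z (\<lambda>_. d)"
proof -
  have [measurable]: "U \<in> sets borel" using U by simp
  have const: "set_integrable lebesgue K (\<lambda>_. c)" if "compact K" for K :: "'a set" and c :: real
    unfolding set_integrable_def
    using lmeasurable_compact[OF that]
    by (intro integrable_scaleR_left integrable_real_indicator) (auto simp: fmeasurable_def)
  have weak: "(\<integral>x\<in>U. Z x \<bullet> G x \<partial>lebesgue) = - (\<integral>x\<in>U. d * \<phi> x \<partial>lebesgue)"
    if \<phi>: "test_fun \<phi> G" and sub: "closure {x. \<phi> x \<noteq> 0} \<subseteq> U" for \<phi> G
  proof -
    have "\<phi> x = 0" if "x \<in> frontier U" for x
      using that sub closure_subset[of "{x. \<phi> x \<noteq> 0}"] frontier_disjoint_eq[of U] U by blast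
    then have "set_lebesgue_integral (hausdorff_measure (real DIM('a) - 1)) (frontier U) (\<lambda>x. \<sigma> x * \<phi> x) = 0"
      unfolding set_lebesgue_integral_def by (intro integral_eq_zero_AE) (auto simp: indicator_def)
    then show ?thesis using trace[unfolded normal_trace_is_def, rule_format, OF \<phi>] by simp
  qed
  have "(\<lambda>x. indicator U x *\<^sub>R Z x) \<in> borel_measurable lborel" by measurable
  then have "(\<lambda>x. indicator U x *\<^sub>R Z x) \<in> borel_measurable lebesgue" by (rule measurable_completion)
  moreover have "(\<lambda>x. indicator U x *\<^sub>R d) \<in> borel_measurable lborel" by measurable
  then have "(\<lambda>x. indicator U x *\<^sub>R d) \<in> borel_measurable lebesgue" by (rule measurable_completion)
  ultimately show ?thesis
    unfolding calibration_def set_borel_measurable_def L2_loc_def has_weak_div_def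
    using bnd trace weak const by auto
qed

lemma norm_radial_field:
  assumes "x \<noteq> a"
  shows "norm (radial_field a A B (x::'a::euclidean_space))
    = \<bar>A + B * norm (x - a) ^ DIM('a)\<bar> / norm (x - a) ^ (DIM('a) - 1)"
proof -
  have "norm (x - a) ^ DIM('a) = norm (x - a) ^ (DIM('a) - 1) * norm (x - a)"
    using power_minus_mult[of "DIM('a)" "norm (x - a)"] by simp
  then show ?thesis using assms by (simp add: radial_field_def abs_mult)
qed

lemma set_integral_hausdorff_sphere_test_fun:
  assumes \<phi>: "test_fun \<phi> G" and R: "R > 0"
  shows "set_lebesgue_integral (hausdorff_measure (real DIM('a) - 1)) (sphere (a::'a::euclidean_space) R) (\<lambda>x. s * \<phi> x)
      = s * R ^ (DIM('a) - 1) * (\<integral>\<omega>. \<phi> (a + R *\<^sub>R \<omega>) \<partial>cone_measure)"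
    and "set_integrable (hausdorff_measure (real DIM('a) - 1)) (sphere a R) (\<lambda>x. s * \<phi> x)"
proof -
  have [measurable]: "\<phi> \<in> borel_measurable borel"
    by (intro borel_measurable_continuous_onI test_fun_continuous[OF \<phi>])
  have m: "(\<lambda>x. s * \<phi> x) \<in> borel_measurable borel" by measurable
  show "set_lebesgue_integral (hausdorff_measure (real DIM('a) - 1)) (sphere a R) (\<lambda>x. s * \<phi> x)
      = s * R ^ (DIM('a) - 1) * (\<integral>\<omega>. \<phi> (a + R *\<^sub>R \<omega>) \<partial>cone_measure)"
    by (subst set_integral_hausdorff_sphere(1)[OF R m]) simp
  show "set_integrable (hausdorff_measure (real DIM('a) - 1)) (sphere a R) (\<lambda>x. s * \<phi> x)"
    by (subst set_integral_hausdorff_sphere(2)[OF R m]) (simp add: integrable_cone_measure_test_fun[OF \<phi>])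
qed

lemma test_fun_gradient_zero:
  assumes "test_fun \<phi> G" "x \<notin> closure {x. \<phi> x \<noteq> 0}"
  shows "G x = 0"
proof -
  let ?V = "- closure {x. \<phi> x \<noteq> 0}"
  have "(\<phi> has_derivative (\<lambda>h. G x \<bullet> h)) (at x)" using assms by (simp add: test_fun_def)
  moreover have "open ?V" "x \<in> ?V" using assms by auto
  moreover have "\<phi> y = 0" if "y \<in> ?V" for y
    using that closure_subset[of "{x. \<phi> x \<noteq> 0}"] by blast
  ultimately have "((\<lambda>_. 0) has_derivative (\<lambda>h. G x \<bullet> h)) (at x)"
    by (rule has_derivative_transform_within_open)
  then have "(\<lambda>h. G x \<bullet> h) = (\<lambda>_. 0)"
    using has_derivative_unique has_derivative_const by blast
  then have "G x \<bullet> G x = 0" by metis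
  then show ?thesis by simp
qed

section \<open>Balls, exteriors and annuli\<close>

text \<open>With \<open>A = 0\<close> the field is \<open>(s / R) *\<^sub>R (x - a)\<close>, which
  has norm \<open>norm (x - a) / R\<close> and equals \<open>s\<close> times the outer normal on the
  boundary.\<close>

lemma calibration_ball:
  fixes a :: "'a::euclidean_space"
  assumes R: "R > 0" and s: "s \<in> {-1, 1}"
  shows "calibration (ball a R) (\<lambda>_. s) (radial_field a 0 (s / R)) (\<lambda>_. real DIM('a) * (s / R))"
proof (rule calibration_const_div)
  have pow: "R ^ DIM('a) = R ^ (DIM('a) - 1) * R"
    using power_minus_mult[of "DIM('a)" R] by simp
  show bnd: "norm (radial_field a 0 (s / R) x) \<le> 1" if x: "x \<in> ball a R" for x
  proof (cases "x = a")
    case False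
    let ?r = "norm (x - a)"
    have "?r ^ DIM('a) = ?r ^ (DIM('a) - 1) * ?r" using power_minus_mult[of "DIM('a)" ?r] by simp
    then have "norm (radial_field a 0 (s / R) x) = ?r / R"
      using False s R by (auto simp: norm_radial_field abs_mult)
    then show ?thesis using x R by (simp add: dist_norm norm_minus_commute)
  qed (simp add: radial_field_def)
  show "normal_trace_is (radial_field a 0 (s / R)) (\<lambda>_. real DIM('a) * (s / R)) (ball a R) (\<lambda>_. s)"
    unfolding normal_trace_is_def
  proof (intro allI impI)
    fix \<phi> G assume \<phi>: "test_fun \<phi> (G :: 'a \<Rightarrow> 'a)"
    \<comment> \<open>The inner radius \<open>- 1\<close> includes the centre in the domain; the
      corresponding boundary term vanishes because \<open>A = 0\<close>.\<close>
    have U: "ball a R = {x. - 1 < dist a x \<and> dist a x < R}" by (auto intro: less_le_trans[OF _ zero_le_dist])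
    have "(\<integral>x\<in>ball a R. radial_field a 0 (s / R) x \<bullet> G x \<partial>lebesgue) + (\<integral>x\<in>ball a R. (real DIM('a) * (s / R)) * \<phi> x \<partial>lebesgue)
      = (0 + s / R * R ^ DIM('a)) * (\<integral>\<omega>. \<phi> (a + R *\<^sub>R \<omega>) \<partial>cone_measure)
       - (0 + s / R * 0 ^ DIM('a)) * (\<integral>\<omega>. \<phi> (a + 0 *\<^sub>R \<omega>) \<partial>cone_measure)"
      by (rule Gauss_Green_radial[OF \<phi> _ R U bnd]) auto
    also have "\<dots> = s * R ^ (DIM('a) - 1) * (\<integral>\<omega>. \<phi> (a + R *\<^sub>R \<omega>) \<partial>cone_measure)"
      using R by (simp add: pow zero_power)
    also have "\<dots> = set_lebesgue_integral (hausdorff_measure (real DIM('a) - 1)) (frontier (ball a R)) (\<lambda>x. s * \<phi> x)"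
      by (simp only: frontier_ball[OF R] set_integral_hausdorff_sphere_test_fun(1)[OF \<phi> R])
    finally show "(\<integral>x\<in>ball a R. radial_field a 0 (s / R) x \<bullet> G x \<partial>lebesgue) + (\<integral>x\<in>ball a R. (real DIM('a) * (s / R)) * \<phi> x \<partial>lebesgue)
      = set_lebesgue_integral (hausdorff_measure (real DIM('a) - 1)) (frontier (ball a R)) (\<lambda>x. s * \<phi> x)" .
  qed
qed auto

text \<open>The profile \<open>- s * (R / r) ^ (DIM('a) - 1)\<close> is bounded by \<open>1\<close>
  for \<open>r > R\<close>; the sign is negative because the outer normal points to
  \<open>a\<close>. Compact support reduces the unbounded domain to an annulus with outer radius
  \<open>M > R\<close>, on whose outer sphere the test function vanishes.\<close>

lemma calibration_exterior:
  fixes a :: "'a::euclidean_space"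
  assumes R: "R > 0" and s: "s \<in> {-1, 1}"
  shows "calibration (- cball a R) (\<lambda>_. s) (radial_field a (- s * R ^ (DIM('a) - 1)) 0) (\<lambda>_. 0)"
proof (rule calibration_const_div)
  let ?U = "- cball a R" and ?A = "- s * R ^ (DIM('a) - 1)"
  show bnd: "norm (radial_field a ?A 0 x) \<le> 1" if x: "x \<in> ?U" for x
  proof -
    have r: "R < norm (x - a)" using x by (simp add: dist_norm norm_minus_commute)
    then have "x \<noteq> a" using R by auto
    then have "norm (radial_field a ?A 0 x) = R ^ (DIM('a) - 1) / norm (x - a) ^ (DIM('a) - 1)"
      using s R by (auto simp: norm_radial_field abs_mult)
    also have "\<dots> \<le> 1"
    proof -
      have "0 < norm (x - a)" using r R by linarith
      then have "0 < norm (x - a) ^ (DIM('a) - 1)" by (rule zero_less_power)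
      moreover have "R ^ (DIM('a) - 1) \<le> norm (x - a) ^ (DIM('a) - 1)" using r R by (intro power_mono) auto
      ultimately show ?thesis by (simp only: divide_le_eq_1_pos)
    qed
    finally show ?thesis .
  qed
  show "normal_trace_is (radial_field a ?A 0) (\<lambda>_. 0) ?U (\<lambda>_. s)"
    unfolding normal_trace_is_def
  proof (intro allI impI)
    fix \<phi> G assume \<phi>: "test_fun \<phi> (G :: 'a \<Rightarrow> 'a)"
    have "bounded (closure {x. \<phi> x \<noteq> 0})" using \<phi> by (simp add: test_fun_def compact_imp_bounded)
    then obtain M0 where M0: "closure {x. \<phi> x \<noteq> 0} \<subseteq> ball a M0" using bounded_subset_ballD by blast
    define M where "M = max M0 (R + 1)"
    have M: "closure {x. \<phi> x \<noteq> 0} \<subseteq> ball a M" "R < M"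
      using M0 subset_ball[of M0 M a] by (auto simp: M_def)
    have out: "\<phi> x = 0" "G x = 0" if "M \<le> dist a x" for x
    proof -
      have "x \<notin> closure {x. \<phi> x \<noteq> 0}" using M(1) that by auto
      then show "\<phi> x = 0" "G x = 0"
        using closure_subset[of "{x. \<phi> x \<noteq> 0}"] test_fun_gradient_zero[OF \<phi>] by auto
    qed
    let ?V = "{x. R < dist a x \<and> dist a x < M}"
    have "(\<integral>x\<in>?U. radial_field a ?A 0 x \<bullet> G x \<partial>lebesgue) = (\<integral>x\<in>?V. radial_field a ?A 0 x \<bullet> G x \<partial>lebesgue)"
      unfolding set_lebesgue_integral_def
      by (intro Bochner_Integration.integral_cong) (auto simp: indicator_def out not_less)
    moreover have "(\<integral>x\<in>?V. radial_field a ?A 0 x \<bullet> G x \<partial>lebesgue) + (\<integral>x\<in>?V. (real DIM('a) * 0) * \<phi> x \<partial>lebesgue)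
      = (?A + 0 * M ^ DIM('a)) * (\<integral>\<omega>. \<phi> (a + M *\<^sub>R \<omega>) \<partial>cone_measure)
       - (?A + 0 * R ^ DIM('a)) * (\<integral>\<omega>. \<phi> (a + R *\<^sub>R \<omega>) \<partial>cone_measure)"
      using R by (intro Gauss_Green_radial[OF \<phi> _ M(2) refl] bnd) auto
    moreover have "(\<integral>\<omega>. \<phi> (a + M *\<^sub>R \<omega>) \<partial>cone_measure) = 0"
    proof (rule integral_eq_zero_AE)
      show "AE \<omega> in cone_measure. \<phi> (a + M *\<^sub>R \<omega>) = 0"
        using AE_cone_measure_norm by eventually_elim (use M R in \<open>simp add: out dist_norm\<close>)
    qed
    ultimately have "(\<integral>x\<in>?U. radial_field a ?A 0 x \<bullet> G x \<partial>lebesgue) + (\<integral>x\<in>?U. 0 * \<phi> x \<partial>lebesgue)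
      = s * R ^ (DIM('a) - 1) * (\<integral>\<omega>. \<phi> (a + R *\<^sub>R \<omega>) \<partial>cone_measure)"
      by simp
    also have "\<dots> = set_lebesgue_integral (hausdorff_measure (real DIM('a) - 1)) (frontier ?U) (\<lambda>x. s * \<phi> x)"
      by (simp only: frontier_complement frontier_cball set_integral_hausdorff_sphere_test_fun(1)[OF \<phi> R])
    finally show "(\<integral>x\<in>?U. radial_field a ?A 0 x \<bullet> G x \<partial>lebesgue) + (\<integral>x\<in>?U. 0 * \<phi> x \<partial>lebesgue)
      = set_lebesgue_integral (hausdorff_measure (real DIM('a) - 1)) (frontier ?U) (\<lambda>x. s * \<phi> x)" .
  qed
qed auto

lemma frontier_annulus:
  fixes a :: "'a::euclidean_space"
  assumes "0 < R0" "R0 < R1"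
  shows "frontier (ball a R1 - cball a R0) = sphere a R0 \<union> sphere a R1"
proof -
  let ?U = "ball a R1 - cball a R0"
  have "open ?U" by (intro open_Diff) auto
  then have fr: "frontier ?U = closure ?U - ?U" by (simp add: frontier_def interior_open)
  have "closure ?U \<subseteq> cball a R1 - ball a R0"
  proof (rule closure_minimal)
    show "closed (cball a R1 - ball a R0)" by (intro closed_Diff) auto
  qed auto
  then have "frontier ?U \<subseteq> sphere a R0 \<union> sphere a R1" unfolding fr by auto
  moreover have "sphere a R1 \<subseteq> closure ?U"
  proof -
    have "(- cball a R0) \<inter> closure (ball a R1) \<subseteq> closure ((- cball a R0) \<inter> ball a R1)"
      by (rule open_Int_closure_subset) auto
    moreover have "(- cball a R0) \<inter> ball a R1 = ?U" by auto
    ultimately show ?thesis using assms by auto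
  qed
  moreover have "sphere a R0 \<subseteq> closure ?U"
  proof -
    have "ball a R1 \<inter> closure (- cball a R0) \<subseteq> closure (ball a R1 \<inter> (- cball a R0))"
      by (rule open_Int_closure_subset) auto
    moreover have "ball a R1 \<inter> (- cball a R0) = ?U" by auto
    moreover have "closure (- cball a R0) = - ball a R0"
      by (simp add: closure_complement)
    ultimately show ?thesis using assms by auto
  qed
  ultimately show ?thesis using assms unfolding fr by auto
qed

text \<open>For \<open>A \<ge> 0\<close> the profile is convex on the interval, so its maximum is
  attained at an endpoint. The lower bound needs a different reason: the profile is nonnegative for
  \<open>B \<ge> 0\<close> and decreasing for \<open>B < 0\<close>, when its minimum is the value at
  \<open>R1\<close>.\<close>

lemma radial_profile_le_one_of_nonneg:
  fixes A B :: real
  assumes R: "0 < R0" "R0 < R1" and r: "r \<in> {R0..R1}" and A: "0 \<le> A"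
    and bd0: "\<bar>A / R0 ^ k + B * R0\<bar> \<le> 1" and bd1: "\<bar>A / R1 ^ k + B * R1\<bar> \<le> 1"
  shows "\<bar>A / r ^ k + B * r\<bar> \<le> 1"
proof -
  define f where "f t = A / t ^ k + B * t" for t
  have "convex_on {R0..R1} f"
  proof (rule convex_on_realI)
    show "connected {R0..R1}" by simp
    fix x :: real assume x: "x \<in> {R0..R1}"
    then have "x > 0" using R by simp
    have "((\<lambda>t. A / t ^ k) has_real_derivative (0 * x ^ k - A * (real k * x ^ (k - Suc 0))) / (x ^ k * x ^ k)) (at x)"
      using \<open>x > 0\<close> by (intro DERIV_divide DERIV_const DERIV_pow) auto
    moreover have "(0 * x ^ k - A * (real k * x ^ (k - Suc 0))) / (x ^ k * x ^ k) = - (A * (real k / x ^ Suc k))"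
      using \<open>x > 0\<close> by (cases k) (auto simp: field_simps)
    ultimately have "(f has_real_derivative - (A * (real k / x ^ Suc k)) + B * 1) (at x)"
      unfolding f_def by (intro DERIV_add DERIV_cmult DERIV_ident) simp
    then show "(f has_real_derivative B - A * (real k / x ^ Suc k)) (at x)" by simp
    fix y :: real assume y: "y \<in> {R0..R1}" "x \<le> y"
    have "real k / y ^ Suc k \<le> real k / x ^ Suc k"
      using \<open>x > 0\<close> y by (intro divide_left_mono power_mono mult_pos_pos) auto
    then have "A * (real k / y ^ Suc k) \<le> A * (real k / x ^ Suc k)" using A by (rule mult_left_mono)
    then show "B - A * (real k / x ^ Suc k) \<le> B - A * (real k / y ^ Suc k)" by simp
  qed
  then have "f r \<le> max (f R0) (f R1)"
    using r by (intro convex_on_le_max)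
  then have "f r \<le> 1" using bd0 bd1 by (auto simp: f_def)
  moreover have "- 1 \<le> f r"
  proof (cases "B \<ge> 0")
    case True
    then have "0 \<le> f r" using A r R by (auto simp: f_def)
    then show ?thesis by simp
  next
    case False
    have "A / R1 ^ k \<le> A / r ^ k" using r R A by (intro divide_left_mono power_mono mult_pos_pos zero_less_power) auto
    moreover have "B * R1 \<le> B * r" using False r by (intro mult_left_mono_neg) auto
    ultimately have "f R1 \<le> f r" by (simp add: f_def)
    then show ?thesis using bd1 by (simp add: f_def)
  qed
  ultimately show ?thesis by (simp add: f_def)
qed


lemma radial_profile_le_one:
  fixes A B :: real
  assumes R: "0 < R0" "R0 < R1" and r: "r \<in> {R0..R1}"
    and bd: "\<bar>A / R0 ^ k + B * R0\<bar> \<le> 1" "\<bar>A / R1 ^ k + B * R1\<bar> \<le> 1"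
  shows "\<bar>A / r ^ k + B * r\<bar> \<le> 1"
proof (cases "0 \<le> A")
  case True
  then show ?thesis by (rule radial_profile_le_one_of_nonneg[OF R r _ bd])
next
  case False
  have neg: "\<bar>(- A) / t ^ k + (- B) * t\<bar> = \<bar>A / t ^ k + B * t\<bar>" for t
    using abs_minus_cancel[of "A / t ^ k + B * t"] by simp
  have "\<bar>(- A) / r ^ k + (- B) * r\<bar> \<le> 1"
    by (rule radial_profile_le_one_of_nonneg[OF R r]) (use False bd neg in auto)
  then show ?thesis unfolding neg .
qed

text \<open>\<open>A\<close> and \<open>B\<close> solve
  \<open>A + B * R1 ^ n = s1 * R1 ^ (n - 1)\<close> and
  \<open>A + B * R0 ^ n = - s0 * R0 ^ (n - 1)\<close> with \<open>n = DIM('a)\<close>. The profile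
  then takes the values \<open>s1\<close> and \<open>- s0\<close> at the two radii, and
  \<open>radial_profile_le_one\<close> carries the bound \<open>1\<close> to the interior.\<close>

lemma calibration_annulus:
  fixes a :: "'a::euclidean_space"
  assumes R: "0 < R0" "R0 < R1" and s: "s0 \<in> {-1, 1}" "s1 \<in> {-1, 1}"
  defines "B \<equiv> (s1 * R1 ^ (DIM('a) - 1) + s0 * R0 ^ (DIM('a) - 1)) / (R1 ^ DIM('a) - R0 ^ DIM('a))"
  defines "A \<equiv> s1 * R1 ^ (DIM('a) - 1) - B * R1 ^ DIM('a)"
  shows "calibration (ball a R1 - cball a R0) (\<lambda>x. if dist a x = R0 then s0 else s1)
    (radial_field a A B) (\<lambda>_. real DIM('a) * B)"
proof (rule calibration_const_div)
  let ?k = "DIM('a) - 1" and ?n = "DIM('a)"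
  let ?U = "ball a R1 - cball a R0" and ?\<sigma> = "\<lambda>x. if dist a x = R0 then s0 else s1"
  have pow: "t ^ ?n = t ^ ?k * t" for t :: real using power_minus_mult[of ?n t] by simp
  have V1: "A + B * R1 ^ ?n = s1 * R1 ^ ?k" by (simp add: A_def)
  have "R0 ^ ?n < R1 ^ ?n" using R by (intro power_strict_mono) auto
  then have "B * (R1 ^ ?n - R0 ^ ?n) = s1 * R1 ^ ?k + s0 * R0 ^ ?k" by (simp add: B_def)
  then have V0: "A + B * R0 ^ ?n = - s0 * R0 ^ ?k" by (simp add: A_def algebra_simps)
  have quot: "A / t ^ ?k + B * t = (A + B * t ^ ?n) / t ^ ?k" if "t > 0" for t
    using that by (simp add: pow add_divide_distrib)
  show bnd: "norm (radial_field a A B x) \<le> 1" if x: "x \<in> ?U" for x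
  proof -
    let ?r = "norm (x - a)"
    have r: "R0 < ?r" "?r < R1" using x by (auto simp: dist_norm norm_minus_commute)
    have e1: "\<bar>A / R1 ^ ?k + B * R1\<bar> \<le> 1" using R s V1 by (subst quot) auto
    have e0: "\<bar>A / R0 ^ ?k + B * R0\<bar> \<le> 1" using R s V0 by (subst quot) auto
    have "?r > 0" "x \<noteq> a" using r R by auto
    then have "norm (radial_field a A B x) = \<bar>A / ?r ^ ?k + B * ?r\<bar>"
      by (simp only: norm_radial_field[OF \<open>x \<noteq> a\<close>] quot abs_divide power_abs abs_norm_cancel)
    also have "\<dots> \<le> 1" by (rule radial_profile_le_one[OF R _ e0 e1]) (use r in auto)
    finally show ?thesis .
  qed
  show "normal_trace_is (radial_field a A B) (\<lambda>_. real ?n * B) ?U ?\<sigma>"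
    unfolding normal_trace_is_def
  proof (intro allI impI)
    fix \<phi> G assume \<phi>: "test_fun \<phi> (G :: 'a \<Rightarrow> 'a)"
    let ?H = "hausdorff_measure (real ?n - 1) :: 'a measure"
    have R1: "R1 > 0" using R by simp
    have U: "?U = {x. R0 < dist a x \<and> dist a x < R1}" by auto
    have S: "sphere a r \<in> sets ?H" for r by (simp add: borel_closed)
    have on0: "\<forall>x. x \<in> sphere a R0 \<longrightarrow> ?\<sigma> x * \<phi> x = s0 * \<phi> x" by simp
    have on1: "\<forall>x. x \<in> sphere a R1 \<longrightarrow> ?\<sigma> x * \<phi> x = s1 * \<phi> x" using R by auto
    have i0: "set_integrable ?H (sphere a R0) (\<lambda>x. ?\<sigma> x * \<phi> x)"
      by (subst set_integrable_cong[OF refl refl on0[rule_format]])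
        (simp_all add: set_integral_hausdorff_sphere_test_fun(2)[OF \<phi> R(1)])
    have i1: "set_integrable ?H (sphere a R1) (\<lambda>x. ?\<sigma> x * \<phi> x)"
      by (subst set_integrable_cong[OF refl refl on1[rule_format]])
        (simp_all add: set_integral_hausdorff_sphere_test_fun(2)[OF \<phi> R1])
    have "set_lebesgue_integral ?H (frontier ?U) (\<lambda>x. ?\<sigma> x * \<phi> x)
      = set_lebesgue_integral ?H (sphere a R0) (\<lambda>x. ?\<sigma> x * \<phi> x) + set_lebesgue_integral ?H (sphere a R1) (\<lambda>x. ?\<sigma> x * \<phi> x)"
      unfolding frontier_annulus[OF R] using R by (intro set_integral_Un i0 i1) auto
    also have "\<dots> = set_lebesgue_integral ?H (sphere a R0) (\<lambda>x. s0 * \<phi> x) + set_lebesgue_integral ?H (sphere a R1) (\<lambda>x. s1 * \<phi> x)"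
      by (simp only: set_lebesgue_integral_cong[OF S on0] set_lebesgue_integral_cong[OF S on1])
    also have "\<dots> = s0 * R0 ^ ?k * (\<integral>\<omega>. \<phi> (a + R0 *\<^sub>R \<omega>) \<partial>cone_measure) + s1 * R1 ^ ?k * (\<integral>\<omega>. \<phi> (a + R1 *\<^sub>R \<omega>) \<partial>cone_measure)"
      by (simp only: set_integral_hausdorff_sphere_test_fun(1)[OF \<phi> R(1)] set_integral_hausdorff_sphere_test_fun(1)[OF \<phi> R1])
    also have "\<dots> = (A + B * R1 ^ ?n) * (\<integral>\<omega>. \<phi> (a + R1 *\<^sub>R \<omega>) \<partial>cone_measure)
       - (A + B * R0 ^ ?n) * (\<integral>\<omega>. \<phi> (a + R0 *\<^sub>R \<omega>) \<partial>cone_measure)"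
      unfolding V0 V1 by simp
    also have "\<dots> = (\<integral>x\<in>?U. radial_field a A B x \<bullet> G x \<partial>lebesgue) + (\<integral>x\<in>?U. (real ?n * B) * \<phi> x \<partial>lebesgue)"
      using R by (intro Gauss_Green_radial[OF \<phi> _ R(2) U bnd, symmetric]) auto
    finally show "(\<integral>x\<in>?U. radial_field a A B x \<bullet> G x \<partial>lebesgue) + (\<integral>x\<in>?U. (real ?n * B) * \<phi> x \<partial>lebesgue)
      = set_lebesgue_integral ?H (frontier ?U) (\<lambda>x. ?\<sigma> x * \<phi> x)" ..
  qed
  show "open ?U" by (intro open_Diff) auto
qed auto

lemma signature_const: "s \<in> {-1, 1} \<Longrightarrow> signature U (\<lambda>_. s)"
  by (auto simp: signature_def)

lemma signature_annulus:
  assumes R: "0 < R0" "R0 < R1" and s: "s0 \<in> {-1, 1}" "s1 \<in> {-1, 1}"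
  shows "signature (ball a R1 - cball a R0) (\<lambda>x. if dist a x = R0 then s0 else s1)"
proof -
  have "continuous_on (sphere a R0 \<union> sphere a R1) (\<lambda>x. if dist a x = R0 then s0 else s1)"
    using R by (intro continuous_on_cases) auto
  then show ?thesis using s by (auto simp: signature_def frontier_annulus[OF R])
qed

theorem theorem3p7:
  fixes a :: "'a::euclidean_space"
  shows
    "(\<forall>R s. R > 0 \<and> s \<in> {-1, 1} \<longrightarrow> calibrable11 (ball a R) (\<lambda>_. s)) \<and>
     (\<forall>R s. R > 0 \<and> s \<in> {-1, 1} \<longrightarrow>
        calibrable11 (- cball a R) (\<lambda>_. s) \<and>
        (\<exists>Z g. calibration (- cball a R) (\<lambda>_. s) Z g \<and>
               (AE x in lebesgue. x \<in> - cball a R \<longrightarrow> g x = 0))) \<and>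
     (\<forall>R0 R1 s0 s1. 0 < R0 \<and> R0 < R1 \<and> s0 \<in> {-1, 1} \<and> s1 \<in> {-1, 1} \<longrightarrow>
        calibrable11 (ball a R1 - cball a R0)
          (\<lambda>x. if dist a x = R0 then s0 else s1))"
proof (intro conjI allI impI; elim conjE)
  fix R s :: real assume "R > 0" "s \<in> {-1, 1}"
  then show "calibrable11 (ball a R) (\<lambda>_. s)"
    unfolding calibrable11_def using signature_const calibration_ball by blast
next
  fix R s :: real assume "R > 0" "s \<in> {-1, 1}"
  note cal = calibration_exterior[OF this]
  show "calibrable11 (- cball a R) (\<lambda>_. s)"
    unfolding calibrable11_def using signature_const[OF \<open>s \<in> {-1, 1}\<close>] cal by blast
  show "\<exists>Z g. calibration (- cball a R) (\<lambda>_. s) Z g \<and> (AE x in lebesgue. x \<in> - cball a R \<longrightarrow> g x = 0)"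
    using cal by (intro exI conjI) auto
next
  fix R0 R1 s0 s1 :: real
  assume *: "0 < R0" "R0 < R1" "s0 \<in> {-1, 1}" "s1 \<in> {-1, 1}"
  show "calibrable11 (ball a R1 - cball a R0) (\<lambda>x. if dist a x = R0 then s0 else s1)"
    unfolding calibrable11_def using signature_annulus[OF *] calibration_annulus[OF *] by blast
qed

end
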